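(* Let $d\ge 1$ be an integer and consider the parking model on $\mathbb{Z}^d$ with parameter $p\in[0,1]$ and law $\mathbb{P}_p$. Let $\tau$ be the parking time of the car initially at the origin (with $\tau=0$ if no car starts at the origin). (i) For any $p>0$, there exists $C_1>0$ such that \[ \mathbb{P}_p(\tau>t)\ \ge\ \exp\left(-C_1 t^{\frac{d}{d+2}}\right)\qquad\text{for all integers } t\ge 1 . \] (ii) Let \[ p_0=\begin{cases}\frac12 & \text{if } d=1,\\[2pt] \frac12\left[1-\sqrt{1-(de)^{-2}}\right] & \text{if } d\ge 2,\end{cases} \] where $e$ is the base of the natural logarithm. If $p\in[0,p_0)$, then for some $c_2=c_2(p)>0$, \[ \mathbb{P}_p(\tau>t)\ \le\ p\,\exp\left(-c_2\, t^{\frac{d}{d+2}}\right)\qquad\text{for all integers } t\ge 1, \] where $c_2(p)$ is bounded away from $0$ on every closed subinterval of $[0,p_0)$.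
   Context: Parking model on $\mathbb{Z}^d$ with parameter $p\in[0,1]$. The probability space is $\Omega=\left(\{-1,1\}\times(\mathbb{Z}^d)^{\mathbb{N}}\times[0,1]^{\mathbb{N}}\right)^{\mathbb{Z}^d}$ with a probability measure $\mathbb{P}_p$ under which the following are all independent, over all vertices $v\in\mathbb{Z}^d$ and over the three components at each $v$: (1) a variable equal to $1$ with probability $p$ (a car is initially at $v$) and $-1$ with probability $1-p$ (there is initially a vacant parking spot at $v$, and no car); (2) a discrete-time simple symmetric random walk path on $\mathbb{Z}^d$ started at $v$ (each step is to a uniformly chosen nearest neighbor), which is the path followed by the car starting at $v$ (if any) as long as it is unparked; (3) a sequence $(U^{(v)}_t)_t$ of i.i.d. uniform $[0,1]$ random variables used to break ties. Dynamics: at time $0$ all cars are unparked. At each time $t=1,2,\dots$, every car that is unparked at time $t-1$ simultaneously moves to the time-$t$ position of its random walk path. If at time $t$ at least one such car arrives at a vertex with a vacant parking spot, then exactly one of the arriving cars parks there at time $t$ (the one with the largest tie-breaking uniform variable of index $t$), and stays there forever; that spot is occupied from then on. Unparked cars arriving at any other vertex (an occupied spot, or a vertex that initially held a car and hence has no parking spot), and arriving cars that lose the tie-break, do not park and continue moving at the next time step. The parking time of $v$ is \[ \tau^{(v)}:=\sum_{s=1}^{\infty}\mathbf{1}\{\text{a car starts at } v \text{ and is unparked at time } s-1\}\in\{0,1,2,\dots\}\cup\{\infty\}, \] so $\tau^{(v)}=0$ if no car starts at $v$; write $\tau=\tau^{(0)}$ for the origin. *)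

theory Defs
  imports "HOL-Probability.Probability"
begin

text \<open>A configuration gives, at every site, the initial state (\<open>1\<close>: a car; \<open>-1\<close>: a vacant spot),
  the path of the car starting there, and its tie-breaking variables (the one of index \<open>0\<close> is
  never used). Only the laws below restrict the initial state to \<open>{-1, 1}\<close> and the tie-breaking
  variables to \<open>[0, 1]\<close>.\<close>

type_synonym 'd site = "int ^ 'd"
type_synonym 'd config = "'d site \<Rightarrow> int \<times> (nat \<Rightarrow> 'd site) \<times> (nat \<Rightarrow> real)"

definition init :: "'d::finite config \<Rightarrow> 'd site \<Rightarrow> int"
  where "init \<omega> v = fst (\<omega> v)"

definition walk :: "'d::finite config \<Rightarrow> 'd site \<Rightarrow> nat \<Rightarrow> 'd site"
  where "walk \<omega> v = fst (snd (\<omega> v))"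

definition tie :: "'d::finite config \<Rightarrow> 'd site \<Rightarrow> nat \<Rightarrow> real"
  where "tie \<omega> v = snd (snd (\<omega> v))"

definition init_law :: "real \<Rightarrow> int measure"
  where "init_law p = measure_pmf (map_pmf (\<lambda>b. if b then 1 else -1) (bernoulli_pmf p))"

definition unit_steps :: "'d::finite site set"
  where "unit_steps = {axis i s | i s. s \<in> {-1, 1}}"

definition walk_law :: "'d::finite site \<Rightarrow> (nat \<Rightarrow> 'd site) measure"
  where "walk_law v =
    distr (PiM UNIV (\<lambda>_. measure_pmf (pmf_of_set unit_steps))) (PiM UNIV (\<lambda>_. count_space UNIV))
      (\<lambda>\<xi> n. v + (\<Sum>k<n. \<xi> k))"

definition tie_law :: "(nat \<Rightarrow> real) measure"
  where "tie_law = PiM UNIV (\<lambda>_. uniform_measure lborel {0..1})"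

definition parking_measure :: "real \<Rightarrow> 'd::finite config measure"
  where "parking_measure p = PiM UNIV (\<lambda>v. init_law p \<Otimes>\<^sub>M (walk_law v \<Otimes>\<^sub>M tie_law))"

text \<open>\<open>A\<close> is the set of cars (named by their starting site) that are unparked at time \<open>t - 1\<close> and
  \<open>V\<close> the set of spots vacant at that time. Equal tie-breaking variables, and infinitely many cars
  arriving at one site, occur with probability \<open>0\<close>; outside this null event, at each vacant spot
  where some car arrives exactly one car satisfies the condition below.\<close>

definition parking_cars ::
    "'d::finite config \<Rightarrow> nat \<Rightarrow> 'd site set \<Rightarrow> 'd site set \<Rightarrow> 'd site set"
  where "parking_cars \<omega> t A V =
    {v \<in> A. walk \<omega> v t \<in> V \<and>
      (\<forall>w\<in>A. w \<noteq> v \<and> walk \<omega> w t = walk \<omega> v t \<longrightarrow> tie \<omega> w t < tie \<omega> v t)}"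

primrec parking_state :: "'d::finite config \<Rightarrow> nat \<Rightarrow> 'd site set \<times> 'd site set"
  where
    "parking_state \<omega> 0 = ({v. init \<omega> v = 1}, {v. init \<omega> v = -1})"
  | "parking_state \<omega> (Suc t) =
      (let (A, V) = parking_state \<omega> t; P = parking_cars \<omega> (Suc t) A V
       in (A - P, V - (\<lambda>v. walk \<omega> v (Suc t)) ` P))"

definition unparked :: "'d::finite config \<Rightarrow> nat \<Rightarrow> 'd site set"
  where "unparked \<omega> t = fst (parking_state \<omega> t)"

text \<open>The summation index is the paper's \<open>s - 1\<close>.\<close>

definition parking_time :: "'d::finite config \<Rightarrow> 'd site \<Rightarrow> enat"
  where "parking_time \<omega> v = (\<Sum>s. if v \<in> unparked \<omega> s then 1 else 0)"

definition p0 :: "nat \<Rightarrow> real"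
  where "p0 d = (if d = 1 then 1 / 2 else (1 - sqrt (1 - 1 / (real d * exp 1)\<^sup>2)) / 2)"

end

theory Submission
  imports Defs
begin

text \<open>Lower bound: if every site of a cube of side of order \<open>t powr (1 / (d + 2))\<close> holds a car and the
  car at the origin stays in the cube up to time \<open>t\<close>, it cannot park; both events have probability
  \<open>exp (- C * t powr (d / (d + 2)))\<close>.

  Upper bound: if the car at the origin is unparked at time \<open>t\<close>, every spot on its range \<open>R\<close> has been
  filled by a car, every spot met before by these cars has been filled by further cars, and so on; this
  closes up in a finite set of sites, containing \<open>R\<close>, with at least as many cars as spots. In one
  dimension it contains an interval with this property, and for \<open>p < 1/2\<close> the intervals containing \<open>R\<close>
  can be enumerated. In higher dimensions, counting all connected sets is too expensive, so the set is
  explored along the walks: at each known site one decides whether it is a spot or a car, which sites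
  its car discovers, and which outside cars enter the known set there. The walks are independent of the
  initial states and have the same law up to translation, so the number of cars whose \<open>(r + 1)\<close>-st
  distinct site is a given one has mean at most \<open>p\<close>: choosing an outside car costs no factor depending
  on \<open>d\<close>. The resulting generating function converges for \<open>p \<le> p0 d\<close> and gives a factor \<open>T < 1\<close> for
  every site of \<open>R\<close>. Finally, \<open>T ^ card R\<close> has mean at most \<open>K * exp (- c * t powr (d / (d + 2)))\<close>: by
  the decay of the heat kernel, a walk with at most \<open>n\<close> known sites finds a new one within
  \<open>C * n powr (2 / d)\<close> steps with probability at least \<open>1/2\<close>.\<close>

section \<open>Random walk functionals\<close>

text \<open>The exponent is a balance: filling a cube of side \<open>r\<close> with cars costs
  \<open>r ^ d\<close> and staying in it up to time \<open>t\<close> costs \<open>t / r ^ 2\<close>;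
  both agree at \<open>r = t powr (1 / (d + 2))\<close>. The range of a single walk obeys the same
  balance. Cars compete for spots, so the set of filling cars is random and unbounded. Events are
  therefore built by reading the sites one at a time, and independence between sites enters in one
  form only: an event unaffected by overwriting the coordinate \<open>v\<close> is independent of
  that coordinate. For \<open>d >= 2\<close>, \<open>p0 d\<close> is the root below 1/2 of
  \<open>sqrt (p * (1 - p)) = 1 / (2 * d * e)\<close>. With the surplus of cars weighted by the best
  tilt \<open>z\<close>, this is the value of \<open>p * z\<close>, at most
  \<open>1 / (4 * e) < 0.092\<close> in all these dimensions, so one numerical solution of the
  budgets serves them all. The prefactor in the upper bound is exactly \<open>p\<close>: no constant
  may be lost, and separate estimates keep the remaining factor below 1 from \<open>t = 1\<close>
  on. All bounds for the largest \<open>p\<close> remain valid for smaller ones, which yields the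
  uniformity of the rate.\<close>

type_synonym 'd path = "nat \<Rightarrow> 'd site"

abbreviation steps_law :: "'d::finite path measure"
  where "steps_law \<equiv> PiM UNIV (\<lambda>_. measure_pmf (pmf_of_set unit_steps))"

definition step_mean :: "('d::finite site \<Rightarrow> real) \<Rightarrow> real"
  where "step_mean f = (\<Sum>i\<in>UNIV. f (axis i 1) + f (axis i (-1))) / (2 * real CARD('d))"

text \<open>The Markov operator of a chain driven by the steps. States carry no sigma-algebra and
  the averages are finite, so estimates on walks become recursions on real numbers without
  integrability conditions.\<close>

definition chain_op :: "('s \<Rightarrow> 'd::finite site \<Rightarrow> 's) \<Rightarrow> ('s \<Rightarrow> real) \<Rightarrow> 's \<Rightarrow> real"
  where "chain_op \<delta> f s = step_mean (\<lambda>e. f (\<delta> s e))"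

primrec run :: "('s \<Rightarrow> 'a \<Rightarrow> 's) \<Rightarrow> (nat \<Rightarrow> 'a) \<Rightarrow> 's \<Rightarrow> nat \<Rightarrow> 's"
  where "run \<delta> \<xi> s 0 = s" | "run \<delta> \<xi> s (Suc n) = \<delta> (run \<delta> \<xi> s n) (\<xi> n)"

text \<open>\<open>run\<close> recurses on the last step, whereas the product measure and the
  iterates of \<open>chain_op\<close> split off the first one.\<close>

lemma run_case_nat: "run \<delta> (case_nat e \<xi>) s (Suc n) = run \<delta> \<xi> (\<delta> s e) n"
  by (induction n) auto

lemma axis_eq_axis_iff: "axis i (s::int) = axis j t \<longleftrightarrow> (i = j \<and> s = t) \<or> (s = 0 \<and> t = 0)"
  by (auto simp: axis_def vec_eq_iff) 

lemma sum_unit_steps: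
  "sum f (unit_steps :: 'd::finite site set) = (\<Sum>i\<in>UNIV. f (axis i 1) + f (axis i (-1)))"
proof -
  have eq: "(unit_steps :: 'd site set) = (\<lambda>(i, s). axis i s) ` (UNIV \<times> {1, -1})"
    by (auto simp: unit_steps_def)
  have inj: "inj_on (\<lambda>(i, s). axis i s :: 'd site) (UNIV \<times> {1, -1})"
    by (auto simp: inj_on_def axis_eq_axis_iff)
  have "sum f (unit_steps :: 'd site set) = (\<Sum>(i, s)\<in>UNIV \<times> {1, -1}. f (axis i s))"
    unfolding eq by (subst sum.reindex[OF inj]) (simp add: case_prod_unfold)
  also have "\<dots> = (\<Sum>i\<in>UNIV. \<Sum>s\<in>{1, -1}. f (axis i s))"
    by (rule sum.cartesian_product[symmetric])
  finally show ?thesis by simp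
qed

lemma finite_unit_steps [simp]: "finite (unit_steps :: 'd::finite site set)"
proof -
  have "(unit_steps :: 'd site set) = (\<lambda>(i, s). axis i s) ` (UNIV \<times> {1, -1})"
    by (auto simp: unit_steps_def)
  then show ?thesis by (metis finite_imageI finite_cartesian_product finite finite_insert finite.emptyI)
qed

lemma unit_steps_nonempty [simp]: "unit_steps \<noteq> ({} :: 'd::finite site set)"
  by (auto simp: unit_steps_def)

lemma card_unit_steps: "card (unit_steps :: 'd::finite site set) = 2 * CARD('d)"
proof -
  have "card (unit_steps :: 'd site set) = (\<Sum>i\<in>(UNIV::'d set). 1 + 1)"
    unfolding card_eq_sum by (rule sum_unit_steps)
  then show ?thesis by simp
qed

lemma step_mean_nonneg: "(\<And>e. f e \<ge> 0) \<Longrightarrow> step_mean f \<ge> 0"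
  by (auto simp: step_mean_def intro!: divide_nonneg_nonneg sum_nonneg)

lemma step_mean_mono: "(\<And>e. f e \<le> g e) \<Longrightarrow> step_mean f \<le> step_mean g"
  unfolding step_mean_def by (intro divide_right_mono sum_mono add_mono) auto

lemma step_mean_const [simp]: "step_mean (\<lambda>_. c) = c"
  by (simp add: step_mean_def)

lemma step_mean_add: "step_mean (\<lambda>e. f e + g e) = step_mean f + step_mean g"
  by (simp add: step_mean_def sum.distrib add_divide_distrib algebra_simps)

lemma step_mean_cmult: "step_mean (\<lambda>e. c * f e) = c * step_mean f"
  by (simp add: step_mean_def sum_distrib_left distrib_left)

lemma nn_integral_step:
  fixes f :: "'d::finite site \<Rightarrow> real"
  assumes "\<And>e. f e \<ge> 0"
  shows "(\<integral>\<^sup>+e. ennreal (f e) \<partial>measure_pmf (pmf_of_set unit_steps)) = ennreal (step_mean f)"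
proof -
  have s: "sum f unit_steps = (\<Sum>i\<in>UNIV. f (axis i 1) + f (axis i (-1)))"
    by (rule sum_unit_steps)
  have n: "sum f unit_steps \<ge> 0" by (simp add: assms sum_nonneg)
  have "(\<integral>\<^sup>+e. ennreal (f e) \<partial>measure_pmf (pmf_of_set unit_steps))
      = (\<Sum>e\<in>unit_steps. ennreal (f e)) / of_nat (2 * CARD('d))"
    by (subst nn_integral_pmf_of_set) (auto simp: card_unit_steps)
  also have "\<dots> = ennreal (sum f unit_steps) / ennreal (2 * real CARD('d))"
    by (simp add: assms ennreal_of_nat_eq_real_of_nat flip: ennreal_mult')
  also have "\<dots> = ennreal (step_mean f)"
    using n unfolding step_mean_def s[symmetric] by (subst divide_ennreal) auto
  finally show ?thesis .
qed

lemma chain_op_nonneg: "(\<And>s. f s \<ge> 0) \<Longrightarrow> (chain_op \<delta> ^^ n) f s \<ge> 0"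
  by (induction n arbitrary: s) (auto simp: chain_op_def intro!: step_mean_nonneg)

text \<open>Markov property: a sequence of independent steps is a first step followed by an
  independent copy of the sequence, so induction on \<open>n\<close> works once the initial state is
  left arbitrary.\<close>

lemma nn_integral_run:
  fixes f :: "'s \<Rightarrow> real" and \<delta> :: "'s \<Rightarrow> 'd::finite site \<Rightarrow> 's"
  assumes f: "\<And>s. f s \<ge> 0"
  shows "(\<lambda>\<xi>. ennreal (f (run \<delta> \<xi> s n))) \<in> borel_measurable steps_law"
    and "(\<integral>\<^sup>+\<xi>. ennreal (f (run \<delta> \<xi> s n)) \<partial>steps_law) = ennreal ((chain_op \<delta> ^^ n) f s)"
proof -
  let ?M = "measure_pmf (pmf_of_set (unit_steps :: 'd site set))"
  let ?S = "steps_law :: 'd path measure"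
  interpret sequence_space ?M
    by unfold_locales
  have meas: "(\<lambda>\<xi>. ennreal (f (run \<delta> \<xi> s n))) \<in> borel_measurable steps_law" for s n
  proof (induction n arbitrary: s)
    case (Suc n)
    have shift: "(\<lambda>\<xi>. \<xi> \<circ> Suc) \<in> measurable ?S steps_law"
      by (rule measurable_PiM_single') (auto simp: space_PiM)
    \<comment> \<open>\<open>f\<close> and the transition map are arbitrary, but the first step lies
      in a countable type, so it can be frozen at each of its values.\<close>
    have "(\<lambda>\<xi>. ennreal (f (run \<delta> (\<xi> \<circ> Suc) (\<delta> s (\<xi> 0)) n))) \<in> borel_measurable ?S"
    proof (rule measurable_compose_countable[where f="\<lambda>e \<xi>. ennreal (f (run \<delta> (\<xi> \<circ> Suc) (\<delta> s e) n))" and g="\<lambda>\<xi>. \<xi> 0"])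
      show "(\<lambda>\<xi>. ennreal (f (run \<delta> (\<xi> \<circ> Suc) (\<delta> s e) n))) \<in> borel_measurable ?S" for e
        using measurable_compose[OF shift Suc.IH[of "\<delta> s e"]] .
      have "(\<lambda>\<xi>. \<xi> 0) \<in> measurable ?S ?M"
        by (rule measurable_component_singleton) auto
      then show "(\<lambda>\<xi>. \<xi> 0) \<in> measurable ?S (count_space UNIV)"
        by simp
    qed
    moreover have "run \<delta> \<xi> s (Suc n) = run \<delta> (\<xi> \<circ> Suc) (\<delta> s (\<xi> 0)) n" for \<xi>
    proof -
      have "\<xi> = case_nat (\<xi> 0) (\<xi> \<circ> Suc)" by (auto simp: fun_eq_iff split: nat.split)
      then show ?thesis by (metis run_case_nat)
    qed
    ultimately show ?case by simp
  qed simp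
  show "(\<lambda>\<xi>. ennreal (f (run \<delta> \<xi> s n))) \<in> borel_measurable steps_law" by (rule meas)
  show "(\<integral>\<^sup>+\<xi>. ennreal (f (run \<delta> \<xi> s n)) \<partial>steps_law) = ennreal ((chain_op \<delta> ^^ n) f s)"
  proof (induction n arbitrary: s)
    case 0
    then show ?case using P.emeasure_space_1 by simp
  next
    case (Suc n)
    have "(\<integral>\<^sup>+\<xi>. ennreal (f (run \<delta> \<xi> s (Suc n))) \<partial>steps_law)
       = (\<integral>\<^sup>+X. ennreal (f (run \<delta> (case X of (e, \<xi>) \<Rightarrow> case_nat e \<xi>) s (Suc n))) \<partial>(?M \<Otimes>\<^sub>M steps_law))"
      by (subst PiM_iter[symmetric], subst nn_integral_distr) (use meas in \<open>auto simp del: run.simps\<close>)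
    also have "\<dots> = (\<integral>\<^sup>+e. \<integral>\<^sup>+\<xi>. ennreal (f (run \<delta> (case_nat e \<xi>) s (Suc n))) \<partial>steps_law \<partial>?M)"
    proof (subst P.nn_integral_fst[symmetric])
      have "(\<lambda>(e, \<xi>). case_nat e \<xi>) \<in> measurable (?M \<Otimes>\<^sub>M steps_law) steps_law"
        by simp
      from measurable_compose[OF this meas[of s "Suc n"]]
      show "(\<lambda>X. ennreal (f (run \<delta> (case X of (e, \<xi>) \<Rightarrow> case_nat e \<xi>) s (Suc n)))) \<in> borel_measurable (?M \<Otimes>\<^sub>M steps_law)"
        .
    qed simp
    also have "\<dots> = (\<integral>\<^sup>+e. ennreal ((chain_op \<delta> ^^ n) f (\<delta> s e)) \<partial>?M)"
      by (simp only: run_case_nat Suc.IH)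
    also have "\<dots> = ennreal ((chain_op \<delta> ^^ Suc n) f s)"
      by (subst nn_integral_step) (auto simp: chain_op_def[of \<delta> "(chain_op \<delta> ^^ n) f"] intro!: chain_op_nonneg f)
    finally show ?case .
  qed
qed

section \<open>The law of a configuration\<close>

abbreviation paths :: "'d::finite path measure"
  where "paths \<equiv> PiM UNIV (\<lambda>_. count_space UNIV)"

definition site_law :: "real \<Rightarrow> 'd::finite site \<Rightarrow> (int \<times> (nat \<Rightarrow> 'd site) \<times> (nat \<Rightarrow> real)) measure"
  where "site_law p v = init_law p \<Otimes>\<^sub>M (walk_law v \<Otimes>\<^sub>M tie_law)"

lemma parking_measure_alt: "parking_measure p = PiM UNIV (site_law p)"
  by (simp add: parking_measure_def site_law_def[abs_def])

lemma space_paths [simp]: "space paths = UNIV"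
  by (simp add: space_PiM)

lemma space_steps_law [simp]: "space steps_law = UNIV"
  by (simp add: space_PiM)

lemma prob_space_steps_law: "prob_space steps_law"
  by (rule prob_space_PiM) (rule prob_space_measure_pmf)

lemma measurable_shifted_path [measurable]:
  "(\<lambda>\<xi> n. v + (\<Sum>k<n. \<xi> k)) \<in> measurable (steps_law :: 'd::finite path measure) paths"
proof (rule measurable_PiM_single')
  show "(\<lambda>\<xi>. v + (\<Sum>k<n. \<xi> k)) \<in> measurable (steps_law :: 'd path measure) (count_space UNIV)" for n
  proof (induction n)
    case (Suc n)
    have 1: "(\<lambda>\<xi>. \<xi> n) \<in> measurable (steps_law :: 'd path measure) (count_space UNIV)"
      using measurable_component_singleton[of n UNIV "\<lambda>_. measure_pmf (pmf_of_set unit_steps)"]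
      by simp
    have "(\<lambda>\<xi>. (v + (\<Sum>k<n. \<xi> k)) + \<xi> n) \<in> measurable (steps_law :: 'd path measure) (count_space UNIV)"
      by (rule measurable_compose_countable[where f="\<lambda>e \<xi>. e + \<xi> n", OF _ Suc.IH])
         (rule measurable_compose[OF 1], simp)
    then show ?case by (simp add: add.assoc)
  qed simp
qed (auto simp: space_PiM)

lemma sets_walk_law [simp, measurable_cong]: "sets (walk_law v) = sets paths"
  by (simp add: walk_law_def)

lemma space_walk_law [simp]: "space (walk_law v) = UNIV"
  by (simp add: walk_law_def)

lemma prob_space_walk_law: "prob_space (walk_law v)"
  unfolding walk_law_def by (rule prob_space.prob_space_distr[OF prob_space_steps_law]) measurable

lemma emeasure_walk_law:
  assumes "B \<in> sets paths"
  shows "emeasure (walk_law v) B = emeasure steps_law {\<xi>. (\<lambda>n. v + (\<Sum>k<n. \<xi> k)) \<in> B}"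
  unfolding walk_law_def using assms by (subst emeasure_distr) (auto simp: vimage_def)

lemma sets_tie_law [simp, measurable_cong]: "sets tie_law = sets (PiM UNIV (\<lambda>_. borel))"
  unfolding tie_law_def by (rule sets_PiM_cong) auto

lemma prob_space_uniform_unit: "prob_space (uniform_measure lborel {0..1::real})"
  by (rule prob_space_uniform_measure) auto

lemma prob_space_tie_law: "prob_space tie_law"
  unfolding tie_law_def by (rule prob_space_PiM) (rule prob_space_uniform_unit)

lemma space_tie_law [simp]: "space tie_law = UNIV"
  by (simp add: tie_law_def space_PiM)

lemma sets_init_law [simp, measurable_cong]: "sets (init_law p) = UNIV"
  by (simp add: init_law_def)

lemma space_init_law [simp]: "space (init_law p) = UNIV"
  by (simp add: init_law_def)

lemma prob_space_init_law: "prob_space (init_law p)"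
  unfolding init_law_def by (rule prob_space_measure_pmf)

lemma emeasure_init_law:
  assumes "0 \<le> p" "p \<le> 1"
  shows "emeasure (init_law p) {1} = ennreal p" "emeasure (init_law p) {x. x \<noteq> 1} = ennreal (1 - p)"
    "emeasure (init_law p) {x. x \<noteq> 1 \<and> x \<noteq> -1} = 0" "emeasure (init_law p) {-1} = ennreal (1 - p)"
proof -
  have 1: "(\<lambda>b. if b then 1 else - 1 :: int) -` {1} = {True}"
    and 2: "(\<lambda>b. if b then 1 else - 1 :: int) -` {x. x \<noteq> 1} = {False}"
    and 3: "(\<lambda>b. if b then 1 else - 1 :: int) -` {x. x \<noteq> 1 \<and> x \<noteq> -1} = {}"
    and 4: "(\<lambda>b. if b then 1 else - 1 :: int) -` {-1} = {False}"
    by (auto split: if_splits)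
  show "emeasure (init_law p) {1} = ennreal p" "emeasure (init_law p) {x. x \<noteq> 1} = ennreal (1 - p)"
    "emeasure (init_law p) {x. x \<noteq> 1 \<and> x \<noteq> -1} = 0" "emeasure (init_law p) {-1} = ennreal (1 - p)"
    unfolding init_law_def emeasure_map_pmf 1 2 3 4
    using assms by (auto simp: emeasure_pmf_single)
qed

lemma space_site_law [simp]: "space (site_law p v) = UNIV"
  by (simp add: site_law_def space_pair_measure)

lemma prob_space_site_law: "prob_space (site_law p v)"
proof -
  interpret T: prob_space tie_law by (rule prob_space_tie_law)
  interpret W: prob_space "walk_law v" by (rule prob_space_walk_law)
  interpret I: prob_space "init_law p" by (rule prob_space_init_law)
  interpret WT: pair_prob_space "walk_law v" tie_law ..
  interpret IWT: pair_prob_space "init_law p" "walk_law v \<Otimes>\<^sub>M tie_law" ..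
  show ?thesis unfolding site_law_def by unfold_locales
qed

lemma space_parking_measure [simp]: "space (parking_measure p) = UNIV"
  by (simp add: parking_measure_alt space_PiM)

lemma prob_space_parking_measure: "prob_space (parking_measure p)"
  unfolding parking_measure_alt by (rule prob_space_PiM) (rule prob_space_site_law)

lemma measurable_site [measurable]: "(\<lambda>\<omega>. \<omega> v) \<in> measurable (parking_measure p) (site_law p v)"
  unfolding parking_measure_alt by simp

lemma measurable_init [measurable]: "(\<lambda>\<omega>. init \<omega> v) \<in> measurable (parking_measure p) (count_space UNIV)"
proof -
  have "fst \<in> measurable (site_law p v) (init_law p)" by (simp add: site_law_def)
  then have "fst \<in> measurable (site_law p v) (count_space UNIV)" by (simp add: init_law_def)
  from measurable_compose[OF measurable_site this] show ?thesis by (simp add: init_def)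
qed

lemma measurable_walk [measurable]: "(\<lambda>\<omega>. walk \<omega> v) \<in> measurable (parking_measure p) paths"
proof -
  have "(\<lambda>x. fst (snd x)) \<in> measurable (site_law p v) (walk_law v)" by (simp add: site_law_def)
  then have "(\<lambda>x. fst (snd x)) \<in> measurable (site_law p v) paths" by (simp cong: measurable_cong_sets)
  from measurable_compose[OF measurable_site this] show ?thesis by (simp add: walk_def)
qed

lemma measurable_walk_at [measurable]: "(\<lambda>\<omega>. walk \<omega> v n) \<in> measurable (parking_measure p) (count_space UNIV)"
  by (rule measurable_compose[OF measurable_walk]) (rule measurable_component_singleton, simp)

lemma measurable_tie [measurable]: "(\<lambda>\<omega>. tie \<omega> v n) \<in> borel_measurable (parking_measure p)"
proof -
  have "(\<lambda>x. snd (snd x)) \<in> measurable (site_law p v) tie_law" by (simp add: site_law_def)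
  then have "(\<lambda>x. snd (snd x)) \<in> measurable (site_law p v) (PiM UNIV (\<lambda>_. borel))" by (simp cong: measurable_cong_sets)
  from measurable_compose[OF measurable_compose[OF measurable_site this] measurable_component_singleton[of n]]
  show ?thesis by (simp add: tie_def)
qed

text \<open>The product law is preserved when one coordinate is redrawn independently. Working with
  \<open>fun_upd\<close> avoids splitting the infinite product into factors.\<close>

lemma emeasure_resample:
  assumes "E \<in> sets (parking_measure p)"
  shows "emeasure (parking_measure p) E = (\<integral>\<^sup>+\<omega>. emeasure (site_law p v) {x. fun_upd \<omega> v x \<in> E} \<partial>parking_measure p)"
proof -
  let ?P = "PiM UNIV (site_law p)"
  interpret P: prob_space ?P by (rule prob_space_PiM) (rule prob_space_site_law)
  interpret M: prob_space "site_law p v" by (rule prob_space_site_law)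
  interpret PM: pair_prob_space "site_law p v" ?P ..
  have E: "E \<in> sets ?P" using assms by (simp add: parking_measure_alt)
  have eq: "distr (site_law p v \<Otimes>\<^sub>M ?P) ?P (\<lambda>(x, X). fun_upd X v x) = ?P"
    using distr_pair_PiM_eq_PiM[of UNIV "site_law p" v] by (simp add: prob_space_site_law)
  have meas: "(\<lambda>(x, X). fun_upd X v x) \<in> measurable (site_law p v \<Otimes>\<^sub>M ?P) ?P"
    unfolding case_prod_unfold by (rule measurable_fun_upd[where J=UNIV]) auto
  have "emeasure ?P E = emeasure (site_law p v \<Otimes>\<^sub>M ?P) ((\<lambda>(x, X). fun_upd X v x) -` E \<inter> space (site_law p v \<Otimes>\<^sub>M ?P))"
    using E meas by (subst eq[symmetric], subst emeasure_distr) auto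
  also have "\<dots> = (\<integral>\<^sup>+\<omega>. emeasure (site_law p v) ((\<lambda>x. (x, \<omega>)) -` ((\<lambda>(x, X). fun_upd X v x) -` E \<inter> space (site_law p v \<Otimes>\<^sub>M ?P))) \<partial>?P)"
    using measurable_sets[OF meas E] by (rule PM.emeasure_pair_measure_alt2)
  also have "\<dots> = (\<integral>\<^sup>+\<omega>. emeasure (site_law p v) {x. fun_upd \<omega> v x \<in> E} \<partial>?P)"
    by (intro nn_integral_cong arg_cong[where f="emeasure (site_law p v)"])
       (auto simp: space_pair_measure space_PiM)
  finally show ?thesis by (simp add: parking_measure_alt)
qed

text \<open>After redrawing the site \<open>v\<close>, membership in \<open>F\<close> is unchanged,
  so the inner probability is the constant \<open>emeasure (site_law p v) A\<close> on
  \<open>F\<close> and zero elsewhere.\<close>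

lemma emeasure_indep_site:
  assumes A: "A \<in> sets (site_law p v)" and F: "F \<in> sets (parking_measure p)"
    and inv: "\<And>\<omega> x. fun_upd \<omega> v x \<in> F \<longleftrightarrow> \<omega> \<in> F"
  shows "emeasure (parking_measure p) ({\<omega>. \<omega> v \<in> A} \<inter> F)
    = emeasure (site_law p v) A * emeasure (parking_measure p) F"
proof -
  have "{\<omega>. \<omega> v \<in> A} = (\<lambda>\<omega>. \<omega> v) -` A \<inter> space (parking_measure p)" by auto
  also have "\<dots> \<in> sets (parking_measure p)"
    by (rule measurable_sets[OF measurable_site A])
  finally have "{\<omega>. \<omega> v \<in> A} \<inter> F \<in> sets (parking_measure p)" using F by auto
  then have "emeasure (parking_measure p) ({\<omega>. \<omega> v \<in> A} \<inter> F)
     = (\<integral>\<^sup>+\<omega>. emeasure (site_law p v) {x. fun_upd \<omega> v x \<in> {\<omega>. \<omega> v \<in> A} \<inter> F} \<partial>parking_measure p)"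
    by (rule emeasure_resample)
  also have "\<dots> = (\<integral>\<^sup>+\<omega>. emeasure (site_law p v) A * indicator F \<omega> \<partial>parking_measure p)"
    by (intro nn_integral_cong) (auto simp: inv split: split_indicator)
  also have "\<dots> = emeasure (site_law p v) A * emeasure (parking_measure p) F"
    using F by (subst nn_integral_cmult) auto
  finally show ?thesis .
qed

lemma emeasure_site_rect:
  assumes B: "B \<in> sets paths" and F: "F \<in> sets (parking_measure p)"
    and inv: "\<And>\<omega> x. fun_upd \<omega> v x \<in> F \<longleftrightarrow> \<omega> \<in> F"
  shows "emeasure (parking_measure p) ({\<omega>. init \<omega> v \<in> A \<and> walk \<omega> v \<in> B} \<inter> F)
    = emeasure (init_law p) A * emeasure (walk_law v) B * emeasure (parking_measure p) F"
    and "{\<omega>. init \<omega> v \<in> A \<and> walk \<omega> v \<in> B} \<inter> F \<in> sets (parking_measure p)"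
proof -
  interpret T: prob_space tie_law by (rule prob_space_tie_law)
  interpret W: prob_space "walk_law v" by (rule prob_space_walk_law)
  interpret WT: pair_prob_space "walk_law v" tie_law ..
  let ?R = "A \<times> (B \<times> UNIV)"
  have R: "?R \<in> sets (site_law p v)"
    unfolding site_law_def using B sets.top[of tie_law] by (intro pair_measureI) auto
  have "emeasure (site_law p v) ?R = emeasure (init_law p) A * (emeasure (walk_law v) B * emeasure tie_law UNIV)"
    unfolding site_law_def using B sets.top[of tie_law]
    by (subst WT.emeasure_pair_measure_Times, simp, force, subst T.emeasure_pair_measure_Times) auto
  then have eq: "emeasure (site_law p v) ?R = emeasure (init_law p) A * emeasure (walk_law v) B"
    using T.emeasure_space_1 by simp
  have *: "{\<omega>. init \<omega> v \<in> A \<and> walk \<omega> v \<in> B} = {\<omega>. \<omega> v \<in> ?R}"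
    by (auto simp: init_def walk_def mem_Times_iff)
  show "emeasure (parking_measure p) ({\<omega>. init \<omega> v \<in> A \<and> walk \<omega> v \<in> B} \<inter> F)
    = emeasure (init_law p) A * emeasure (walk_law v) B * emeasure (parking_measure p) F"
    unfolding * using emeasure_indep_site[OF R F inv] eq by simp
  have "{\<omega>. \<omega> v \<in> ?R} = (\<lambda>\<omega>. \<omega> v) -` ?R \<inter> space (parking_measure p)" by auto
  then show "{\<omega>. init \<omega> v \<in> A \<and> walk \<omega> v \<in> B} \<inter> F \<in> sets (parking_measure p)"
    unfolding * using measurable_sets[OF measurable_site R] F by simp
qed

lemma emeasure_car_site:
  assumes p: "0 \<le> p" "p \<le> 1" and B: "B \<in> sets paths"
    and F: "F \<in> sets (parking_measure p)" and inv: "\<And>\<omega> x. fun_upd \<omega> v x \<in> F \<longleftrightarrow> \<omega> \<in> F"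
  shows "emeasure (parking_measure p) ({\<omega>. init \<omega> v = 1 \<and> walk \<omega> v \<in> B} \<inter> F)
    = ennreal p * emeasure (walk_law v) B * emeasure (parking_measure p) F"
    and "{\<omega>. init \<omega> v = 1 \<and> walk \<omega> v \<in> B} \<inter> F \<in> sets (parking_measure p)"
  using emeasure_site_rect[OF B F inv, of "{1}"] p by (auto simp: emeasure_init_law)

lemma emeasure_init_site:
  assumes F: "F \<in> sets (parking_measure p)" and inv: "\<And>\<omega> x. fun_upd \<omega> v x \<in> F \<longleftrightarrow> \<omega> \<in> F"
  shows "emeasure (parking_measure p) ({\<omega>. init \<omega> v \<in> A} \<inter> F)
    = emeasure (init_law p) A * emeasure (parking_measure p) F"
    and "{\<omega>. init \<omega> v \<in> A} \<inter> F \<in> sets (parking_measure p)"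
proof -
  interpret W: prob_space "walk_law v" by (rule prob_space_walk_law)
  have "UNIV \<in> sets (paths :: 'a path measure)" using sets.top[of paths] by simp
  from emeasure_site_rect[OF this F inv, of A] W.emeasure_space_1
  show "emeasure (parking_measure p) ({\<omega>. init \<omega> v \<in> A} \<inter> F)
      = emeasure (init_law p) A * emeasure (parking_measure p) F"
    "{\<omega>. init \<omega> v \<in> A} \<inter> F \<in> sets (parking_measure p)" by simp_all
qed

section \<open>Paths that meet a known set\<close>

text \<open>The time up to which a path is revealed will be the parking time of its car, which
  depends on other cars. Leaving it existential makes the event depend on this one path only; the
  price is a sum over the possible \<open>X\<close>.\<close>

definition extends :: "(nat \<Rightarrow> 'a) \<Rightarrow> 'a set \<Rightarrow> 'a set \<Rightarrow> bool"
  where "extends g S X \<longleftrightarrow> (\<exists>n. X = g ` {..n} - S)"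

definition attaches :: "(nat \<Rightarrow> 'a) \<Rightarrow> 'a set \<Rightarrow> 'a \<Rightarrow> 'a set \<Rightarrow> bool"
  where "attaches g S x X \<longleftrightarrow>
    (\<exists>n. X = g ` {..n} - S \<and> (\<exists>k\<le>n. g k = x \<and> g ` {..<k} \<inter> S = {}))"

text \<open>The first \<open>m + 1\<close> distinct sites of the path, without its start.\<close>

definition early :: "nat \<Rightarrow> (nat \<Rightarrow> 'a) \<Rightarrow> 'a set"
  where "early m g = {g k | k. card (g ` {..<k}) \<le> m} - {g 0}"

text \<open>Infinitely many times \<open>k\<close> may qualify, so finite subsets are bounded first:
  they lie in the path up to the largest of their witnesses, and before that time at most
  \<open>m\<close> sites have been visited.\<close>

lemma finite_early: "finite (early m g)" and card_early: "card (early m g) \<le> m"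
proof -
  let ?E = "{g k | k. card (g ` {..<k}) \<le> m}"
  have *: "card F \<le> Suc m" if F: "F \<subseteq> ?E" "finite F" for F
  proof -
    from F have "\<exists>f. \<forall>y\<in>F. y = g (f y) \<and> card (g ` {..<f y}) \<le> m"
      by (intro bchoice) auto
    then obtain f where f: "\<And>y. y \<in> F \<Longrightarrow> y = g (f y) \<and> card (g ` {..<f y}) \<le> m" by auto
    show ?thesis
    proof (cases "F = {}")
      case False
      define K where "K = Max (f ` F)"
      have "K \<in> f ` F" using F(2) False by (auto simp: K_def)
      then have K: "card (g ` {..<K}) \<le> m" using f by auto
      have "F \<subseteq> g ` {..K}"
      proof
        fix y assume "y \<in> F"
        then have "f y \<le> K" using F(2) by (auto simp: K_def)
        then show "y \<in> g ` {..K}" using f[OF \<open>y \<in> F\<close>] by auto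
      qed
      then have "card F \<le> card (g ` {..K})" by (intro card_mono) auto
      also have "g ` {..K} = insert (g K) (g ` {..<K})"
        by (metis image_insert lessThan_Suc lessThan_Suc_atMost)
      also have "card \<dots> \<le> Suc m" using K card_insert_le_m1[of "Suc m"] 
        by (metis (no_types, lifting) K Suc_le_mono card_insert_disjoint card_mono finite_imageI finite_lessThan insert_absorb le_Suc_eq)
      finally show ?thesis .
    qed simp
  qed
  then have fin: "finite ?E" "card ?E \<le> Suc m"
    using finite_if_finite_subsets_card_bdd[of ?E "Suc m"] by auto
  have "g 0 \<in> ?E" by (auto intro!: exI[of _ 0])
  then show "finite (early m g)" "card (early m g) \<le> m"
    using fin by (auto simp: early_def card_Diff_singleton)
qed

lemma early_translate:
  fixes g :: "nat \<Rightarrow> 'a::group_add"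
  shows "early m (\<lambda>n. w + g n) = (+) w ` early m g"
proof -
  have "card ((\<lambda>n. w + g n) ` {..<k}) = card (g ` {..<k})" for k
  proof -
    have "(\<lambda>n. w + g n) ` {..<k} = (+) w ` (g ` {..<k})" by auto
    then show ?thesis by (simp add: card_image)
  qed
  then show ?thesis unfolding early_def by auto
qed

text \<open>Everything visited before the first hit of \<open>S\<close> is outside \<open>S\<close>,
  hence in \<open>X\<close>.\<close>

lemma attaches_early:
  assumes "attaches g S x X" "g 0 \<notin> S" "x \<in> S"
  shows "x \<in> early (card X) g"
proof -
  from assms(1) obtain n k where nk: "X = g ` {..n} - S" "k \<le> n" "g k = x" "g ` {..<k} \<inter> S = {}"
    by (auto simp: attaches_def)
  have "g ` {..<k} \<subseteq> X" using nk by auto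
  then have "card (g ` {..<k}) \<le> card X" using nk(1) by (intro card_mono) auto
  then show ?thesis using nk(3) assms(2,3) by (auto simp: early_def)
qed

lemma attaches_extends: "attaches g S x X \<Longrightarrow> extends g S X"
  by (auto simp: attaches_def extends_def)

text \<open>The initial pieces of a path are nested. Along a fixed path, a sum over \<open>X\<close>
  is therefore a sum over cardinalities.\<close>

lemma extends_unique:
  assumes "extends g S X" "extends g S Y" "card X = card Y"
  shows "X = Y"
proof -
  from assms(1,2) obtain n m where nm: "X = g ` {..n} - S" "Y = g ` {..m} - S"
    by (auto simp: extends_def)
  have fin: "finite X" "finite Y" using nm by auto
  have "g ` {..n} \<subseteq> g ` {..m} \<or> g ` {..m} \<subseteq> g ` {..n}"
    by (metis atMost_subset_iff image_mono nat_le_linear)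
  then have "X \<subseteq> Y \<or> Y \<subseteq> X" using nm by auto
  then show ?thesis using fin assms(3) by (metis card_subset_eq)
qed

section \<open>Measurability of path events\<close>

lemma sets_paths_prefix:
  "{g. Q (map g [0..<n])} \<in> sets (paths :: 'd::finite path measure)"
proof -
  have 1: "{g. g i = c} \<in> sets (paths :: 'd path measure)" for i c
  proof -
    have "{g. g i = c} = (\<lambda>g. g i) -` {c} \<inter> space (paths :: 'd path measure)" by auto
    also have "\<dots> \<in> sets paths"
      by (rule measurable_sets[OF measurable_component_singleton]) auto
    finally show ?thesis .
  qed
  have 2: "{g. \<forall>i<n. g i = l ! i} \<in> sets (paths :: 'd path measure)" for l
  proof -
    have "{g. \<forall>i<n. g i = l ! i} = space (paths :: 'd path measure) \<inter> (\<Inter>i\<in>{..<n}. {g. g i = l ! i})"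
      by auto
    also have "\<dots> \<in> sets paths" using 1 sets.top[of paths] by (cases "n = 0") auto
    finally show ?thesis .
  qed
  have "{g. Q (map g [0..<n])} = (\<Union>l\<in>{l. length l = n \<and> Q l}. {g. \<forall>i<n. g i = l ! i})"
    (is "?A = ?B")
  proof (intro equalityI subsetI)
    fix g assume "g \<in> ?A" then show "g \<in> ?B"
      by (auto intro!: exI[of _ "map g [0..<n]"])
  next
    fix g assume "g \<in> ?B"
    then obtain l where l: "length l = n" "Q l" "\<forall>i<n. g i = l ! i" by auto
    then have "map g [0..<n] = l" by (intro nth_equalityI) auto
    with l show "g \<in> ?A" by auto
  qed
  also have "\<dots> \<in> sets paths"
    using 2 by (intro sets.countable_UN') (auto simp only: image_subset_iff countableI_type)
  finally show ?thesis .
qed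

lemma sets_extends [measurable]: "{g. extends g S X} \<in> sets (paths :: 'd::finite path measure)"
proof -
  have "{g. extends g S X} = (\<Union>n. {g. X = set (map g [0..<Suc n]) - S})"
    by (simp add: extends_def lessThan_Suc_atMost atLeast0LessThan set_eq_iff del: upt_Suc)
  moreover have "{g. X = set (map g [0..<Suc n]) - S} \<in> sets (paths :: 'd path measure)" for n
    by (rule sets_paths_prefix[of "\<lambda>l. X = set l - S"])
  ultimately show ?thesis by (simp only:) (intro sets.countable_UN, blast)
qed

lemma sets_attaches [measurable]: "{g. attaches g S x X} \<in> sets (paths :: 'd::finite path measure)"
proof -
  have "{g. attaches g S x X} = (\<Union>n. {g. (\<lambda>l. X = set l - S \<and> (\<exists>k\<le>n. l ! k = x \<and> set (take k l) \<inter> S = {})) (map g [0..<Suc n])})"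
    (is "?A = ?B")
  proof -
    have "map g [0..<Suc n] ! k = g k" "set (take k (map g [0..<Suc n])) = g ` {..<k}" if "k \<le> n" for g :: "nat \<Rightarrow> 'd site" and k n
      using that by (auto simp: take_map atLeast0LessThan simp del: upt_Suc)
    then show ?thesis
      by (simp add: attaches_def lessThan_Suc_atMost atLeast0LessThan set_eq_iff del: upt_Suc cong: conj_cong)
  qed
  moreover have "{g. (\<lambda>l. X = set l - S \<and> (\<exists>k\<le>n. l ! k = x \<and> set (take k l) \<inter> S = {})) (map g [0..<Suc n])} \<in> sets (paths :: 'd path measure)" for n
    by (rule sets_paths_prefix)
  ultimately show ?thesis by (simp only:) (intro sets.countable_UN, blast)
qed

section \<open>Union bounds over countable families of revealed data\<close>

lemma emeasure_UN_count_space: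
  assumes I: "countable I" and A: "\<And>i. i \<in> I \<Longrightarrow> A i \<in> sets M"
  shows "emeasure M (\<Union>i\<in>I. A i) \<le> (\<integral>\<^sup>+i. emeasure M (A i) \<partial>count_space I)"
proof -
  have "(\<Union>i\<in>I. A i) \<in> sets M" using assms by auto
  then have "emeasure M (\<Union>i\<in>I. A i) = (\<integral>\<^sup>+x. indicator (\<Union>i\<in>I. A i) x \<partial>M)" by simp
  also have "\<dots> \<le> (\<integral>\<^sup>+x. \<integral>\<^sup>+i. indicator (A i) x \<partial>count_space I \<partial>M)"
  proof (intro nn_integral_mono)
    fix x
    show "indicator (\<Union>i\<in>I. A i) x \<le> (\<integral>\<^sup>+i. (indicator (A i) x :: ennreal) \<partial>count_space I)"
    proof (cases "x \<in> (\<Union>i\<in>I. A i)")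
      case True
      then obtain i where i: "i \<in> I" "x \<in> A i" by auto
      have "indicator (A i) x \<le> (\<integral>\<^sup>+i. (indicator (A i) x :: ennreal) \<partial>count_space I)"
        by (rule nn_integral_ge_point[OF i(1)])
      then show ?thesis using i True by (auto simp: indicator_def)
    qed simp
  qed
  also have "\<dots> = (\<integral>\<^sup>+i. \<integral>\<^sup>+x. indicator (A i) x \<partial>M \<partial>count_space I)"
    using A by (intro nn_integral_count_space_nn_integral I) auto
  also have "\<dots> = (\<integral>\<^sup>+i. emeasure M (A i) \<partial>count_space I)"
    using A by (intro nn_integral_cong) auto
  finally show ?thesis .
qed

lemma nn_integral_count_space_emeasure:
  assumes I: "countable I" and B: "\<And>i. i \<in> I \<Longrightarrow> B i \<in> sets N"
  shows "(\<integral>\<^sup>+i. emeasure N (B i) * h i \<partial>count_space I)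
    = (\<integral>\<^sup>+x. \<integral>\<^sup>+i. indicator (B i) x * h i \<partial>count_space I \<partial>N)"
proof -
  have "(\<integral>\<^sup>+i. emeasure N (B i) * h i \<partial>count_space I)
      = (\<integral>\<^sup>+i. \<integral>\<^sup>+x. indicator (B i) x * h i \<partial>N \<partial>count_space I)"
    using B by (intro nn_integral_cong) (simp add: nn_integral_multc)
  then show ?thesis using I B by (simp add: nn_integral_count_space_nn_integral)
qed

text \<open>Union bound for revealing one car. \<open>i\<close> is what is revealed, and the event
  \<open>F i\<close> describing the rest does not read the car's own site; each term factors into
  \<open>p\<close>, a walk probability and \<open>c * h i\<close>. Summing against the walk law,
  rather than counting the \<open>i\<close>, keeps the entropy bounded.\<close>

lemma emeasure_UN_cars:
  fixes v :: "'i \<Rightarrow> 'd::finite site"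
  assumes p: "0 \<le> p" "p \<le> 1" and I: "countable I" and c: "0 \<le> c" and h: "\<And>i. 0 \<le> h i"
    and B: "\<And>i. i \<in> I \<Longrightarrow> B i \<in> sets paths"
    and F: "\<And>i. i \<in> I \<Longrightarrow> F i \<in> sets (parking_measure p)"
      "\<And>i \<omega> y. i \<in> I \<Longrightarrow> fun_upd \<omega> (v i) y \<in> F i \<longleftrightarrow> \<omega> \<in> F i"
      "\<And>i. i \<in> I \<Longrightarrow> emeasure (parking_measure p) (F i) \<le> ennreal (c * h i)"
    and s: "(\<integral>\<^sup>+i. emeasure (walk_law (v i)) (B i) * ennreal (h i) \<partial>count_space I) \<le> ennreal s"
  defines "U \<equiv> (\<Union>i\<in>I. {\<omega>. init \<omega> (v i) = 1 \<and> walk \<omega> (v i) \<in> B i} \<inter> F i)"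
  shows "U \<in> sets (parking_measure p) \<and> emeasure (parking_measure p) U \<le> ennreal (p * c * s)"
proof -
  let ?P = "parking_measure p :: 'd config measure"
  let ?A = "\<lambda>i. {\<omega>. init \<omega> (v i) = 1 \<and> walk \<omega> (v i) \<in> B i} \<inter> F i"
  have A: "?A i \<in> sets ?P"
    "emeasure ?P (?A i) \<le> ennreal (p * c) * (emeasure (walk_law (v i)) (B i) * ennreal (h i))" if i: "i \<in> I" for i
  proof -
    note car = emeasure_car_site[OF p B[OF i] F(1)[OF i] F(2)[OF i]]
    show "?A i \<in> sets ?P" by (rule car(2))
    have "emeasure ?P (?A i) \<le> ennreal p * emeasure (walk_law (v i)) (B i) * ennreal (c * h i)"
      unfolding car(1) using F(3)[OF i] by (intro mult_left_mono) auto
    also have "\<dots> = ennreal (p * c) * (emeasure (walk_law (v i)) (B i) * ennreal (h i))"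
      using p c h by (simp add: ennreal_mult mult_ac)
    finally show "emeasure ?P (?A i) \<le> ennreal (p * c) * (emeasure (walk_law (v i)) (B i) * ennreal (h i))" .
  qed
  have "U \<in> sets ?P" unfolding U_def using A(1) I by (intro sets.countable_UN') auto
  have "emeasure ?P U \<le> (\<integral>\<^sup>+i. emeasure ?P (?A i) \<partial>count_space I)"
    unfolding U_def using A(1) by (intro emeasure_UN_count_space I) auto
  also have "\<dots> \<le> (\<integral>\<^sup>+i. ennreal (p * c) * (emeasure (walk_law (v i)) (B i) * ennreal (h i)) \<partial>count_space I)"
    using A(2) by (intro nn_integral_mono) auto
  also have "\<dots> = ennreal (p * c) * (\<integral>\<^sup>+i. emeasure (walk_law (v i)) (B i) * ennreal (h i) \<partial>count_space I)"
    by (rule nn_integral_cmult) simp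
  also have "\<dots> \<le> ennreal (p * c) * ennreal s" using s by (rule mult_left_mono) simp
  also have "\<dots> = ennreal (p * c * s)" using p c by (simp add: ennreal_mult')
  finally show ?thesis using \<open>U \<in> sets ?P\<close> by blast
qed

lemma countable_finite_sets [simp]: "countable {X :: 'a::countable set. finite X \<and> Q X}"
  by (rule countable_subset[OF _ countable_Collect_finite]) auto

lemma nn_integral_count_space_mono_set:
  "A \<subseteq> B \<Longrightarrow> (\<integral>\<^sup>+x. f x \<partial>count_space A) \<le> (\<integral>\<^sup>+x. f x \<partial>count_space B)"
  by (subst (1 2) nn_integral_count_space_indicator) (auto intro!: nn_integral_mono split: split_indicator)

abbreviation newcomers :: "'a set \<Rightarrow> ('a \<times> 'a set) set"
  where "newcomers S \<equiv> {(w, X). w \<notin> S \<and> finite X \<and> w \<in> X \<and> X \<inter> S = {}}"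

lemma countable_newcomers [simp]: "countable (newcomers S :: ('a::countable \<times> _) set)"
  by (rule countable_subset[OF _ countable_SIGMA[of UNIV "\<lambda>_. {X. finite X}"]])
     (auto intro: countable_Collect_finite)

text \<open>Only the translates of one path enter, so each of its first sites serves exactly one starting
  site \<open>w\<close>: this replaces the entropy of the choice of \<open>w\<close>.\<close>

lemma attaches_sum_pointwise:
  fixes \<pi> :: "nat \<Rightarrow> 'd::finite site"
  assumes T: "0 \<le> T" "T < 1" and x: "x \<in> S" and \<pi>: "\<pi> 0 = 0"
  shows "(\<integral>\<^sup>+(w, X). indicator {g. attaches g S x X} (\<lambda>n. w + \<pi> n) * ennreal (T ^ (card X - 1)) \<partial>count_space (newcomers S))
    \<le> ennreal (1 / (1 - T)\<^sup>2)"
proof -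
  let ?J = "{(w, X). (w, X) \<in> newcomers S \<and> attaches (\<lambda>n. w + \<pi> n) S x X}"
  \<comment> \<open>By \<open>extends_unique\<close>, \<open>X\<close> is determined by
    \<open>w\<close> and its size. The subtraction never truncates, since \<open>w\<close> itself
    lies in \<open>X\<close>.\<close>
  let ?\<phi> = "\<lambda>(w, X). (w, card X - 1)"
  let ?K = "{(w, m). x - w \<in> early (Suc m) \<pi>}"
  have inj: "inj_on ?\<phi> ?J"
  proof (rule inj_onI)
    fix i j assume ij: "i \<in> ?J" "j \<in> ?J" "?\<phi> i = ?\<phi> j"
    obtain w X w' Y where eq: "i = (w, X)" "j = (w', Y)" by fastforce
    from ij have h: "w \<notin> S" "finite X" "w \<in> X" "X \<inter> S = {}" "attaches (\<lambda>n. w + \<pi> n) S x X"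
       "w' \<notin> S" "finite Y" "w' \<in> Y" "Y \<inter> S = {}" "attaches (\<lambda>n. w' + \<pi> n) S x Y"
       "w = w' \<and> card X - 1 = card Y - 1"
      unfolding eq by auto
    then have "card X > 0" "card Y > 0" by (auto simp: card_gt_0_iff)
    with h(11) have "w = w'" "card X = card Y" by auto
    moreover have "extends (\<lambda>n. w + \<pi> n) S X" "extends (\<lambda>n. w' + \<pi> n) S Y"
      using h(5,10) by (auto intro: attaches_extends)
    ultimately show "i = j"
      unfolding eq by (metis extends_unique)
  qed
  have "(\<integral>\<^sup>+(w, X). indicator {g. attaches g S x X} (\<lambda>n. w + \<pi> n) * ennreal (T ^ (card X - 1)) \<partial>count_space (newcomers S))
     = (\<integral>\<^sup>+i. ennreal (T ^ snd (?\<phi> i)) \<partial>count_space ?J)"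
    by (subst (1 2) nn_integral_count_space_indicator)
       (auto intro!: nn_integral_cong split: split_indicator)
  also have "\<dots> = (\<integral>\<^sup>+j. ennreal (T ^ snd j) \<partial>count_space (?\<phi> ` ?J))"
    by (rule nn_integral_bij_count_space[where g="?\<phi>"], rule bij_betw_imageI[OF inj refl])
  also have "\<dots> \<le> (\<integral>\<^sup>+j. ennreal (T ^ snd j) \<partial>count_space ?K)"
  proof (rule nn_integral_count_space_mono_set, clarify)
    fix w X assume h: "w \<notin> S" "finite X" "w \<in> X" "X \<inter> S = {}" "attaches (\<lambda>n. w + \<pi> n) S x X"
    have "x \<in> early (card X) (\<lambda>n. w + \<pi> n)"
      using h \<pi> x by (intro attaches_early) auto
    moreover have "card X > 0" using h by (auto simp: card_gt_0_iff)
    then have "Suc (card X - 1) = card X" by simp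
    ultimately show "x - w \<in> early (Suc (card X - 1)) \<pi>" by (auto simp: early_translate)
  qed
  also have "\<dots> = (\<integral>\<^sup>+j. indicator ?K j * ennreal (T ^ snd j) \<partial>count_space UNIV)"
    by (subst nn_integral_count_space_indicator) (auto simp: mult.commute)
  also have "\<dots> = (\<integral>\<^sup>+m. \<integral>\<^sup>+w. indicator ?K (w, m) * ennreal (T ^ m) \<partial>count_space UNIV \<partial>count_space UNIV)"
    by (subst nn_integral_snd_count_space[symmetric]) simp
  \<comment> \<open>For fixed \<open>m\<close>, the site \<open>x - w\<close> is one of the at most
    \<open>m + 1\<close> elements of \<open>early (Suc m)\<close>, which leaves at most
    \<open>m + 1\<close> values of \<open>w\<close>.\<close>
  also have "\<dots> \<le> (\<integral>\<^sup>+m. ennreal (real (Suc m) * T ^ m) \<partial>count_space UNIV)"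
  proof (intro nn_integral_mono)
    fix m :: nat
    let ?W = "(\<lambda>y. x - y) ` early (Suc m) \<pi>"
    have fin: "finite ?W" by (simp add: finite_early)
    have c: "card ?W \<le> Suc m"
      using card_image_le[OF finite_early[of "Suc m" \<pi>], of "\<lambda>y. x - y"] card_early[of "Suc m" \<pi>] by linarith
    have "(w, m) \<in> ?K \<longleftrightarrow> w \<in> ?W" for w
      by (auto simp: image_iff intro!: bexI[of _ "x - w"])
    then have "indicator ?K (w, m) = (indicator ?W w :: ennreal)" for w
      by (auto simp: indicator_def)
    then have "(\<integral>\<^sup>+w. indicator ?K (w, m) * ennreal (T ^ m) \<partial>count_space UNIV)
       = (\<integral>\<^sup>+w. ennreal (T ^ m) * indicator ?W w \<partial>count_space UNIV)" by (simp add: mult.commute)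
    also have "\<dots> = ennreal (T ^ m) * of_nat (card ?W)"
      using fin by (subst nn_integral_cmult_indicator) auto
    also have "\<dots> \<le> ennreal (T ^ m) * of_nat (Suc m)"
      using c by (intro mult_left_mono) (simp_all only: of_nat_mono zero_le)
    also have "\<dots> = ennreal (real (Suc m) * T ^ m)"
      using T by (metis ennreal_mult' ennreal_of_nat_eq_real_of_nat mult.commute of_nat_0_le_iff)
    finally show "(\<integral>\<^sup>+w. indicator ?K (w, m) * ennreal (T ^ m) \<partial>count_space UNIV) \<le> ennreal (real (Suc m) * T ^ m)" .
  qed
  also have "\<dots> = ennreal (1 / (1 - T)\<^sup>2)"
  proof -
    have "(\<lambda>m. real (Suc m) * T ^ m) sums (1 / (1 - T)\<^sup>2)"
      using geometric_deriv_sums[of T] T by simp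
    then show ?thesis
      using T by (subst nn_integral_count_space_nat, subst suminf_ennreal2)
        (auto simp: sums_iff zero_le_mult_iff simp del: of_nat_Suc)
  qed
  finally show ?thesis .
qed

text \<open>Each term involves the law of a single car only, so the joint law is irrelevant to the
  sum: all cars may be driven by the same steps, and the pointwise bound applies.\<close>

lemma attaches_sum:
  assumes T: "0 \<le> T" "T < 1" and x: "x \<in> (S :: 'd::finite site set)"
  shows "(\<integral>\<^sup>+(w, X). emeasure (walk_law w) {g. attaches g S x X} * ennreal (T ^ (card X - 1)) \<partial>count_space (newcomers S))
    \<le> ennreal (1 / (1 - T)\<^sup>2)"
proof -
  let ?path = "\<lambda>\<xi> n. \<Sum>k<n. \<xi> k :: 'd site"
  interpret P: prob_space "steps_law :: 'd path measure" by (rule prob_space_steps_law)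
  have meas: "{\<xi>. attaches (\<lambda>n. w + ?path \<xi> n) S x X} \<in> sets steps_law" for w X
  proof -
    have "{\<xi>. attaches (\<lambda>n. w + ?path \<xi> n) S x X}
      = (\<lambda>\<xi> n. w + ?path \<xi> n) -` {g. attaches g S x X} \<inter> space steps_law" by auto
    also have "\<dots> \<in> sets steps_law" by measurable
    finally show ?thesis .
  qed
  have "(\<integral>\<^sup>+(w, X). emeasure (walk_law w) {g. attaches g S x X} * ennreal (T ^ (card X - 1)) \<partial>count_space (newcomers S))
     = (\<integral>\<^sup>+i. emeasure steps_law {\<xi>. attaches (\<lambda>n. fst i + ?path \<xi> n) S x (snd i)} * ennreal (T ^ (card (snd i) - 1)) \<partial>count_space (newcomers S))"
    by (intro nn_integral_cong) (auto simp: emeasure_walk_law[OF sets_attaches])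
  also have "\<dots> = (\<integral>\<^sup>+\<xi>. \<integral>\<^sup>+i. indicator {\<xi>. attaches (\<lambda>n. fst i + ?path \<xi> n) S x (snd i)} \<xi> * ennreal (T ^ (card (snd i) - 1)) \<partial>count_space (newcomers S) \<partial>steps_law)"
    by (rule nn_integral_count_space_emeasure) (simp_all add: meas)
  also have "\<dots> \<le> (\<integral>\<^sup>+\<xi>. ennreal (1 / (1 - T)\<^sup>2) \<partial>(steps_law :: 'd path measure))"
    using attaches_sum_pointwise[OF T x, of "?path _"]
    by (intro nn_integral_mono) (simp add: case_prod_unfold indicator_def)
  also have "\<dots> = ennreal (1 / (1 - T)\<^sup>2)" using P.emeasure_space_1 by simp
  finally show ?thesis .
qed

text \<open>Along one path there is at most one \<open>X\<close> of each size, which leaves a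
  geometric series.\<close>

lemma extends_sum:
  assumes T: "0 \<le> T" "T < 1"
  shows "(\<integral>\<^sup>+X. emeasure (walk_law w) {g. extends g S X} * ennreal (T ^ card X) \<partial>count_space {X :: 'd::finite site set. finite X \<and> X \<inter> S = {}})
    \<le> ennreal (1 / (1 - T))"
proof -
  interpret P: prob_space "walk_law w" by (rule prob_space_walk_law)
  let ?I = "{X :: 'd site set. finite X \<and> X \<inter> S = {}}"
  have "(\<integral>\<^sup>+X. emeasure (walk_law w) {g. extends g S X} * ennreal (T ^ card X) \<partial>count_space ?I)
     = (\<integral>\<^sup>+g. \<integral>\<^sup>+X. indicator {g. extends g S X} g * ennreal (T ^ card X) \<partial>count_space ?I \<partial>walk_law w)"
    by (rule nn_integral_count_space_emeasure) (simp_all add: sets_extends)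
  also have "\<dots> \<le> (\<integral>\<^sup>+g. ennreal (1 / (1 - T)) \<partial>walk_law w)"
  proof (intro nn_integral_mono)
    fix g
    let ?J = "{X \<in> ?I. extends g S X}"
    have "(\<integral>\<^sup>+X. indicator {g. extends g S X} g * ennreal (T ^ card X) \<partial>count_space ?I)
       = (\<integral>\<^sup>+X. ennreal (T ^ card X) \<partial>count_space ?J)"
      by (subst (1 2) nn_integral_count_space_indicator) (auto intro!: nn_integral_cong split: split_indicator)
    also have "\<dots> = (\<integral>\<^sup>+m. ennreal (T ^ m) \<partial>count_space (card ` ?J))"
      by (rule nn_integral_bij_count_space[where g=card], rule bij_betw_imageI[OF _ refl])
         (auto intro!: inj_onI dest: extends_unique)
    also have "\<dots> \<le> (\<integral>\<^sup>+m. ennreal (T ^ m) \<partial>count_space UNIV)"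
      by (rule nn_integral_count_space_mono_set) auto
    also have "\<dots> = ennreal (1 / (1 - T))"
      using T geometric_sums[of T]
      by (subst nn_integral_count_space_nat, subst suminf_ennreal2) (auto simp: sums_iff)
    finally show "(\<integral>\<^sup>+X. indicator {g. extends g S X} g * ennreal (T ^ card X) \<partial>count_space ?I) \<le> ennreal (1 / (1 - T))" .
  qed
  also have "\<dots> = ennreal (1 / (1 - T))" using P.emeasure_space_1 by simp
  finally show ?thesis .
qed

section \<open>Exploring the cars that fill a set of sites\<close>

definition attach_event :: "'d::finite site set \<Rightarrow> 'd site \<Rightarrow> 'd site \<times> 'd site set \<Rightarrow> 'd config set"
  where "attach_event S x i = {\<omega>. init \<omega> (fst i) = 1 \<and> walk \<omega> (fst i) \<in> {g. attaches g S x (snd i)}}"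

definition extend_event :: "'d::finite site set \<Rightarrow> 'd site \<Rightarrow> 'd site set \<Rightarrow> 'd config set"
  where "extend_event S x X = {\<omega>. init \<omega> x = 1 \<and> walk \<omega> x \<in> {g. extends g S X}}"

text \<open>In \<open>exploration h S Q1 Q2 b\<close>, \<open>S\<close> is the set of known sites, \<open>Q1\<close> the part whose initial state is not yet
  known, \<open>Q2\<close> the part where further cars from outside \<open>S\<close> may enter \<open>S\<close>, and \<open>b\<close> the number of cars minus
  the number of spots found so far. A configuration belongs to it if at most \<open>h\<close> decisions empty \<open>Q1\<close> and
  \<open>Q2\<close> with \<open>b \<ge> 0\<close> at the end. The event does not depend on the coordinates in \<open>S - Q1\<close>.\<close>

primrec exploration :: "nat \<Rightarrow> 'd::finite site set \<Rightarrow> 'd site set \<Rightarrow> 'd site set \<Rightarrow> int \<Rightarrow> 'd config set"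
  where
    "exploration 0 S Q1 Q2 b = (if Q1 = {} \<and> Q2 = {} \<and> b \<ge> 0 then UNIV else {})"
  | "exploration (Suc h) S Q1 Q2 b =
      (if Q2 \<noteq> {} then
         (let x = SOME x. x \<in> Q2 in
           exploration h S Q1 (Q2 - {x}) b \<union>
           (\<Union>i\<in>newcomers S. attach_event S x i \<inter>
             exploration h (S \<union> snd i) (Q1 \<union> (snd i - {fst i})) (insert (fst i) Q2) (b + 1)))
       else if Q1 \<noteq> {} then
         (let x = SOME x. x \<in> Q1 in
           ({\<omega>. init \<omega> x \<in> {i. i \<noteq> 1}} \<inter> exploration h S (Q1 - {x}) {x} (b - 1)) \<union>
           (\<Union>X\<in>{X. finite X \<and> X \<inter> S = {}}. extend_event S x X \<inter>
             exploration h (S \<union> X) (Q1 - {x} \<union> X) {x} (b + 1)))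
       else if b \<ge> 0 then UNIV else {})"

lemma exploration_attach:
  "x = (SOME x. x \<in> Q2) \<Longrightarrow> Q2 \<noteq> {} \<Longrightarrow> exploration (Suc h) S Q1 Q2 b = exploration h S Q1 (Q2 - {x}) b \<union>
    (\<Union>i\<in>newcomers S. attach_event S x i \<inter>
      exploration h (S \<union> snd i) (Q1 \<union> (snd i - {fst i})) (insert (fst i) Q2) (b + 1))"
  by (simp add: Let_def)

lemma exploration_label:
  "x = (SOME x. x \<in> Q1) \<Longrightarrow> Q1 \<noteq> {} \<Longrightarrow> exploration (Suc h) S Q1 {} b =
    ({\<omega>. init \<omega> x \<in> {i. i \<noteq> 1}} \<inter> exploration h S (Q1 - {x}) {x} (b - 1)) \<union>
    (\<Union>X\<in>{X. finite X \<and> X \<inter> S = {}}. extend_event S x X \<inter>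
      exploration h (S \<union> X) (Q1 - {x} \<union> X) {x} (b + 1))"
  by (simp add: Let_def)

text \<open>A decision reads a coordinate in \<open>Q1\<close> or outside \<open>S\<close>, and
  hands it on as a member of \<open>S\<close> that is not in the new \<open>Q1\<close>; nothing is
  read twice.\<close>

lemma exploration_cong:
  assumes "Q1 \<subseteq> S" "Q2 \<subseteq> S" "\<And>v. v \<in> Q1 \<or> v \<notin> S \<Longrightarrow> \<omega> v = \<omega>' v"
  shows "\<omega> \<in> exploration h S Q1 Q2 b \<longleftrightarrow> \<omega>' \<in> exploration h S Q1 Q2 b"
  using assms
proof (induction h arbitrary: S Q1 Q2 b)
  case (Suc h)
  consider "Q2 \<noteq> {}" | "Q2 = {}" "Q1 \<noteq> {}" | "Q2 = {}" "Q1 = {}" by blast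
  then show ?case
  proof cases
    case 1
    define x where "x = (SOME x. x \<in> Q2)"
    have x: "x \<in> Q2" using 1 by (simp add: x_def some_in_eq)
    note step = exploration_attach[OF x_def 1]
    have close: "\<omega> \<in> exploration h S Q1 (Q2 - {x}) b \<longleftrightarrow> \<omega>' \<in> exploration h S Q1 (Q2 - {x}) b"
      by (rule Suc.IH) (use Suc.prems(1,2) in \<open>auto intro!: Suc.prems(3)\<close>)
    have attach: "\<omega> \<in> attach_event S x i \<inter> exploration h (S \<union> snd i) (Q1 \<union> (snd i - {fst i})) (insert (fst i) Q2) (b + 1)
        \<longleftrightarrow> \<omega>' \<in> attach_event S x i \<inter> exploration h (S \<union> snd i) (Q1 \<union> (snd i - {fst i})) (insert (fst i) Q2) (b + 1)"
      if i: "i \<in> newcomers S" for i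
    proof -
      have "\<omega> \<in> exploration h (S \<union> snd i) (Q1 \<union> (snd i - {fst i})) (insert (fst i) Q2) (b + 1)
        \<longleftrightarrow> \<omega>' \<in> exploration h (S \<union> snd i) (Q1 \<union> (snd i - {fst i})) (insert (fst i) Q2) (b + 1)"
        by (rule Suc.IH) (use Suc.prems(1,2) i in \<open>auto intro!: Suc.prems(3)\<close>)
      moreover have "\<omega> (fst i) = \<omega>' (fst i)"
        using Suc.prems(3)[of "fst i"] i by auto
      ultimately show ?thesis by (simp add: attach_event_def init_def walk_def)
    qed
    show ?thesis
      unfolding step Un_iff UN_iff close using attach by (metis (no_types, lifting))
  next
    case 2
    define x where "x = (SOME x. x \<in> Q1)"
    have x: "x \<in> Q1" using 2 by (simp add: x_def some_in_eq)
    note step = exploration_label[OF x_def 2(2)]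
    have eq: "\<omega> x = \<omega>' x" using Suc.prems(3)[of x] x by auto
    have spot: "\<omega> \<in> {\<omega>. init \<omega> x \<in> {i. i \<noteq> 1}} \<inter> exploration h S (Q1 - {x}) {x} (b - 1) \<longleftrightarrow>
        \<omega>' \<in> {\<omega>. init \<omega> x \<in> {i. i \<noteq> 1}} \<inter> exploration h S (Q1 - {x}) {x} (b - 1)"
    proof -
      have "\<omega> \<in> exploration h S (Q1 - {x}) {x} (b - 1) \<longleftrightarrow> \<omega>' \<in> exploration h S (Q1 - {x}) {x} (b - 1)"
        by (rule Suc.IH) (use Suc.prems(1,2) x in \<open>auto intro!: Suc.prems(3)\<close>)
      then show ?thesis by (simp add: init_def eq)
    qed
    have car: "\<omega> \<in> extend_event S x X \<inter> exploration h (S \<union> X) (Q1 - {x} \<union> X) {x} (b + 1)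
       \<longleftrightarrow> \<omega>' \<in> extend_event S x X \<inter> exploration h (S \<union> X) (Q1 - {x} \<union> X) {x} (b + 1)"
      if "X \<in> {X. finite X \<and> X \<inter> S = {}}" for X
    proof -
      have "\<omega> \<in> exploration h (S \<union> X) (Q1 - {x} \<union> X) {x} (b + 1)
        \<longleftrightarrow> \<omega>' \<in> exploration h (S \<union> X) (Q1 - {x} \<union> X) {x} (b + 1)"
        by (rule Suc.IH) (use Suc.prems(1,2) x that in \<open>auto intro!: Suc.prems(3)\<close>)
      then show ?thesis by (simp add: extend_event_def init_def walk_def eq)
    qed
    show ?thesis
      unfolding 2(1) step Un_iff UN_iff spot using car by (metis (no_types, lifting))
  qed simp
qed simp

lemma exploration_upd:
  assumes "Q1 \<subseteq> S" "Q2 \<subseteq> S" "v \<in> S" "v \<notin> Q1"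
  shows "fun_upd \<omega> v y \<in> exploration h S Q1 Q2 b \<longleftrightarrow> \<omega> \<in> exploration h S Q1 Q2 b"
  using assms by (intro exploration_cong) auto

text \<open>\<open>T\<close> and \<open>L\<close> bound the generating functions of what is found from one site of \<open>Q1\<close> and of \<open>Q2\<close>; an
  entering car with \<open>m\<close> new sites has weight \<open>m * T ^ (m - 1)\<close>, whence the factor \<open>1 / (1 - T)\<^sup>2\<close>.\<close>

lemma emeasure_exploration:
  fixes S Q1 Q2 :: "'d::finite site set"
  assumes p: "0 \<le> p" "p \<le> 1" and z: "1 \<le> z" and T: "0 \<le> T" "T < 1" and L: "0 \<le> L"
    and attach_budget: "1 + p * z * L\<^sup>2 / (1 - T)\<^sup>2 \<le> L"
    and label_budget: "L * ((1 - p) / z + p * z / (1 - T)) \<le> T"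
    and S: "finite S" "Q1 \<subseteq> S" "Q2 \<subseteq> S"
  shows "exploration h S Q1 Q2 b \<in> sets (parking_measure p) \<and>
    emeasure (parking_measure p) (exploration h S Q1 Q2 b) \<le> ennreal (T ^ card Q1 * L ^ card Q2 * z powi b)"
  using S
proof (induction h arbitrary: S Q1 Q2 b)
  case 0
  interpret prob_space "parking_measure p :: 'd config measure" by (rule prob_space_parking_measure)
  \<comment> \<open>Chernoff weight: the final requirement \<open>b \<ge> 0\<close> is only used
    through \<open>z powi b \<ge> 1\<close>.\<close>
  have "1 \<le> z powi b" if "b \<ge> 0"
    using that z by (simp add: power_int_def one_le_power)
  moreover have "UNIV \<in> sets (parking_measure p :: 'd config measure)"
    using sets.top[of "parking_measure p :: 'd config measure"] by simp
  ultimately show ?case using emeasure_space_1 by auto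
next
  case (Suc h)
  let ?P = "parking_measure p :: 'd config measure"
  interpret prob_space ?P by (rule prob_space_parking_measure)
  have zb: "0 < z powi b" using z by simp
  have zb1: "z powi (b + 1) = z powi b * z" and zbm: "z powi (b - 1) = z powi b / z"
    using z by (auto simp: power_int_add_1 power_int_diff)
  have fin: "finite Q1" "finite Q2" using Suc.prems by (auto intro: finite_subset)
  consider "Q2 \<noteq> {}" | "Q2 = {}" "Q1 \<noteq> {}" | "Q2 = {}" "Q1 = {}" by blast
  then show ?case
  proof cases
    case 1
    define x where "x = (SOME x. x \<in> Q2)"
    have x: "x \<in> Q2" using 1 by (simp add: x_def some_in_eq)
    note step = exploration_attach[OF x_def 1]
    let ?F = "\<lambda>i. exploration h (S \<union> snd i) (Q1 \<union> (snd i - {fst i})) (insert (fst i) Q2) (b + 1)"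
    let ?U = "\<Union>i\<in>newcomers S. attach_event S x i \<inter> ?F i"
    obtain r where r: "card Q2 = Suc r" "card (Q2 - {x}) = r"
      using x fin by (metis card_Suc_Diff1)
    \<comment> \<open>An attached car \<open>w\<close> leaves \<open>x\<close> in \<open>Q2\<close>
      and joins it, so compared with closing \<open>x\<close> it costs \<open>L\<^sup>2 * z\<close>.
      Its own state is known, so only the other new sites enter \<open>Q1\<close>.\<close>
    define c where "c = T ^ card Q1 * L ^ Suc (card Q2) * z powi (b + 1)"
    have c0: "0 \<le> c" using T L z by (auto simp: c_def)
    have close: "exploration h S Q1 (Q2 - {x}) b \<in> sets ?P"
      "emeasure ?P (exploration h S Q1 (Q2 - {x}) b) \<le> ennreal (T ^ card Q1 * L ^ r * z powi b)"
      using Suc.IH[of S Q1 "Q2 - {x}" b] Suc.prems r by auto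
    have U: "?U \<in> sets ?P \<and> emeasure ?P ?U \<le> ennreal (p * c * (1 / (1 - T)\<^sup>2))"
      unfolding attach_event_def
    proof (rule emeasure_UN_cars[OF p countable_newcomers c0, where h="\<lambda>i. T ^ (card (snd i) - 1)"])
      fix i assume i: "i \<in> newcomers S"
      have pre: "finite (S \<union> snd i)" "Q1 \<union> (snd i - {fst i}) \<subseteq> S \<union> snd i" "insert (fst i) Q2 \<subseteq> S \<union> snd i"
        using Suc.prems i by auto
      note IH = Suc.IH[OF pre, of "b + 1"]
      show "?F i \<in> sets ?P" using IH by blast
      show "fun_upd \<omega> (fst i) y \<in> ?F i \<longleftrightarrow> \<omega> \<in> ?F i" for \<omega> y
        using i Suc.prems by (intro exploration_upd) auto
      have "card (Q1 \<union> (snd i - {fst i})) = card Q1 + (card (snd i) - 1)"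
        using i Suc.prems fin by (subst card_Un_disjoint) auto
      moreover have "card (insert (fst i) Q2) = Suc (card Q2)"
        using i Suc.prems fin by (subst card_insert_disjoint) auto
      ultimately show "emeasure ?P (?F i) \<le> ennreal (c * T ^ (card (snd i) - 1))"
        using IH by (simp add: c_def power_add mult_ac)
    next
      show "(\<integral>\<^sup>+i. emeasure (walk_law (fst i)) {g. attaches g S x (snd i)} * ennreal (T ^ (card (snd i) - 1)) \<partial>count_space (newcomers S))
          \<le> ennreal (1 / (1 - T)\<^sup>2)"
        using attaches_sum[OF T, of x S] x Suc.prems by (auto simp: case_prod_unfold)
    qed (use T sets_attaches in auto)
    have "emeasure ?P (exploration (Suc h) S Q1 Q2 b) \<le> ennreal (T ^ card Q1 * L ^ r * z powi b) + ennreal (p * c * (1 / (1 - T)\<^sup>2))"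
      unfolding step using close(2) U
      by (intro order.trans[OF emeasure_subadditive[OF close(1)]] add_mono) auto
    also have "\<dots> = ennreal (T ^ card Q1 * L ^ r * z powi b * (1 + p * z * L\<^sup>2 / (1 - T)\<^sup>2))"
    proof -
      have "p * c * (1 / (1 - T)\<^sup>2) = T ^ card Q1 * L ^ r * z powi b * (p * z * L\<^sup>2 / (1 - T)\<^sup>2)"
        by (simp add: c_def r zb1 power2_eq_square mult_ac del: power_int_add_1)
      moreover have "0 \<le> T ^ card Q1 * L ^ r * z powi b * (p * z * L\<^sup>2 / (1 - T)\<^sup>2)"
        "0 \<le> T ^ card Q1 * L ^ r * z powi b"
        using p T L z by auto
      ultimately show ?thesis by (simp only: distrib_left ennreal_plus mult_1_right)
    qed
    also have "\<dots> \<le> ennreal (T ^ card Q1 * L ^ r * z powi b * L)"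
      using T L z attach_budget by (intro ennreal_leI mult_left_mono) auto
    finally show ?thesis using step close conjunct1[OF U] by (simp add: r mult_ac)
  next
    case 2
    define x where "x = (SOME x. x \<in> Q1)"
    have x: "x \<in> Q1" using 2 by (simp add: x_def some_in_eq)
    note step = exploration_label[OF x_def 2(2)]
    obtain r where r: "card Q1 = Suc r" "card (Q1 - {x}) = r"
      using x fin by (metis card_Suc_Diff1)
    let ?I = "{X. finite X \<and> X \<inter> S = {}}"
    let ?F = "\<lambda>X. exploration h (S \<union> X) (Q1 - {x} \<union> X) {x} (b + 1)"
    let ?U = "\<Union>X\<in>?I. extend_event S x X \<inter> ?F X"
    let ?B = "{\<omega>. init \<omega> x \<in> {i. i \<noteq> 1}} \<inter> exploration h S (Q1 - {x}) {x} (b - 1)"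
    \<comment> \<open>In both outcomes the labelled site moves from \<open>Q1\<close> to
      \<open>Q2\<close>: one factor \<open>T\<close> is exchanged for \<open>L\<close>.\<close>
    define c where "c = T ^ r * L * z powi (b + 1)"
    have c0: "0 \<le> c" using T L z by (auto simp: c_def)
    have spot: "?B \<in> sets ?P" "emeasure ?P ?B \<le> ennreal ((1 - p) * (T ^ r * L * z powi (b - 1)))"
    proof -
      let ?F = "exploration h S (Q1 - {x}) {x} (b - 1)"
      have pre: "finite (S)" "Q1 - {x} \<subseteq> S" "{x} \<subseteq> S"
        using Suc.prems x by auto
      have IH: "?F \<in> sets ?P" "emeasure ?P ?F \<le> ennreal (T ^ r * L * z powi (b - 1))"
        using Suc.IH[of "S" "Q1 - {x}" "{x}" "b - 1", OF pre] r by auto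
      have inv: "fun_upd \<omega> x y \<in> ?F \<longleftrightarrow> \<omega> \<in> ?F" for \<omega> y
        using x Suc.prems by (intro exploration_upd) auto
      show "?B \<in> sets ?P" by (rule emeasure_init_site[OF IH(1) inv])
      have "emeasure ?P ?B = ennreal (1 - p) * emeasure ?P ?F"
        by (subst emeasure_init_site[OF IH(1) inv]) (simp add: emeasure_init_law p)
      also have "\<dots> \<le> ennreal (1 - p) * ennreal (T ^ r * L * z powi (b - 1))"
        using IH(2) by (intro mult_left_mono) auto
      finally show "emeasure ?P ?B \<le> ennreal ((1 - p) * (T ^ r * L * z powi (b - 1)))"
        using p by (simp add: ennreal_mult')
    qed
    have U: "?U \<in> sets ?P \<and> emeasure ?P ?U \<le> ennreal (p * c * (1 / (1 - T)))"
      unfolding extend_event_def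
    proof (rule emeasure_UN_cars[OF p countable_finite_sets c0, where v="\<lambda>_. x" and h="\<lambda>X. T ^ card X"])
      fix X assume X: "X \<in> ?I"
      have pre: "finite (S \<union> X)" "Q1 - {x} \<union> X \<subseteq> S \<union> X" "{x} \<subseteq> S \<union> X"
        using Suc.prems X x by auto
      note IH = Suc.IH[OF pre, of "b + 1"]
      show "?F X \<in> sets ?P" using IH by blast
      show "fun_upd \<omega> x y \<in> ?F X \<longleftrightarrow> \<omega> \<in> ?F X" for \<omega> y
        using X x Suc.prems by (intro exploration_upd) auto
      have "card (Q1 - {x} \<union> X) = r + card X"
        unfolding r(2)[symmetric] using X Suc.prems fin by (subst card_Un_disjoint) auto
      then show "emeasure ?P (?F X) \<le> ennreal (c * T ^ card X)"
        using IH by (simp add: c_def power_add mult_ac)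
    qed (use T sets_extends extends_sum[OF T, where w=x and S=S] in auto)
    have "emeasure ?P (exploration (Suc h) S Q1 Q2 b) \<le> ennreal ((1 - p) * (T ^ r * L * z powi (b - 1))) + ennreal (p * c * (1 / (1 - T)))"
      unfolding step 2(1) using spot(2) U
      by (intro order.trans[OF emeasure_subadditive[OF spot(1)]] add_mono) auto
    also have "\<dots> = ennreal (T ^ r * z powi b * (L * ((1 - p) / z + p * z / (1 - T))))"
    proof -
      have "(1 - p) * (T ^ r * L * z powi (b - 1)) = T ^ r * z powi b * (L * ((1 - p) / z))"
        by (simp add: zbm)
      moreover have "p * c * (1 / (1 - T)) = T ^ r * z powi b * (L * (p * z / (1 - T)))"
        by (simp add: c_def zb1 mult_ac)
      moreover have "0 \<le> T ^ r * z powi b * (L * ((1 - p) / z))" "0 \<le> T ^ r * z powi b * (L * (p * z / (1 - T)))"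
        using T L z p by auto
      ultimately show ?thesis by (simp only: distrib_left ennreal_plus)
    qed
    also have "\<dots> \<le> ennreal (T ^ r * z powi b * T)"
      using T L z label_budget by (intro ennreal_leI mult_left_mono) auto
    finally show ?thesis using step spot conjunct1[OF U] 2 by (simp add: r mult_ac)
  next
    case 3
    have "1 \<le> z powi b" if "b \<ge> 0"
      using that z by (simp add: power_int_def one_le_power)
    moreover have "UNIV \<in> sets ?P"
      using sets.top[of ?P] by simp
    ultimately show ?thesis using emeasure_space_1 3 by auto
  qed
qed

text \<open>\<open>G\<close> is a finite set of cars that fill all spots on their tracks, and \<open>R\<close> its part not yet used.\<close>

lemma exploration_complete:
  fixes \<omega> :: "'d::finite config" and n :: "'d site \<Rightarrow> nat"
  defines "track w \<equiv> walk \<omega> w ` {..n w}"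
  assumes start: "\<And>v. walk \<omega> v 0 = v"
    and G: "finite G" "\<And>w. w \<in> G \<Longrightarrow> init \<omega> w = 1"
    and tracks: "\<And>w y. w \<in> G \<Longrightarrow> y \<in> track w \<Longrightarrow> init \<omega> y \<noteq> 1 \<Longrightarrow> y \<in> (\<lambda>u. walk \<omega> u (n u)) ` G"
    and U: "finite U" "\<And>w. w \<in> G \<Longrightarrow> track w \<subseteq> U"
    and R: "R \<subseteq> G" and S: "S \<subseteq> U" "Q1 \<subseteq> S" "Q2 \<subseteq> S"
    and used: "\<And>w. w \<in> G - R \<Longrightarrow> track w \<subseteq> S"
    and waiting: "R \<inter> S \<subseteq> Q1"
    and first_hit: "\<And>w k. w \<in> R - S \<Longrightarrow> k \<le> n w \<Longrightarrow> walk \<omega> w k \<in> S \<Longrightarrow> (\<And>j. j < k \<Longrightarrow> walk \<omega> w j \<notin> S)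
       \<Longrightarrow> walk \<omega> w k \<in> Q1 \<union> Q2"
    and b: "int (card (G - R)) - int (card {y \<in> S - Q1. init \<omega> y \<noteq> 1}) \<le> b"
    and covered: "\<And>y. y \<in> S \<Longrightarrow> init \<omega> y \<noteq> 1 \<Longrightarrow> y \<in> (\<lambda>u. walk \<omega> u (n u)) ` G"
  shows "\<exists>h. \<omega> \<in> exploration h S Q1 Q2 b"
  using R S used waiting first_hit b covered
proof (induction "card R * (2 * card U + 2) + 2 * card Q1 + card Q2" arbitrary: R S Q1 Q2 b rule: less_induct)
  case less
  note prems = less.prems
  have finS: "finite S" "finite Q1" "finite Q2" "finite R"
    using prems(1-4) U(1) G(1) by (meson finite_subset)+
  have w_track: "w \<in> track w" for w using start[of w] by (auto simp: track_def intro!: image_eqI[of _ _ 0])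
  consider "Q2 \<noteq> {}" | "Q2 = {}" "Q1 \<noteq> {}" | "Q2 = {}" "Q1 = {}" by blast
  then show ?case
  proof cases
    case 1
    define x where "x = (SOME x. x \<in> Q2)"
    have x: "x \<in> Q2" using 1 by (simp add: x_def some_in_eq)
    note step = exploration_attach[OF x_def 1]
    show ?thesis
    proof (cases "\<exists>w\<in>R - S. \<exists>k\<le>n w. walk \<omega> w k = x \<and> (\<forall>j<k. walk \<omega> w j \<notin> S)")
      case True
      then obtain w k where w: "w \<in> R" "w \<notin> S" "k \<le> n w" "walk \<omega> w k = x" "\<And>j. j < k \<Longrightarrow> walk \<omega> w j \<notin> S"
        by auto
      define X where "X = track w - S"
      have X: "finite X" "w \<in> X" "X \<inter> S = {}" "attaches (walk \<omega> w) S x X"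
        using w w_track by (auto simp: X_def track_def attaches_def)
      have carw: "init \<omega> w = 1" using w(1) prems(1) G by auto
      have "\<exists>h. \<omega> \<in> exploration h (S \<union> X) (Q1 \<union> (X - {w})) (insert w Q2) (b + 1)"
      proof (rule less.hyps[of "R - {w}"])
        have Q1U: "Q1 \<union> (X - {w}) \<subseteq> U - {w}"
          using prems(2-3) U(2)[of w] w(1,2) prems(1) by (auto simp: X_def)
        have "card (Q1 \<union> (X - {w})) \<le> card U"
          using Q1U U(1) by (intro card_mono) auto
        moreover have "card (insert w Q2) \<le> card Q2 + 1"
          using card_insert_le_m1[of "card Q2 + 1" Q2 w] by simp
        moreover have "card R = Suc (card (R - {w}))"
          using w(1) finS(4) by (metis card_Suc_Diff1)
        ultimately show "card (R - {w}) * (2 * card U + 2) + 2 * card (Q1 \<union> (X - {w})) + card (insert w Q2)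
            < card R * (2 * card U + 2) + 2 * card Q1 + card Q2"
          by simp
        show "R - {w} \<subseteq> G" "S \<union> X \<subseteq> U" "Q1 \<union> (X - {w}) \<subseteq> S \<union> X" "insert w Q2 \<subseteq> S \<union> X"
          using prems(1-4) U(2)[of w] w(1) X(2) by (auto simp: X_def)
        show "track u \<subseteq> S \<union> X" if "u \<in> G - (R - {w})" for u
          using prems(5)[of u] that by (cases "u = w") (auto simp: X_def)
        show "(R - {w}) \<inter> (S \<union> X) \<subseteq> Q1 \<union> (X - {w})" using prems(6) by auto
        show "walk \<omega> u i \<in> Q1 \<union> (X - {w}) \<union> insert w Q2"
          if u: "u \<in> R - {w} - (S \<union> X)" "i \<le> n u" "walk \<omega> u i \<in> S \<union> X" "\<And>j. j < i \<Longrightarrow> walk \<omega> u j \<notin> S \<union> X" for u i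
        proof (cases "walk \<omega> u i \<in> X")
          case False
          then have "walk \<omega> u i \<in> Q1 \<union> Q2" using u by (intro prems(7)) auto
          then show ?thesis by auto
        qed auto
        have "{y \<in> S \<union> X - (Q1 \<union> (X - {w})). init \<omega> y \<noteq> 1} = {y \<in> S - Q1. init \<omega> y \<noteq> 1}"
          using X(2,3) carw by auto
        moreover have "card (G - (R - {w})) = Suc (card (G - R))"
        proof -
          have "G - (R - {w}) = insert w (G - R)" using w(1) prems(1) by auto
          then show ?thesis using w(1) G(1) by auto
        qed
        ultimately show "int (card (G - (R - {w}))) - int (card {y \<in> S \<union> X - (Q1 \<union> (X - {w})). init \<omega> y \<noteq> 1}) \<le> b + 1"
          using prems(8) by simp
        show "y \<in> (\<lambda>u. walk \<omega> u (n u)) ` G" if "y \<in> S \<union> X" "init \<omega> y \<noteq> 1" for y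
          using prems(9)[of y] tracks[of w y] that w(1) prems(1) by (auto simp: X_def)
      qed
      then obtain h where h: "\<omega> \<in> exploration h (S \<union> X) (Q1 \<union> (X - {w})) (insert w Q2) (b + 1)" by auto
      have "\<omega> \<in> attach_event S x (w, X) \<inter> exploration h (S \<union> snd (w, X)) (Q1 \<union> (snd (w, X) - {fst (w, X)})) (insert (fst (w, X)) Q2) (b + 1)"
        using h X carw by (simp add: attach_event_def)
      moreover have "(w, X) \<in> newcomers S" using X w by auto
      ultimately have "\<omega> \<in> exploration (Suc h) S Q1 Q2 b" unfolding step by blast
      then show ?thesis by blast
    next
      case False
      have "\<exists>h. \<omega> \<in> exploration h S Q1 (Q2 - {x}) b"
      proof (rule less.hyps[of R])
        have "card (Q2 - {x}) < card Q2" using x finS(3) by (metis card_Diff1_less)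
        then show "card R * (2 * card U + 2) + 2 * card Q1 + card (Q2 - {x})
            < card R * (2 * card U + 2) + 2 * card Q1 + card Q2" by simp
        show "walk \<omega> w k \<in> Q1 \<union> (Q2 - {x})"
          if "w \<in> R - S" "k \<le> n w" "walk \<omega> w k \<in> S" "\<And>j. j < k \<Longrightarrow> walk \<omega> w j \<notin> S" for w k
          using prems(7)[OF that] that False by blast
      qed (use prems in auto)
      then obtain h where "\<omega> \<in> exploration h S Q1 (Q2 - {x}) b" by auto
      then have "\<omega> \<in> exploration (Suc h) S Q1 Q2 b" unfolding step by blast
      then show ?thesis by blast
    qed
  next
    case 2
    define x where "x = (SOME x. x \<in> Q1)"
    have x: "x \<in> Q1" using 2 by (simp add: x_def some_in_eq)
    note step = exploration_label[OF x_def 2(2)]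
    have cardQ1: "card Q1 = Suc (card (Q1 - {x}))" using x finS(2) by (metis card_Suc_Diff1)
    show ?thesis
    proof (cases "init \<omega> x = 1")
      case False
      have "\<exists>h. \<omega> \<in> exploration h S (Q1 - {x}) {x} (b - 1)"
      proof (rule less.hyps[of R])
        show "card R * (2 * card U + 2) + 2 * card (Q1 - {x}) + card {x}
            < card R * (2 * card U + 2) + 2 * card Q1 + card Q2" using cardQ1 by simp
        show "R \<inter> S \<subseteq> Q1 - {x}" using prems(1,6) G(2) False by auto
        show "walk \<omega> w k \<in> Q1 - {x} \<union> {x}"
          if "w \<in> R - S" "k \<le> n w" "walk \<omega> w k \<in> S" "\<And>j. j < k \<Longrightarrow> walk \<omega> w j \<notin> S" for w k
          using prems(7)[OF that] 2 by blast
        have "{y \<in> S - (Q1 - {x}). init \<omega> y \<noteq> 1} = insert x {y \<in> S - Q1. init \<omega> y \<noteq> 1}"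
          using False x prems(3) by auto
        then have "card {y \<in> S - (Q1 - {x}). init \<omega> y \<noteq> 1} = Suc (card {y \<in> S - Q1. init \<omega> y \<noteq> 1})"
          using x finS(1) by auto
        then show "int (card (G - R)) - int (card {y \<in> S - (Q1 - {x}). init \<omega> y \<noteq> 1}) \<le> b - 1"
          using prems(8) by simp
      qed (use prems x in auto)
      then obtain h where "\<omega> \<in> exploration h S (Q1 - {x}) {x} (b - 1)" by auto
      then have "\<omega> \<in> exploration (Suc h) S Q1 {} b" unfolding step using False by blast
      then show ?thesis using 2 by blast
    next
      case True
      \<comment> \<open>A car that is not waiting in \<open>R\<close> reveals nothing: its path is
        stopped at time 0. It still raises \<open>b\<close>, which is harmless.\<close>
      define X where "X = (if x \<in> R then track x - S else {})"
      have xS: "x \<in> S" using x prems(3) by auto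
      have X: "finite X" "X \<inter> S = {}"
        by (auto simp: X_def track_def)
      have ext: "extends (walk \<omega> x) S X"
      proof (cases "x \<in> R")
        case False
        then show ?thesis unfolding extends_def X_def
          by (intro exI[of _ 0]) (use start[of x] xS in auto)
      qed (auto simp: extends_def X_def track_def)
      have "\<exists>h. \<omega> \<in> exploration h (S \<union> X) (Q1 - {x} \<union> X) {x} (b + 1)"
      proof (rule less.hyps[of "R - {x}"])
        show "card (R - {x}) * (2 * card U + 2) + 2 * card (Q1 - {x} \<union> X) + card {x}
            < card R * (2 * card U + 2) + 2 * card Q1 + card Q2"
        proof (cases "x \<in> R")
          case True
          have "card (Q1 - {x} \<union> X) \<le> card U"
            using prems(1-3) U(1) U(2)[of x] True by (intro card_mono) (auto simp: X_def)
          moreover have "card R = Suc (card (R - {x}))"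
            using True finS(4) by (metis card_Suc_Diff1)
          ultimately show ?thesis by simp
        qed (use cardQ1 in \<open>simp add: X_def\<close>)
        show "R - {x} \<subseteq> G" "S \<union> X \<subseteq> U" "Q1 - {x} \<union> X \<subseteq> S \<union> X" "{x} \<subseteq> S \<union> X"
          using prems(1-4) U(2)[of x] xS by (auto simp: X_def split: if_splits)
        show "track u \<subseteq> S \<union> X" if "u \<in> G - (R - {x})" for u
          using prems(5)[of u] that by (cases "u = x") (auto simp: X_def)
        show "(R - {x}) \<inter> (S \<union> X) \<subseteq> Q1 - {x} \<union> X" using prems(6) by auto
        show "walk \<omega> u i \<in> Q1 - {x} \<union> X \<union> {x}"
          if u: "u \<in> R - {x} - (S \<union> X)" "i \<le> n u" "walk \<omega> u i \<in> S \<union> X" "\<And>j. j < i \<Longrightarrow> walk \<omega> u j \<notin> S \<union> X" for u i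
        proof (cases "walk \<omega> u i \<in> X")
          case False
          then have "walk \<omega> u i \<in> Q1 \<union> Q2" using u by (intro prems(7)) auto
          then show ?thesis using 2 by auto
        qed auto
        have "{y \<in> S \<union> X - (Q1 - {x} \<union> X). init \<omega> y \<noteq> 1} = {y \<in> S - Q1. init \<omega> y \<noteq> 1}"
          using X(2) True by auto
        moreover have "card (G - (R - {x})) \<le> Suc (card (G - R))"
        proof -
          have "G - (R - {x}) \<subseteq> insert x (G - R)" by auto
          then have "card (G - (R - {x})) \<le> card (insert x (G - R))" using G(1) by (intro card_mono) auto
          also have "\<dots> \<le> Suc (card (G - R))" using card_insert_le_m1[of "Suc (card (G - R))" "G - R" x] by simp
          finally show ?thesis .
        qed
        ultimately show "int (card (G - (R - {x}))) - int (card {y \<in> S \<union> X - (Q1 - {x} \<union> X). init \<omega> y \<noteq> 1}) \<le> b + 1"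
          using prems(8) by simp
        show "y \<in> (\<lambda>u. walk \<omega> u (n u)) ` G" if "y \<in> S \<union> X" "init \<omega> y \<noteq> 1" for y
          using prems(9)[of y] tracks[of x y] that prems(1) by (auto simp: X_def split: if_splits)
      qed
      then obtain h where h: "\<omega> \<in> exploration h (S \<union> X) (Q1 - {x} \<union> X) {x} (b + 1)" by auto
      have "\<omega> \<in> extend_event S x X" using ext True by (simp add: extend_event_def)
      then have "\<omega> \<in> exploration (Suc h) S Q1 {} b" unfolding step using h X by blast
      then show ?thesis using 2 by blast
    qed
  next
    case 3
    \<comment> \<open>With nothing pending, the car filling a known spot has been used: otherwise
      \<open>waiting\<close> places it outside \<open>S\<close>, and on its way to the spot it would
      first enter \<open>S\<close> at a pending site. Hence the known spots are at most as many as
      the used cars.\<close>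
    have "{y \<in> S. init \<omega> y \<noteq> 1} \<subseteq> (\<lambda>u. walk \<omega> u (n u)) ` (G - R)"
    proof
      fix y assume y: "y \<in> {y \<in> S. init \<omega> y \<noteq> 1}"
      then obtain u where u: "u \<in> G" "y = walk \<omega> u (n u)" using prems(9)[of y] by auto
      have "u \<notin> R"
      proof
        assume "u \<in> R"
        then have uS: "u \<notin> S" using prems(6) 3 by auto
        define k where "k = (LEAST k. walk \<omega> u k \<in> S)"
        have "walk \<omega> u (n u) \<in> S" using u y by auto
        then have "walk \<omega> u k \<in> S" "k \<le> n u" "\<And>j. j < k \<Longrightarrow> walk \<omega> u j \<notin> S"
          unfolding k_def by (rule LeastI, rule Least_le) (auto dest: not_less_Least)
        then have "walk \<omega> u k \<in> Q1 \<union> Q2" using uS \<open>u \<in> R\<close> by (intro prems(7)) auto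
        with 3 show False by auto
      qed
      with u show "y \<in> (\<lambda>u. walk \<omega> u (n u)) ` (G - R)" by auto
    qed
    then have "card {y \<in> S. init \<omega> y \<noteq> 1} \<le> card (G - R)"
      using G(1) by (intro surj_card_le) auto
    then have "b \<ge> 0" using prems(8) 3 by simp
    then show ?thesis using 3 by (intro exI[of _ 0]) simp
  qed
qed

section \<open>The parking dynamics\<close>

text \<open>The almost sure properties under which the dynamics can be followed pathwise: by a given
  time only finitely many cars can reach a site, and every contest for a spot has a unique
  winner.\<close>

definition regular :: "'d::finite config \<Rightarrow> bool"
  where "regular \<omega> \<longleftrightarrow> (\<forall>v. init \<omega> v = 1 \<or> init \<omega> v = -1) \<and> (\<forall>v. walk \<omega> v 0 = v) \<and>
    (\<forall>v n i. \<bar>walk \<omega> v (Suc n) $ i - walk \<omega> v n $ i\<bar> \<le> 1) \<and>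
    (\<forall>v w n. v \<noteq> w \<longrightarrow> tie \<omega> v n \<noteq> tie \<omega> w n)"

lemma vec_box_eq: "{x :: 'a ^ 'd::finite. \<forall>i. x $ i \<in> A i} = vec_lambda ` (PiE UNIV A)"
proof (intro equalityI subsetI)
  fix x :: "'a ^ 'd" assume "x \<in> {x. \<forall>i. x $ i \<in> A i}"
  then show "x \<in> vec_lambda ` (PiE UNIV A)"
    by (intro image_eqI[of _ _ "vec_nth x"]) auto
qed auto

lemma finite_vec_box:
  "(\<And>i. finite (A i)) \<Longrightarrow> finite {x :: 'a ^ 'd::finite. \<forall>i. x $ i \<in> A i}"
  unfolding vec_box_eq by (intro finite_imageI finite_PiE) auto

lemma card_vec_box:
  fixes A :: "'d::finite \<Rightarrow> 'a set"
  shows "card {x :: 'a ^ 'd. \<forall>i. x $ i \<in> A i} = (\<Prod>i\<in>UNIV. card (A i))"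
proof -
  have "inj_on vec_lambda (PiE (UNIV :: 'd set) A)"
    by (intro inj_onI) (auto simp: vec_lambda_inject)
  then show ?thesis unfolding vec_box_eq by (simp add: card_image card_PiE)
qed

definition vacant :: "'d::finite config \<Rightarrow> nat \<Rightarrow> 'd site set"
  where "vacant \<omega> t = snd (parking_state \<omega> t)"

definition parks :: "'d::finite config \<Rightarrow> 'd site \<Rightarrow> nat \<Rightarrow> bool"
  where "parks \<omega> w s \<longleftrightarrow> w \<in> parking_cars \<omega> (Suc s) (unparked \<omega> s) (vacant \<omega> s)"

lemma unparked_0: "unparked \<omega> 0 = {v. init \<omega> v = 1}" and vacant_0: "vacant \<omega> 0 = {v. init \<omega> v = -1}"
  by (simp_all add: unparked_def vacant_def)

lemma unparked_Suc: "unparked \<omega> (Suc t) = unparked \<omega> t - {w. parks \<omega> w t}"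
  and vacant_Suc: "vacant \<omega> (Suc t) = vacant \<omega> t - (\<lambda>w. walk \<omega> w (Suc t)) ` {w. parks \<omega> w t}"
  by (simp_all add: unparked_def vacant_def parks_def case_prod_unfold Let_def)

lemma parksD: "parks \<omega> w s \<Longrightarrow> w \<in> unparked \<omega> s \<and> walk \<omega> w (Suc s) \<in> vacant \<omega> s"
  by (simp add: parks_def parking_cars_def)

lemma unparked_antimono: "s \<le> t \<Longrightarrow> unparked \<omega> t \<subseteq> unparked \<omega> s"
  by (induction t) (auto simp: le_Suc_eq unparked_Suc)

lemma vacant_antimono: "s \<le> t \<Longrightarrow> vacant \<omega> t \<subseteq> vacant \<omega> s"
  by (induction t) (auto simp: le_Suc_eq vacant_Suc)

lemma filled_by:
  assumes "y \<in> vacant \<omega> 0" "y \<notin> vacant \<omega> t"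
  shows "\<exists>s<t. \<exists>w. parks \<omega> w s \<and> walk \<omega> w (Suc s) = y"
  using assms(2)
proof (induction t)
  case (Suc t)
  show ?case
  proof (cases "y \<in> vacant \<omega> t")
    case True
    then show ?thesis using Suc.prems by (auto simp: vacant_Suc)
  next
    case False
    then show ?thesis using Suc.IH less_Suc_eq by blast
  qed
qed (use assms(1) in auto)

lemma walk_displacement:
  assumes "regular \<omega>"
  shows "\<bar>walk \<omega> v n $ i - v $ i\<bar> \<le> int n"
proof (induction n)
  case 0
  then show ?case using assms by (simp add: regular_def)
next
  case (Suc n)
  have "\<bar>walk \<omega> v (Suc n) $ i - walk \<omega> v n $ i\<bar> \<le> 1" using assms by (simp add: regular_def)
  then show ?case using Suc by linarith
qed

lemma finite_arrivals:
  assumes "regular \<omega>"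
  shows "finite {w. walk \<omega> w n = y}"
proof (rule finite_subset)
  show "{w. walk \<omega> w n = y} \<subseteq> {x. \<forall>i. x $ i \<in> {y $ i - int n..y $ i + int n}}"
  proof
    fix w assume "w \<in> {w. walk \<omega> w n = y}"
    then have "\<bar>y $ i - w $ i\<bar> \<le> int n" for i using walk_displacement[OF assms, of w n i] by auto
    then have "y $ i - int n \<le> w $ i \<and> w $ i \<le> y $ i + int n" for i by (smt (verit))
    then show "w \<in> {x. \<forall>i. x $ i \<in> {y $ i - int n..y $ i + int n}}" by simp
  qed
  show "finite {x :: 'a site. \<forall>i. x $ i \<in> {y $ i - int n..y $ i + int n}}"
    by (rule finite_vec_box) auto
qed

text \<open>The displacement is bounded, so finitely many cars arrive and a largest tie-breaking
  variable exists; the variables being distinct, its owner parks.\<close>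

lemma some_car_parks:
  assumes reg: "regular \<omega>" and w: "w \<in> unparked \<omega> s" "walk \<omega> w (Suc s) \<in> vacant \<omega> s"
  shows "\<exists>u. parks \<omega> u s \<and> walk \<omega> u (Suc s) = walk \<omega> w (Suc s)"
proof -
  let ?C = "{u \<in> unparked \<omega> s. walk \<omega> u (Suc s) = walk \<omega> w (Suc s)}"
  have fin: "finite ?C" using finite_arrivals[OF reg, of "Suc s" "walk \<omega> w (Suc s)"] by (rule rev_finite_subset) auto
  have "w \<in> ?C" using w by auto
  define m where "m = Max ((\<lambda>u. tie \<omega> u (Suc s)) ` ?C)"
  have "m \<in> (\<lambda>u. tie \<omega> u (Suc s)) ` ?C"
    unfolding m_def using fin \<open>w \<in> ?C\<close> by (intro Max_in) auto
  then obtain u where u: "u \<in> ?C" "tie \<omega> u (Suc s) = m" by auto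
  have "tie \<omega> v (Suc s) < tie \<omega> u (Suc s)" if "v \<in> ?C" "v \<noteq> u" for v
  proof -
    have "tie \<omega> v (Suc s) \<le> m" unfolding m_def using fin that by (intro Max_ge) auto
    moreover have "tie \<omega> v (Suc s) \<noteq> tie \<omega> u (Suc s)" using reg that(2) by (auto simp: regular_def)
    ultimately show ?thesis using u by simp
  qed
  then have "parks \<omega> u s" using u w by (auto simp: parks_def parking_cars_def)
  then show ?thesis using u by auto
qed

text \<open>Had the spot been vacant on arrival, some car would have filled it at that very
  step.\<close>

lemma unparked_not_vacant:
  assumes reg: "regular \<omega>" and w: "w \<in> unparked \<omega> i"
  shows "walk \<omega> w i \<notin> vacant \<omega> i"
proof (cases i)
  case 0
  then show ?thesis using reg w by (auto simp: regular_def unparked_0 vacant_0)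
next
  case (Suc j)
  show ?thesis
  proof
    assume v: "walk \<omega> w i \<in> vacant \<omega> i"
    then have "walk \<omega> w (Suc j) \<in> vacant \<omega> j" "w \<in> unparked \<omega> j"
      using vacant_antimono[of j i \<omega>] unparked_antimono[of j i \<omega>] w Suc by auto
    from some_car_parks[OF reg this(2,1)]
    have "walk \<omega> w (Suc j) \<in> (\<lambda>u. walk \<omega> u (Suc j)) ` {u. parks \<omega> u j}"
      by (metis image_eqI mem_Collect_eq)
    then show False using v Suc by (simp add: vacant_Suc)
  qed
qed

text \<open>The filling car parks at time \<open>Suc s\<close>, possibly equal to \<open>i\<close>
  when the visitor loses the contest. As a statement about the index \<open>s\<close>, the
  inequality is strict, which drives the induction on parking times.\<close>

lemma visited_spot_filled:
  assumes reg: "regular \<omega>" and w: "w \<in> unparked \<omega> j" "i \<le> j" and y: "init \<omega> (walk \<omega> w i) \<noteq> 1"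
  shows "\<exists>s<i. \<exists>u. parks \<omega> u s \<and> walk \<omega> u (Suc s) = walk \<omega> w i"
proof (rule filled_by)
  show "walk \<omega> w i \<in> vacant \<omega> 0" using y reg by (auto simp: vacant_0 regular_def)
  show "walk \<omega> w i \<notin> vacant \<omega> i"
    using unparked_not_vacant[OF reg] unparked_antimono[OF w(2)] w(1) by blast
qed

text \<open>Unspecified for a car that never parks; the sets of cars constructed below contain
  parked cars only.\<close>

definition park_time :: "'d::finite config \<Rightarrow> 'd site \<Rightarrow> nat"
  where "park_time \<omega> w = (LEAST s. w \<notin> unparked \<omega> s)"

abbreviation park_site :: "'d::finite config \<Rightarrow> 'd site \<Rightarrow> 'd site"
  where "park_site \<omega> \<equiv> \<lambda>w. walk \<omega> w (park_time \<omega> w)"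

lemma park_time_eq:
  assumes "parks \<omega> w s"
  shows "park_time \<omega> w = Suc s"
  unfolding park_time_def
proof (rule Least_equality)
  show "w \<notin> unparked \<omega> (Suc s)" using assms by (simp add: unparked_Suc)
  show "Suc s \<le> t" if "w \<notin> unparked \<omega> t" for t
    using that parksD[OF assms] unparked_antimono[of t s \<omega>] by (cases "t \<le> s") auto
qed

text \<open>Only the set of sites parked on is recorded, not which car filled which spot when. The
  condition is thus stable under finite unions, as the recursive construction requires.\<close>

definition self_filling :: "'d::finite config \<Rightarrow> 'd site set \<Rightarrow> bool"
  where "self_filling \<omega> G \<longleftrightarrow> finite G \<and>
    (\<forall>w\<in>G. init \<omega> w = 1 \<and> (\<forall>i\<le>park_time \<omega> w. init \<omega> (walk \<omega> w i) \<noteq> 1 \<longrightarrow>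
      walk \<omega> w i \<in> park_site \<omega> ` G))"

lemma self_filling_Union:
  assumes "finite \<G>" "\<And>G. G \<in> \<G> \<Longrightarrow> self_filling \<omega> G"
  shows "self_filling \<omega> (\<Union>\<G>)"
  using assms unfolding self_filling_def by (fastforce)

text \<open>Strong induction on the parking step: the spots met before were filled at smaller steps.
  Disjointness from the cars still unparked is carried along so that a later car can be kept out of
  \<open>G\<close>.\<close>

lemma self_filling_car:
  assumes reg: "regular \<omega>"
  shows "parks \<omega> w s \<Longrightarrow> \<exists>G. self_filling \<omega> G \<and> w \<in> G \<and> G \<inter> unparked \<omega> (Suc s) = {}"
proof (induction s arbitrary: w rule: less_induct)
  case (less s)
  have wu: "w \<in> unparked \<omega> s" using parksD[OF less.prems] by auto
  have pt: "park_time \<omega> w = Suc s" using less.prems by (rule park_time_eq)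
  have carw: "init \<omega> w = 1" using wu unparked_antimono[of 0 s \<omega>] by (auto simp: unparked_0)
  have "\<exists>G. self_filling \<omega> G \<and> G \<inter> unparked \<omega> (Suc s) = {} \<and> (init \<omega> (walk \<omega> w i) \<noteq> 1 \<longrightarrow>
      walk \<omega> w i \<in> park_site \<omega> ` G)" if i: "i \<le> s" for i
  proof (cases "init \<omega> (walk \<omega> w i) = 1")
    case True
    then show ?thesis by (intro exI[of _ "{}"]) (auto simp: self_filling_def)
  next
    case False
    then obtain r u where r: "r < i" "parks \<omega> u r" "walk \<omega> u (Suc r) = walk \<omega> w i"
      using visited_spot_filled[OF reg wu i] by auto
    then obtain G where G: "self_filling \<omega> G" "u \<in> G" "G \<inter> unparked \<omega> (Suc r) = {}"
      using less.IH[of r u] \<open>i \<le> s\<close> by auto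
    have "unparked \<omega> (Suc s) \<subseteq> unparked \<omega> (Suc r)" using r(1) i by (intro unparked_antimono) auto
    moreover have "walk \<omega> w i = walk \<omega> u (park_time \<omega> u)" using r by (simp add: park_time_eq)
    ultimately show ?thesis using G by (intro exI[of _ G]) auto
  qed
  then obtain H where H: "\<And>i. i \<le> s \<Longrightarrow> self_filling \<omega> (H i) \<and> H i \<inter> unparked \<omega> (Suc s) = {} \<and> (init \<omega> (walk \<omega> w i) \<noteq> 1 \<longrightarrow>
      walk \<omega> w i \<in> park_site \<omega> ` H i)"
    by metis
  define G where "G = insert w (\<Union>(H ` {..s}))"
  have sf: "self_filling \<omega> (\<Union>(H ` {..s}))" using H by (intro self_filling_Union) auto
  have "walk \<omega> w i \<in> park_site \<omega> ` G"
    if "i \<le> Suc s" "init \<omega> (walk \<omega> w i) \<noteq> 1" for i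
  proof (cases "i = Suc s")
    case True
    then show ?thesis using pt by (auto simp: G_def)
  next
    case False
    then have "i \<le> s" using that by auto
    then show ?thesis using H[of i] that by (auto simp: G_def)
  qed
  then have "self_filling \<omega> G"
    using sf carw pt unfolding self_filling_def G_def by auto
  moreover have "w \<notin> unparked \<omega> (Suc s)" using less.prems by (simp add: unparked_Suc)
  ultimately show ?case using H by (intro exI[of _ G]) (auto simp: G_def)
qed

text \<open>The car at \<open>v\<close> is not in \<open>G\<close>, because it is still driving when
  the cars of \<open>G\<close> have parked. Its own coordinate therefore stays available for its
  range.\<close>

lemma self_filling_range:
  assumes reg: "regular \<omega>" and v: "v \<in> unparked \<omega> t"
  obtains G where "self_filling \<omega> G" "v \<notin> G"
    "\<And>i. i \<le> t \<Longrightarrow> init \<omega> (walk \<omega> v i) \<noteq> 1 \<Longrightarrow> walk \<omega> v i \<in> park_site \<omega> ` G"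
proof -
  have "\<exists>G. self_filling \<omega> G \<and> v \<notin> G \<and> (init \<omega> (walk \<omega> v i) \<noteq> 1 \<longrightarrow>
      walk \<omega> v i \<in> park_site \<omega> ` G)" if i: "i \<le> t" for i
  proof (cases "init \<omega> (walk \<omega> v i) = 1")
    case True
    then show ?thesis by (intro exI[of _ "{}"]) (auto simp: self_filling_def)
  next
    case False
    then obtain r u where r: "r < i" "parks \<omega> u r" "walk \<omega> u (Suc r) = walk \<omega> v i"
      using visited_spot_filled[OF reg v i] by auto
    then obtain G where G: "self_filling \<omega> G" "u \<in> G" "G \<inter> unparked \<omega> (Suc r) = {}"
      using self_filling_car[OF reg] by blast
    have "v \<in> unparked \<omega> (Suc r)" using r(1) i v unparked_antimono[of "Suc r" t \<omega>] by auto
    moreover have "walk \<omega> v i = walk \<omega> u (park_time \<omega> u)" using r by (simp add: park_time_eq)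
    ultimately show ?thesis using G by (intro exI[of _ G]) auto
  qed
  then obtain H where H: "\<And>i. i \<le> t \<Longrightarrow> self_filling \<omega> (H i) \<and> v \<notin> H i \<and> (init \<omega> (walk \<omega> v i) \<noteq> 1 \<longrightarrow>
      walk \<omega> v i \<in> park_site \<omega> ` H i)"
    by metis
  have "self_filling \<omega> (\<Union>(H ` {..t}))" using H by (intro self_filling_Union) auto
  moreover have "walk \<omega> v i \<in> park_site \<omega> ` \<Union>(H ` {..t})"
    if "i \<le> t" "init \<omega> (walk \<omega> v i) \<noteq> 1" for i
  proof -
    have "walk \<omega> v i \<in> park_site \<omega> ` H i" using H[of i] that by auto
    then show ?thesis using that by blast
  qed
  ultimately show thesis using H by (intro that[of "\<Union>(H ` {..t})"]) auto
qed

lemma unparked_exploration: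
  assumes reg: "regular \<omega>" and v: "v \<in> unparked \<omega> t"
  defines "R \<equiv> walk \<omega> v ` {..t}"
  shows "\<exists>h. \<omega> \<in> exploration h R (R - {v}) {v} 0"
proof -
  obtain G where G: "self_filling \<omega> G" "v \<notin> G"
    "\<And>i. i \<le> t \<Longrightarrow> init \<omega> (walk \<omega> v i) \<noteq> 1 \<Longrightarrow> walk \<omega> v i \<in> park_site \<omega> ` G"
    using self_filling_range[OF reg v] by blast
  have vR: "v \<in> R" using reg by (auto simp: R_def regular_def intro!: image_eqI[of _ _ 0])
  have carv: "init \<omega> v = 1" using v unparked_antimono[of 0 t \<omega>] by (auto simp: unparked_0)
  show ?thesis
  proof (rule exploration_complete[where n = "park_time \<omega>" and G = G and R = G and U = "R \<union> (\<Union>w\<in>G. walk \<omega> w ` {..park_time \<omega> w})"])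
    show "walk \<omega> v 0 = v" for v using reg by (simp add: regular_def)
    have "{y \<in> R - (R - {v}). init \<omega> y \<noteq> 1} = {}" using carv by auto
    then show "int (card (G - G)) - int (card {y \<in> R - (R - {v}). init \<omega> y \<noteq> 1}) \<le> 0" by (simp only: Diff_cancel)
  qed (use G vR in \<open>auto simp: self_filling_def R_def\<close>)
qed

section \<open>Almost sure regularity and measurability of the dynamics\<close>

lemma AE_walk_law:
  assumes "{g. Q g} \<in> sets paths" "\<And>\<xi>. (\<And>k. \<xi> k \<in> unit_steps) \<Longrightarrow> Q (\<lambda>n. v + (\<Sum>k<n. \<xi> k))"
  shows "AE g in walk_law v. Q g"
proof -
  interpret P: product_prob_space "\<lambda>_. measure_pmf (pmf_of_set (unit_steps :: 'a site set))" "UNIV :: nat set"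
    by unfold_locales
  have "AE \<xi> in steps_law. \<xi> k \<in> (unit_steps :: 'a site set)" for k
  proof -
    have "AE x in measure_pmf (pmf_of_set (unit_steps :: 'a site set)). x \<in> unit_steps"
      by (simp add: AE_measure_pmf_iff)
    then show ?thesis using P.AE_component[of k "\<lambda>x. x \<in> unit_steps"] by simp
  qed
  then have "AE \<xi> in steps_law. \<forall>k. \<xi> k \<in> (unit_steps :: 'a site set)"
    by (simp add: AE_all_countable)
  then have "AE \<xi> in steps_law. Q (\<lambda>n. v + (\<Sum>k<n. \<xi> k))"
    by eventually_elim (use assms(2) in auto)
  moreover have "{g \<in> space paths. Q g} \<in> sets paths" using assms(1) by simp
  ultimately show ?thesis unfolding walk_law_def
    by (subst AE_distr_iff) auto
qed

lemma AE_regular: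
  assumes p: "0 \<le> p" "p \<le> 1"
  shows "AE \<omega> in parking_measure p. regular (\<omega> :: 'd::finite config)"
proof -
  let ?P = "parking_measure p :: 'd config measure"
  interpret prob_space ?P by (rule prob_space_parking_measure)
  have init: "AE \<omega> in ?P. init \<omega> v = 1 \<or> init \<omega> v = -1" for v
  proof -
    have "emeasure ?P ({\<omega>. init \<omega> v \<in> {x. x \<noteq> 1 \<and> x \<noteq> -1}} \<inter> UNIV) = 0"
      using emeasure_init_site(1)[where F=UNIV and v=v and A="{x. x \<noteq> 1 \<and> x \<noteq> -1}" and p=p] sets.top[of ?P] p
      by (simp add: emeasure_init_law)
    moreover have "{\<omega>. init \<omega> v \<in> {x. x \<noteq> 1 \<and> x \<noteq> -1}} \<inter> UNIV \<in> sets ?P"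
      using emeasure_init_site(2)[where F=UNIV and v=v and A="{x. x \<noteq> 1 \<and> x \<noteq> -1}" and p=p] sets.top[of ?P] by simp
    ultimately show ?thesis by (intro AE_I[where N="{\<omega>. init \<omega> v \<in> {x. x \<noteq> 1 \<and> x \<noteq> -1}} \<inter> UNIV"]) auto
  qed
  have walks: "AE \<omega> in ?P. Q v (walk \<omega> v)"
    if Q: "{g. Q v g} \<in> sets paths" "\<And>\<xi>. (\<And>k. \<xi> k \<in> unit_steps) \<Longrightarrow> Q v (\<lambda>n. v + (\<Sum>k<n. \<xi> k))" for Q v
  proof -
    have B: "{g. \<not> Q v g} \<in> sets paths"
      using sets.compl_sets[OF Q(1)] by (simp add: Collect_neg_eq Compl_eq_Diff_UNIV)
    have "AE g in walk_law v. Q v g" using Q by (rule AE_walk_law)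
    then have "emeasure (walk_law v) {g. \<not> Q v g} = 0" using B by (simp add: AE_iff_measurable)
    then show ?thesis
      using emeasure_site_rect[OF B, where F=UNIV and A=UNIV and p=p and v=v] sets.top[of ?P]
      by (intro AE_I[where N="{\<omega>. \<not> Q v (walk \<omega> v)}"]) auto
  qed
  have start: "AE \<omega> in ?P. walk \<omega> v 0 = v" for v
    by (rule walks[of "\<lambda>v g. g 0 = v"])
       (use sets_paths_prefix[of "\<lambda>l. l ! 0 = v" 1] in auto)
  have unit: "\<bar>e $ i\<bar> \<le> 1" if "e \<in> unit_steps" for e :: "'d site" and i
    using that by (auto simp: unit_steps_def axis_def)
  have step: "AE \<omega> in ?P. \<bar>walk \<omega> v (Suc n) $ i - walk \<omega> v n $ i\<bar> \<le> 1" for v n i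
  proof (rule walks[of "\<lambda>v g. \<bar>g (Suc n) $ i - g n $ i\<bar> \<le> 1"])
    show "{g. \<bar>g (Suc n) $ i - g n $ i\<bar> \<le> 1} \<in> sets (paths :: 'd path measure)"
    proof -
      have "{g. \<bar>g (Suc n) $ i - g n $ i\<bar> \<le> 1} = {g :: nat \<Rightarrow> 'd site. (\<lambda>l. \<bar>l ! (Suc n) $ i - l ! n $ i\<bar> \<le> 1) (map g [0..<Suc (Suc n)])}"
        by (simp del: upt_Suc)
      then show ?thesis using sets_paths_prefix[of "\<lambda>l. \<bar>l ! (Suc n) $ i - l ! n $ i\<bar> \<le> 1" "Suc (Suc n)"] by simp
    qed
  qed (auto simp: unit)
  have ties: "AE \<omega> in ?P. tie \<omega> v n \<noteq> tie \<omega> w n" if "v \<noteq> w" for v w n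
  proof -
    interpret T: product_prob_space "\<lambda>_. uniform_measure lborel {0..1::real}" "UNIV :: nat set"
      by (intro product_prob_spaceI prob_space_uniform_unit)
    have E: "{\<omega>. tie \<omega> v n = tie \<omega> w n} \<in> sets ?P"
    proof -
      have "{\<omega> \<in> space ?P. tie \<omega> v n = tie \<omega> w n} \<in> sets ?P" by measurable
      then show ?thesis by simp
    qed
    have null: "emeasure (site_law p v) {x. snd (snd x) n = c} = 0" for c
    proof -
      have mc: "{h. h n = c} \<in> sets tie_law"
      proof -
        have "{h \<in> space (PiM UNIV (\<lambda>_. borel)). h n = c} \<in> sets (PiM UNIV (\<lambda>_::nat. borel :: real measure))" by measurable
        then show ?thesis by (simp add: space_PiM)
      qed
      have "emeasure tie_law {h. h n = c} = emeasure (uniform_measure lborel {0..1::real}) {c}"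
        using T.emeasure_PiM_Collect_single[of n "{c}"] by (simp add: tie_law_def space_PiM)
      also have "\<dots> = 0"
      proof -
        have "emeasure lborel ({0..1} \<inter> {c}) = 0" by (rule emeasure_lborel_countable) auto
        then show ?thesis by simp
      qed
      finally have z: "emeasure tie_law {h. h n = c} = 0" .
      interpret TT: prob_space tie_law by (rule prob_space_tie_law)
      interpret W: prob_space "walk_law v" by (rule prob_space_walk_law)
      interpret WT: pair_prob_space "walk_law v" tie_law ..
      have "{x. snd (snd x) n = c} = UNIV \<times> (UNIV \<times> {h. h n = c})" by auto
      then show ?thesis
        unfolding site_law_def using mc sets.top[of "walk_law v"] z
        by (subst \<open>{x. snd (snd x) n = c} = _\<close>, subst WT.emeasure_pair_measure_Times, simp, force, subst TT.emeasure_pair_measure_Times) auto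
    qed
    \<comment> \<open>Redrawing the site \<open>v\<close> leaves the variable of \<open>w\<close>
      fixed, and a continuous law gives no mass to a single value.\<close>
    have "emeasure ?P {\<omega>. tie \<omega> v n = tie \<omega> w n} = (\<integral>\<^sup>+\<omega>. emeasure (site_law p v) {x. snd (snd x) n = tie \<omega> w n} \<partial>?P)"
      by (subst emeasure_resample[OF E, of v]) (use that in \<open>simp add: tie_def\<close>)
    also have "\<dots> = 0" by (simp add: null)
    finally show ?thesis using E by (intro AE_I[where N="{\<omega>. tie \<omega> v n = tie \<omega> w n}"]) auto
  qed
  have "AE \<omega> in ?P. (\<forall>v. init \<omega> v = 1 \<or> init \<omega> v = -1) \<and> (\<forall>v. walk \<omega> v 0 = v) \<and>
    (\<forall>v n i. \<bar>walk \<omega> v (Suc n) $ i - walk \<omega> v n $ i\<bar> \<le> 1) \<and>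
    (\<forall>v w n. v \<noteq> w \<longrightarrow> tie \<omega> v n \<noteq> tie \<omega> w n)"
    by (intro AE_conjI AE_all_countable[THEN iffD2] allI init start step)
       (use ties in \<open>auto simp: AE_all_countable\<close>)
  then show ?thesis by (simp add: regular_def)
qed

text \<open>Sites are countable, so the parking rule is a countable combination of measurable
  events. Unparked cars and vacant spots determine each other's next state, hence the joint
  induction.\<close>

lemma unparked_measurable:
  "{\<omega>. v \<in> unparked \<omega> t} \<in> sets (parking_measure p :: 'd::finite config measure) \<and>
   {\<omega>. v \<in> vacant \<omega> t} \<in> sets (parking_measure p :: 'd config measure)"
proof (induction t arbitrary: v)
  case 0
  have "{\<omega> \<in> space (parking_measure p :: 'd config measure). init \<omega> v = 1} \<in> sets (parking_measure p)"
    "{\<omega> \<in> space (parking_measure p :: 'd config measure). init \<omega> v = -1} \<in> sets (parking_measure p)"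
    by measurable
  then show ?case by (simp add: unparked_0 vacant_0)
next
  case (Suc t)
  let ?P = "parking_measure p :: 'd config measure"
  have [measurable]: "Measurable.pred ?P (\<lambda>\<omega>. v \<in> unparked \<omega> t)" "Measurable.pred ?P (\<lambda>\<omega>. v \<in> vacant \<omega> t)" for v
    using Suc.IH by (simp_all add: pred_def)
  \<comment> \<open>Vacancy at a random site is rewritten as a countable disjunction over fixed
    sites \<open>y\<close>.\<close>
  have parks_eq: "parks \<omega> w t \<longleftrightarrow> w \<in> unparked \<omega> t \<and> (\<exists>y. walk \<omega> w (Suc t) = y \<and> y \<in> vacant \<omega> t) \<and>
      (\<forall>u. u \<in> unparked \<omega> t \<longrightarrow> u \<noteq> w \<longrightarrow> walk \<omega> u (Suc t) = walk \<omega> w (Suc t) \<longrightarrow> tie \<omega> u (Suc t) < tie \<omega> w (Suc t))" for \<omega> :: "'d config" and w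
    by (auto simp: parks_def parking_cars_def)
  have [measurable]: "Measurable.pred ?P (\<lambda>\<omega>. parks \<omega> w t)" for w
    unfolding parks_eq by measurable
  have "Measurable.pred ?P (\<lambda>\<omega>. v \<in> unparked \<omega> t \<and> \<not> parks \<omega> v t)"
    "Measurable.pred ?P (\<lambda>\<omega>. v \<in> vacant \<omega> t \<and> \<not> (\<exists>w. parks \<omega> w t \<and> walk \<omega> w (Suc t) = v))"
    by measurable
  moreover have "v \<in> unparked \<omega> (Suc t) \<longleftrightarrow> v \<in> unparked \<omega> t \<and> \<not> parks \<omega> v t"
    "v \<in> vacant \<omega> (Suc t) \<longleftrightarrow> v \<in> vacant \<omega> t \<and> \<not> (\<exists>w. parks \<omega> w t \<and> walk \<omega> w (Suc t) = v)" for \<omega> :: "'d config"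
    by (auto simp: unparked_Suc vacant_Suc)
  ultimately show ?case by (simp add: pred_def)
qed

lemma parking_time_gt: "parking_time \<omega> v > enat t \<longleftrightarrow> v \<in> unparked \<omega> t"
proof -
  let ?f = "\<lambda>s. if v \<in> unparked \<omega> s then 1 else 0 :: enat"
  show ?thesis
  proof
    assume "v \<in> unparked \<omega> t"
    then have "v \<in> unparked \<omega> s" if "s \<le> t" for s using unparked_antimono[OF that] by blast
    then have "(\<Sum>s<Suc t. ?f s) = (\<Sum>s<Suc t. 1 :: enat)" by (intro sum.cong) auto
    also have "\<dots> = enat (Suc t)" by (simp flip: of_nat_eq_enat)
    finally have eq: "(\<Sum>s<Suc t. ?f s) = enat (Suc t)" .
    have "(\<Sum>s<Suc t. ?f s) \<le> (\<Sum>s. ?f s)" by (rule sum_le_suminf) auto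
    then have "enat (Suc t) \<le> parking_time \<omega> v" unfolding eq parking_time_def .
    then show "enat t < parking_time \<omega> v" by (meson enat_ord_simps(2) lessI less_le_trans)
  next
    assume gt: "enat t < parking_time \<omega> v"
    show "v \<in> unparked \<omega> t"
    proof (rule ccontr)
      assume "v \<notin> unparked \<omega> t"
      then have "v \<notin> unparked \<omega> s" if "t \<le> s" for s using unparked_antimono[OF that] by blast
      then have "(\<Sum>s. ?f s) = (\<Sum>s<t. ?f s)" by (intro suminf_finite) auto
      also have "\<dots> \<le> (\<Sum>s<t. 1)" by (intro sum_mono) auto
      also have "\<dots> = enat t" by (simp flip: of_nat_eq_enat)
      finally show False using gt by (simp add: parking_time_def)
    qed
  qed
qed

section \<open>Heat kernel decay\<close>

text \<open>The \<open>n\<close>-step transition probability of the simple walk on the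
  integers.\<close>

primrec line_kernel :: "nat \<Rightarrow> int \<Rightarrow> real"
  where
    "line_kernel 0 x = (if x = 0 then 1 else 0)"
  | "line_kernel (Suc n) x = (line_kernel n (x - 1) + line_kernel n (x + 1)) / 2"

lemma line_kernel_left: "x < - int n \<Longrightarrow> line_kernel n x = 0"
  by (induction n arbitrary: x) auto

lemma line_kernel_parity: "odd (x + int n) \<Longrightarrow> line_kernel n x = 0"
  by (induction n arbitrary: x) auto

lemma line_kernel_binomial: "line_kernel n (2 * int k - int n) = real (n choose k) / 2 ^ n"
proof (induction n arbitrary: k)
  case (Suc n)
  show ?case
  proof (cases k)
    case 0
    have "line_kernel n (- int n) = 1 / 2 ^ n" using Suc.IH[of 0] by simp
    then show ?thesis using 0 by (simp add: line_kernel_left)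
  next
    case (Suc j)
    have "line_kernel n (2 * int j - int n) = real (n choose j) / 2 ^ n"
      "line_kernel n (2 * int k - int n) = real (n choose k) / 2 ^ n"
      using Suc.IH by auto
    moreover have "2 * int k - int (Suc n) - 1 = 2 * int j - int n" "2 * int k - int (Suc n) + 1 = 2 * int k - int n"
      using Suc by auto
    ultimately show ?thesis using Suc by (simp only: line_kernel.simps) (simp add: field_simps)
  qed
qed auto

text \<open>The factor \<open>3 * k + 1\<close> makes the induction close: in the step,
  \<open>16 * (k + 1)\<^sup>2 * (3 * k + 1)\<close> exceeds
  \<open>4 * (2 * k + 1)\<^sup>2 * (3 * k + 4)\<close> by exactly \<open>4 * k\<close>.\<close>

lemma central_binomial_bound: "(2 * k choose k)\<^sup>2 * (3 * k + 1) \<le> 16 ^ k"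
proof (induction k)
  case (Suc k)
  let ?c = "2 * k choose k" and ?c' = "2 * Suc k choose Suc k"
  have rec: "Suc k * ?c' = 2 * (2 * k + 1) * ?c"
  proof -
    have "Suc (2 * k) choose Suc k = Suc (2 * k) choose k"
      using binomial_symmetric[of "Suc k" "Suc (2 * k)"] by simp
    then have "?c' = 2 * (Suc (2 * k) choose Suc k)" by simp
    then have "Suc k * ?c' = 2 * (Suc k * (Suc (2 * k) choose Suc k))" by (simp only: mult_ac)
    also have "\<dots> = 2 * (Suc (2 * k) * ?c)" by (simp only: Suc_times_binomial)
    finally show ?thesis by (simp only: mult_ac Suc_eq_plus1)
  qed
  have "(Suc k)\<^sup>2 * (?c'\<^sup>2 * (3 * Suc k + 1)) = (2 * (2 * k + 1) * ?c)\<^sup>2 * (3 * k + 4)"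
    unfolding rec[symmetric] by (simp add: power2_eq_square algebra_simps)
  also have "\<dots> = ?c\<^sup>2 * (4 * (2 * k + 1)\<^sup>2 * (3 * k + 4))"
    by (simp add: power2_eq_square algebra_simps)
  also have "\<dots> \<le> ?c\<^sup>2 * (16 * (Suc k)\<^sup>2 * (3 * k + 1))"
    by (intro mult_left_mono) (auto simp: power2_eq_square algebra_simps)
  also have "\<dots> = 16 * (Suc k)\<^sup>2 * (?c\<^sup>2 * (3 * k + 1))" by (simp only: mult_ac)
  also have "\<dots> \<le> 16 * (Suc k)\<^sup>2 * 16 ^ k" using Suc by (intro mult_left_mono) auto
  also have "\<dots> = (Suc k)\<^sup>2 * 16 ^ Suc k" by simp
  finally show ?case by (simp del: binomial_Suc_Suc power_Suc)
qed simp

lemma middle_binomial_bound: "real (n choose (n div 2)) / 2 ^ n \<le> 1 / sqrt (real n + 1)"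
proof -
  have even: "real (2 * k choose k) / 4 ^ k \<le> 1 / sqrt (3 * real k + 1)" for k
  proof -
    have "real ((2 * k choose k)\<^sup>2 * (3 * k + 1)) \<le> real (16 ^ k)"
      using central_binomial_bound[of k] by (simp only: of_nat_le_iff)
    moreover have "(4 ^ k)\<^sup>2 = (16 :: real) ^ k" by (simp add: power2_eq_square flip: power_mult_distrib)
    ultimately have "(real (2 * k choose k))\<^sup>2 * (3 * real k + 1) \<le> (4 ^ k)\<^sup>2"
      by (simp add: distrib_left)
    then have "(real (2 * k choose k) * sqrt (3 * real k + 1))\<^sup>2 \<le> (4 ^ k)\<^sup>2"
      by (simp add: power_mult_distrib)
    then have "real (2 * k choose k) * sqrt (3 * real k + 1) \<le> 4 ^ k"
      by (rule power2_le_imp_le) simp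
    then show ?thesis by (simp add: field_simps)
  qed
  show ?thesis
  proof (cases "even n")
    case True
    then obtain k where k: "n = 2 * k" by auto
    have "1 / sqrt (3 * real k + 1) \<le> 1 / sqrt (2 * real k + 1)"
      by (intro divide_left_mono) auto
    then show ?thesis using even[of k] k by (simp add: power_mult)
  next
    case False
    then obtain k where k: "n = 2 * k + 1" by (auto elim: oddE)
    have "Suc (2 * k) choose Suc k = Suc (2 * k) choose k"
      using binomial_symmetric[of "Suc k" "Suc (2 * k)"] by simp
    then have "2 * Suc k choose Suc k = 2 * (n choose k)" using k by simp
    then have "real (n choose k) / 2 ^ n = real (2 * Suc k choose Suc k) / 4 ^ Suc k"
      using k by (simp add: power_mult)
    also have "\<dots> \<le> 1 / sqrt (3 * real (Suc k) + 1)" by (rule even)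
    also have "\<dots> \<le> 1 / sqrt (real n + 1)"
      using k by (intro divide_left_mono) auto
    finally show ?thesis using k by simp
  qed
qed

lemma line_kernel_nonneg: "0 \<le> line_kernel n x"
  by (induction n arbitrary: x) auto

lemma line_kernel_le: "line_kernel n x \<le> 1 / sqrt (real n + 1)"
proof (cases "even (x + int n) \<and> x \<ge> - int n")
  case True
  define k where "k = nat ((x + int n) div 2)"
  have "x = 2 * int k - int n" using True by (auto simp: k_def)
  then have "line_kernel n x = real (n choose k) / 2 ^ n" by (simp only: line_kernel_binomial)
  also have "\<dots> \<le> real (n choose (n div 2)) / 2 ^ n"
    by (intro divide_right_mono) (auto simp: binomial_maximum)
  also have "\<dots> \<le> 1 / sqrt (real n + 1)" by (rule middle_binomial_bound)
  finally show ?thesis .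
next
  case False
  then have "line_kernel n x = 0" using line_kernel_left line_kernel_parity by auto
  then show ?thesis by simp
qed

lemma step_mean_sum: "step_mean (\<lambda>e. \<Sum>i\<in>I. f i e) = (\<Sum>i\<in>I. step_mean (f i))"
  by (induction I rule: infinite_finite_induct) (auto simp: step_mean_add)

lemma chain_op_pow_sum: "(chain_op \<delta> ^^ n) (\<lambda>s. \<Sum>i\<in>I. f i s) = (\<lambda>s. \<Sum>i\<in>I. (chain_op \<delta> ^^ n) (f i) s)"
  by (induction n) (auto simp: chain_op_def fun_eq_iff step_mean_sum)

lemma chain_op_pow_cmult: "(chain_op \<delta> ^^ n) (\<lambda>s. c * f s) = (\<lambda>s. c * (chain_op \<delta> ^^ n) f s)"
  by (induction n) (auto simp: chain_op_def fun_eq_iff step_mean_cmult)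

lemma chain_op_pow_add: "(chain_op \<delta> ^^ n) (\<lambda>s. f s + g s) = (\<lambda>s. (chain_op \<delta> ^^ n) f s + (chain_op \<delta> ^^ n) g s)"
  by (induction n) (auto simp: chain_op_def fun_eq_iff step_mean_add)

lemma chain_op_pow_const: "(chain_op \<delta> ^^ n) (\<lambda>s. c) = (\<lambda>s. c)"
  by (induction n) (auto simp: chain_op_def fun_eq_iff)

lemma chain_op_pow_mono:
  assumes "\<And>s e. P s \<Longrightarrow> P (\<delta> s e)" "\<And>s. P s \<Longrightarrow> f s \<le> g s" "P s"
  shows "(chain_op \<delta> ^^ n) f s \<le> (chain_op \<delta> ^^ n) g s"
  using assms(3)
  by (induction n arbitrary: s) (auto simp: chain_op_def intro!: step_mean_mono assms(1,2))

text \<open>The transition probability when coordinate \<open>i\<close> has made exactly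
  \<open>N i\<close> moves.\<close>

definition box_kernel :: "('d \<Rightarrow> nat) \<Rightarrow> 'd::finite site \<Rightarrow> 'd site \<Rightarrow> real"
  where "box_kernel N y x = (\<Prod>i\<in>UNIV. line_kernel (N i) (x $ i - y $ i))"

text \<open>A step of the walk chooses a uniform coordinate and makes one move there, so it advances
  one of the clocks \<open>N i\<close>. The walk in dimension \<open>d\<close> becomes a recursion
  on these clocks.\<close>

lemma chain_op_box_kernel:
  fixes N :: "'d::finite \<Rightarrow> nat"
  shows "chain_op (+) (box_kernel N y) = (\<lambda>x. \<Sum>i\<in>UNIV. 1 / real CARD('d) * box_kernel (N(i := Suc (N i))) y x)"
proof
  fix x :: "'d site"
  have "box_kernel N y (x + axis i 1) + box_kernel N y (x + axis i (-1)) = 2 * box_kernel (N(i := Suc (N i))) y x" for i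
  proof -
    let ?r = "\<Prod>j\<in>UNIV - {i}. line_kernel (N j) (x $ j - y $ j)"
    have 1: "box_kernel N y (x + axis i s) = line_kernel (N i) (x $ i + s - y $ i) * ?r" for s
      unfolding box_kernel_def
      by (subst prod.remove[of UNIV i]) (auto simp: axis_def intro!: prod.cong arg_cong2[where f="(*)"])
    have 2: "box_kernel (N(i := Suc (N i))) y x = line_kernel (Suc (N i)) (x $ i - y $ i) * ?r"
      unfolding box_kernel_def
      by (subst prod.remove[of UNIV i]) (auto intro!: prod.cong arg_cong2[where f="(*)"])
    have e: "x $ i + 1 - y $ i = x $ i - y $ i + 1" "x $ i + -1 - y $ i = x $ i - y $ i - 1" by auto
    show ?thesis unfolding 1 2 e by (simp add: algebra_simps)
  qed
  then show "chain_op (+) (box_kernel N y) x = (\<Sum>i\<in>UNIV. 1 / real CARD('d) * box_kernel (N(i := Suc (N i))) y x)"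
    unfolding chain_op_def step_mean_def by (simp add: sum_distrib_left[symmetric] sum_divide_distrib)
qed

text \<open>Advancing clock \<open>i\<close> multiplies the weight by
  \<open>sqrt ((N i + 1) / (N i + 2))\<close>, at most \<open>1 - 1 / (2 * (N i + 2))\<close>. The
  mean of \<open>1 / (N i + 2)\<close> is then bounded below by convexity, \<open>M\<close> being
  the sum of the \<open>N i + 2\<close>.\<close>

lemma box_weight_mean:
  fixes N :: "'d::finite \<Rightarrow> nat"
  defines "V \<equiv> \<lambda>N :: 'd \<Rightarrow> nat. \<Prod>i\<in>UNIV. 1 / sqrt (real (N i) + 1)"
    and "M \<equiv> (\<Sum>i\<in>UNIV. real (N i)) + 2 * real CARD('d)"
  shows "(\<Sum>i\<in>UNIV. 1 / real CARD('d) * V (N(i := Suc (N i)))) \<le> V N * (1 - real CARD('d) / 2 / M)"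
proof -
  let ?d = "real CARD('d)"
  have d: "?d > 0" by simp
  have M: "M > 0" unfolding M_def using d by (intro add_nonneg_pos sum_nonneg) auto
  have V0: "V N \<ge> 0" unfolding V_def by (intro prod_nonneg) auto
  have V1: "V (N(i := Suc (N i))) \<le> V N * (1 - 1 / 2 * (1 / (real (N i) + 2)))" for i
  proof -
    let ?r = "\<Prod>j\<in>UNIV - {i}. 1 / sqrt (real (N j) + 1)"
    have r: "?r \<ge> 0" by (intro prod_nonneg) auto
    have 1: "V N = 1 / sqrt (real (N i) + 1) * ?r"
      unfolding V_def by (subst prod.remove[of UNIV i]) auto
    have 2: "V (N(i := Suc (N i))) = 1 / sqrt (real (N i) + 2) * ?r"
      unfolding V_def by (subst prod.remove[of UNIV i]) (auto intro!: prod.cong arg_cong2[where f="(*)"] simp: add_ac)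
    have "1 / sqrt (real (N i) + 2) \<le> 1 / sqrt (real (N i) + 1) * (1 - 1 / 2 * (1 / (real (N i) + 2)))"
    proof -
      define a where "a = real (N i) + 2"
      have a: "a \<ge> 2" by (simp add: a_def)
      have "(a - 1) / a \<le> (1 - 1 / (2 * a))\<^sup>2"
        using a by (simp add: power2_eq_square field_simps)
      then have "sqrt ((a - 1) / a) \<le> 1 - 1 / (2 * a)"
        using a by (intro real_le_lsqrt) (auto simp: field_simps)
      then have "sqrt (a - 1) / sqrt a \<le> 1 - 1 / (2 * a)" by (simp add: real_sqrt_divide)
      then have "1 / sqrt a \<le> 1 / sqrt (a - 1) * (1 - 1 / (2 * a))"
        using a by (simp add: field_simps)
      then show ?thesis by (simp add: a_def add.commute)
    qed
    from mult_right_mono[OF this r] show ?thesis unfolding 1 2 by (simp add: mult_ac)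
  qed
  \<comment> \<open>The tangent to \<open>1 / a\<close> at the average \<open>M / d\<close>; summed
    over the coordinates it is the inequality between arithmetic and harmonic means.\<close>
  have tangent: "1 / a \<ge> 2 * ?d / M - a * (?d / M)\<^sup>2" if "a > 0" for a
  proof -
    define u where "u = ?d / M"
    have "(1 - a * u)\<^sup>2 \<ge> 0" by simp
    then have "2 * u * a - a * u\<^sup>2 * a \<le> 1" by (simp add: power2_eq_square algebra_simps)
    then have "2 * u - a * u\<^sup>2 \<le> 1 / a" using that by (simp add: field_simps)
    then show ?thesis by (simp add: u_def)
  qed
  have "?d * (?d / M) = (\<Sum>i\<in>(UNIV::'d set). 2 * ?d / M - (real (N i) + 2) * (?d / M)\<^sup>2)"
  proof -
    have "(\<Sum>i\<in>(UNIV::'d set). 2 * ?d / M - (real (N i) + 2) * (?d / M)\<^sup>2)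
       = ?d * (2 * ?d / M) - M * (?d / M)\<^sup>2"
      by (simp add: sum_subtractf sum_distrib_right[symmetric] sum.distrib M_def)
    also have "\<dots> = ?d * (?d / M)" using M by (simp add: power2_eq_square field_simps)
    finally show ?thesis by simp
  qed
  also have "\<dots> \<le> (\<Sum>i\<in>(UNIV::'d set). 1 / (real (N i) + 2))"
    by (intro sum_mono tangent) auto
  finally have harm: "?d * (?d / M) \<le> (\<Sum>i\<in>(UNIV::'d set). 1 / (real (N i) + 2))" .
  have "(\<Sum>i\<in>UNIV. 1 / ?d * V (N(i := Suc (N i)))) \<le> (\<Sum>i\<in>(UNIV::'d set). 1 / ?d * (V N * (1 - 1 / 2 * (1 / (real (N i) + 2)))))"
    by (intro sum_mono mult_left_mono V1) auto
  also have "\<dots> = V N * (1 - 1 / 2 * ((\<Sum>i\<in>(UNIV::'d set). 1 / (real (N i) + 2)) / ?d))"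
  proof -
    have "1 / ?d * (V N * (1 - 1 / 2 * q)) = V N / ?d - V N / (2 * ?d) * q" for q
      using d by (simp add: field_simps)
    then have "(\<Sum>i\<in>(UNIV::'d set). 1 / ?d * (V N * (1 - 1 / 2 * (1 / (real (N i) + 2)))))
        = (\<Sum>i\<in>(UNIV::'d set). V N / ?d - V N / (2 * ?d) * (1 / (real (N i) + 2)))" by (simp only:)
    also have "\<dots> = V N - V N / (2 * ?d) * (\<Sum>i\<in>(UNIV::'d set). 1 / (real (N i) + 2))"
      unfolding sum_subtractf sum_distrib_left[symmetric] using d by simp
    finally show ?thesis by (simp add: right_diff_distrib)
  qed
  also have "\<dots> \<le> V N * (1 - 1 / 2 * (?d / M))"
  proof (intro mult_left_mono diff_left_mono V0)
    show "?d / M \<le> (\<Sum>i\<in>(UNIV::'d set). 1 / (real (N i) + 2)) / ?d"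
      using harm d by (simp add: pos_le_divide_eq mult_ac)
  qed auto
  finally show ?thesis by simp
qed

text \<open>From \<open>ln (1 + 1 / M) \<le> 1 / M\<close> the first factor is at most
  \<open>(M / (M + 1)) powr a\<close>, and the product telescopes.\<close>

lemma powr_ratio_step:
  fixes M a :: real
  assumes "M > 0" "a > 0" "n \<ge> 0"
  shows "(1 - a / M) * ((M + 1) / (M + 1 + n)) powr a \<le> (M / (M + 1 + n)) powr a"
proof -
  have "ln (1 + 1 / M) \<le> 1 / M" using assms by (intro ln_add_one_self_le_self) auto
  then have "- (1 / M) \<le> ln (M / (M + 1))"
    using assms by (simp add: ln_div field_simps)
  then have "1 - a / M \<le> 1 + a * ln (M / (M + 1))"
    using assms mult_left_mono[of "- (1 / M)" "ln (M / (M + 1))" a] by simp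
  also have "\<dots> \<le> exp (a * ln (M / (M + 1)))" by (rule exp_ge_add_one_self)
  also have "\<dots> = (M / (M + 1)) powr a" using assms by (simp add: powr_def)
  finally have "(1 - a / M) * ((M + 1) / (M + 1 + n)) powr a \<le> (M / (M + 1)) powr a * ((M + 1) / (M + 1 + n)) powr a"
    by (intro mult_right_mono) auto
  also have "\<dots> = (M / (M + 1) * ((M + 1) / (M + 1 + n))) powr a"
    by (rule powr_mult[symmetric])
  also have "M / (M + 1) * ((M + 1) / (M + 1 + n)) = M / (M + 1 + n)" using assms by simp
  finally show ?thesis .
qed

text \<open>The right-hand side is a supersolution of the recursion: after \<open>m\<close> steps
  the mean of \<open>1 / (N i + 2)\<close> is at least \<open>CARD('d) / (m + 2 * CARD('d))\<close>, whatever their distribution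
  among the coordinates.\<close>

lemma box_kernel_decay:
  fixes N :: "'d::finite \<Rightarrow> nat"
  shows "(chain_op (+) ^^ n) (box_kernel N y) x
    \<le> (((\<Sum>i\<in>UNIV. real (N i)) + 2 * real CARD('d)) / ((\<Sum>i\<in>UNIV. real (N i)) + 2 * real CARD('d) + real n)) powr (real CARD('d) / 2)
      * (\<Prod>i\<in>UNIV. 1 / sqrt (real (N i) + 1))"
proof (induction n arbitrary: N)
  case 0
  have "(\<Sum>i\<in>UNIV. real (N i)) + 2 * real CARD('d) > 0"
    by (intro add_nonneg_pos sum_nonneg) auto
  moreover have "box_kernel N y x \<le> (\<Prod>i\<in>UNIV. 1 / sqrt (real (N i) + 1))"
    unfolding box_kernel_def by (intro prod_mono) (auto simp: line_kernel_le line_kernel_nonneg)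
  ultimately show ?case by simp
next
  case (Suc n)
  define M where "M = (\<Sum>i\<in>UNIV. real (N i)) + 2 * real CARD('d)"
  define V where "V = (\<lambda>N :: 'd \<Rightarrow> nat. \<Prod>i\<in>UNIV. 1 / sqrt (real (N i) + 1))"
  have M: "M > 0" unfolding M_def by (intro add_nonneg_pos sum_nonneg) auto
  have V0: "V N \<ge> 0" for N unfolding V_def by (intro prod_nonneg) auto
  have M1: "(\<Sum>j\<in>UNIV. real ((N(i := Suc (N i))) j)) + 2 * real CARD('d) = M + 1" for i
  proof -
    have "(\<Sum>j\<in>UNIV. real ((N(i := Suc (N i))) j)) = (\<Sum>j\<in>UNIV. real (N j) + (if j = i then 1 else 0))"
      by (intro sum.cong) auto
    then show ?thesis by (simp add: M_def sum.distrib)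
  qed
  have IH: "(chain_op (+) ^^ n) (box_kernel (N(i := Suc (N i))) y) x
      \<le> ((M + 1) / (M + 1 + real n)) powr (real CARD('d) / 2) * V (N(i := Suc (N i)))" for i
    using Suc.IH[of "N(i := Suc (N i))"] unfolding M1 by (simp only: V_def)
  have "(chain_op (+) ^^ Suc n) (box_kernel N y) x = (\<Sum>i\<in>UNIV. 1 / real CARD('d) * (chain_op (+) ^^ n) (box_kernel (N(i := Suc (N i))) y) x)"
    unfolding funpow_Suc_right comp_def chain_op_box_kernel chain_op_pow_sum chain_op_pow_cmult ..
  also have "\<dots> \<le> (\<Sum>i\<in>UNIV. 1 / real CARD('d) * (((M + 1) / (M + 1 + real n)) powr (real CARD('d) / 2) * V (N(i := Suc (N i)))))"
    by (intro sum_mono mult_left_mono IH) auto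
  also have "\<dots> = ((M + 1) / (M + 1 + real n)) powr (real CARD('d) / 2) * (\<Sum>i\<in>UNIV. 1 / real CARD('d) * V (N(i := Suc (N i))))"
    unfolding sum_distrib_left by (simp only: mult_ac)
  also have "\<dots> \<le> ((M + 1) / (M + 1 + real n)) powr (real CARD('d) / 2) * (V N * (1 - real CARD('d) / 2 / M))"
    using box_weight_mean[of N] unfolding V_def M_def by (intro mult_left_mono) auto
  also have "\<dots> = (1 - real CARD('d) / 2 / M) * ((M + 1) / (M + 1 + real n)) powr (real CARD('d) / 2) * V N"
    by (simp add: mult_ac)
  also have "\<dots> \<le> (M / (M + 1 + real n)) powr (real CARD('d) / 2) * V N"
    using M V0 by (intro mult_right_mono powr_ratio_step) auto
  finally show ?case unfolding M_def V_def by (simp add: add_ac)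
qed

lemma walk_kernel_decay:
  fixes x y :: "'d::finite site"
  shows "(chain_op (+) ^^ n) (\<lambda>x. if x = y then 1 else 0) x
    \<le> (2 * real CARD('d) / (2 * real CARD('d) + real n)) powr (real CARD('d) / 2)"
proof -
  have "box_kernel (\<lambda>_. 0) y = (\<lambda>x. if x = y then 1 else 0)"
    by (auto simp: box_kernel_def fun_eq_iff vec_eq_iff prod_zero_iff)
  then show ?thesis using box_kernel_decay[of n "\<lambda>_. 0" y x] by simp
qed

section \<open>Exponential moments of the range\<close>

text \<open>The range alone is not a Markov chain; together with the current position it is.\<close>

definition visit :: "'d::finite site set \<times> 'd site \<Rightarrow> 'd site \<Rightarrow> 'd site set \<times> 'd site"
  where "visit s e = (insert (snd s + e) (fst s), snd s + e)"

definition range_weight :: "real \<Rightarrow> 'd::finite site set \<times> 'd site \<Rightarrow> real"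
  where "range_weight \<gamma> s = \<gamma> ^ card (fst s)"

lemma run_visit:
  "run visit \<xi> ({v}, v) n = ((\<lambda>n. v + (\<Sum>k<n. \<xi> k)) ` {..n}, v + (\<Sum>k<n. \<xi> k))"
  by (induction n) (auto simp: visit_def atMost_Suc add.assoc)

lemma visit_position: "(chain_op visit ^^ n) (\<lambda>s. h (snd s)) s = (chain_op (+) ^^ n) h (snd s)"
  by (induction n arbitrary: s) (auto simp: chain_op_def visit_def)

text \<open>A walk that finds no new site during \<open>n\<close> steps is at time \<open>n\<close> in the set \<open>A\<close> already visited.\<close>

lemma range_weight_block:
  fixes A :: "'d::finite site set"
  assumes \<gamma>: "0 < \<gamma>" "\<gamma> < 1" and A: "finite A" "x \<in> A"
    and spread: "real (card A) * (2 * real CARD('d) / (2 * real CARD('d) + real n)) powr (real CARD('d) / 2) \<le> 1 / 2"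
  shows "(chain_op visit ^^ n) (range_weight \<gamma>) (A, x) \<le> \<gamma> ^ card A * ((1 + \<gamma>) / 2)"
proof -
  let ?\<kappa> = "(2 * real CARD('d) / (2 * real CARD('d) + real n)) powr (real CARD('d) / 2)"
  \<comment> \<open>A position outside \<open>A\<close> at the end means at least one new site,
    hence an extra factor of at most the base. The indicator of \<open>A\<close> is written as a sum
    over single sites so that each term is a heat kernel.\<close>
  let ?g = "\<lambda>s :: 'd site set \<times> 'd site. \<gamma> ^ card A * (\<gamma> + (1 - \<gamma>) * (\<Sum>y\<in>A. if snd s = y then 1 else 0))"
  have "(chain_op visit ^^ n) (range_weight \<gamma>) (A, x) \<le> (chain_op visit ^^ n) ?g (A, x)"
  proof (rule chain_op_pow_mono[where P="\<lambda>s. finite (fst s) \<and> A \<subseteq> fst s \<and> snd s \<in> fst s"])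
    fix s :: "'d site set \<times> 'd site"
    assume s: "finite (fst s) \<and> A \<subseteq> fst s \<and> snd s \<in> fst s"
    have *: "(\<Sum>y\<in>A. if snd s = y then 1 else 0 :: real) = (if snd s \<in> A then 1 else 0)"
      using A by simp
    show "range_weight \<gamma> s \<le> ?g s"
    proof (cases "snd s \<in> A")
      case True
      have "card A \<le> card (fst s)" using s by (intro card_mono) auto
      then have "\<gamma> ^ card (fst s) \<le> \<gamma> ^ card A" using \<gamma> by (intro power_decreasing) auto
      then show ?thesis unfolding range_weight_def * using True by simp
    next
      case False
      then have "Suc (card A) = card (insert (snd s) A)" using A by simp
      also have "\<dots> \<le> card (fst s)" using s by (intro card_mono) auto
      finally have "\<gamma> ^ card (fst s) \<le> \<gamma> ^ Suc (card A)" using \<gamma> by (intro power_decreasing) auto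
      then show ?thesis unfolding range_weight_def * using False by (simp add: mult.commute)
    qed
  qed (use A in \<open>auto simp: visit_def\<close>)
  also have "\<dots> = \<gamma> ^ card A * (\<gamma> + (1 - \<gamma>) * (\<Sum>y\<in>A. (chain_op (+) ^^ n) (\<lambda>x. if x = y then 1 else 0) x))"
    unfolding chain_op_pow_cmult chain_op_pow_add chain_op_pow_const chain_op_pow_sum
    by (subst visit_position) simp
  also have "\<dots> \<le> \<gamma> ^ card A * (\<gamma> + (1 - \<gamma>) * (\<Sum>y\<in>A. ?\<kappa>))"
    using \<gamma> by (intro mult_left_mono add_left_mono sum_mono walk_kernel_decay) auto
  also have "\<dots> \<le> \<gamma> ^ card A * (\<gamma> + (1 - \<gamma>) * (1 / 2))"
    using \<gamma> spread by (intro mult_left_mono add_left_mono) auto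
  also have "\<dots> = \<gamma> ^ card A * ((1 + \<gamma>) / 2)" by (simp add: field_simps)
  finally show ?thesis .
qed

lemma range_weight_le:
  fixes A :: "'d::finite site set"
  assumes \<gamma>: "0 < \<gamma>" "\<gamma> < 1" and A: "finite A"
  shows "(chain_op visit ^^ n) (range_weight \<gamma>) (A, x) \<le> \<gamma> ^ card A"
proof -
  have "(chain_op visit ^^ n) (range_weight \<gamma>) (A, x) \<le> (chain_op visit ^^ n) (\<lambda>_. \<gamma> ^ card A) (A, x)"
  proof (rule chain_op_pow_mono[where P="\<lambda>s. finite (fst s) \<and> A \<subseteq> fst s"])
    fix s :: "'d site set \<times> 'd site" assume "finite (fst s) \<and> A \<subseteq> fst s"
    then show "range_weight \<gamma> s \<le> \<gamma> ^ card A"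
      unfolding range_weight_def using \<gamma> by (intro power_decreasing card_mono) auto
  qed (use A in \<open>auto simp: visit_def\<close>)
  then show ?thesis by (simp add: chain_op_pow_const)
qed

text \<open>As long as at most \<open>N\<close> sites are known, every block of \<open>l\<close>
  steps gains the factor \<open>(1 + \<gamma>) / 2\<close>; once more are known, the weight is below
  \<open>\<gamma> ^ N\<close> for good.\<close>

lemma range_weight_blocks:
  fixes A :: "'d::finite site set"
  assumes \<gamma>: "0 < \<gamma>" "\<gamma> < 1" and A: "finite A" "x \<in> A"
    and spread: "real N * (2 * real CARD('d) / (2 * real CARD('d) + real l)) powr (real CARD('d) / 2) \<le> 1 / 2"
  shows "(chain_op visit ^^ (k * l)) (range_weight \<gamma>) (A, x) \<le> \<gamma> ^ card A * ((1 + \<gamma>) / 2) ^ k + \<gamma> ^ N"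
  using A
proof (induction k arbitrary: A x)
  case 0
  then show ?case using \<gamma> by (simp add: range_weight_def)
next
  case (Suc k)
  let ?\<kappa> = "(2 * real CARD('d) / (2 * real CARD('d) + real l)) powr (real CARD('d) / 2)"
  let ?\<rho> = "(1 + \<gamma>) / 2"
  have \<rho>: "0 \<le> ?\<rho>" using \<gamma> by simp
  show ?case
  proof (cases "card A \<le> N")
    case True
    have "real (card A) * ?\<kappa> \<le> real N * ?\<kappa>" using True by (intro mult_right_mono) auto
    then have sp: "real (card A) * ?\<kappa> \<le> 1 / 2" using spread by linarith
    have "(chain_op visit ^^ (Suc k * l)) (range_weight \<gamma>) (A, x)
        = (chain_op visit ^^ l) ((chain_op visit ^^ (k * l)) (range_weight \<gamma>)) (A, x)"
      by (simp add: funpow_add)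
    also have "\<dots> \<le> (chain_op visit ^^ l) (\<lambda>s. ?\<rho> ^ k * range_weight \<gamma> s + \<gamma> ^ N) (A, x)"
    proof (rule chain_op_pow_mono[where P="\<lambda>s. finite (fst s) \<and> snd s \<in> fst s"])
      fix s :: "'d site set \<times> 'd site" assume "finite (fst s) \<and> snd s \<in> fst s"
      then have "(chain_op visit ^^ (k * l)) (range_weight \<gamma>) (fst s, snd s) \<le> \<gamma> ^ card (fst s) * ?\<rho> ^ k + \<gamma> ^ N"
        by (intro Suc.IH) auto
      then show "(chain_op visit ^^ (k * l)) (range_weight \<gamma>) s \<le> ?\<rho> ^ k * range_weight \<gamma> s + \<gamma> ^ N"
        unfolding range_weight_def[of \<gamma> s] prod.collapse by (simp only: mult.commute)
    qed (use Suc.prems in \<open>auto simp: visit_def\<close>)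
    also have "\<dots> = ?\<rho> ^ k * (chain_op visit ^^ l) (range_weight \<gamma>) (A, x) + \<gamma> ^ N"
      by (simp add: chain_op_pow_add chain_op_pow_cmult chain_op_pow_const)
    also have "\<dots> \<le> ?\<rho> ^ k * (\<gamma> ^ card A * ?\<rho>) + \<gamma> ^ N"
      using \<rho> by (intro add_right_mono mult_left_mono range_weight_block \<gamma> Suc.prems sp) auto
    finally show ?thesis by (simp add: mult_ac)
  next
    case False
    have "(chain_op visit ^^ (Suc k * l)) (range_weight \<gamma>) (A, x) \<le> \<gamma> ^ card A"
      using Suc.prems \<gamma> by (intro range_weight_le) auto
    also have "\<dots> \<le> \<gamma> ^ N" using False \<gamma> by (intro power_decreasing) auto
    also have "\<dots> \<le> \<gamma> ^ card A * ?\<rho> ^ Suc k + \<gamma> ^ N" using \<gamma> by simp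
    finally show ?thesis .
  qed
qed

lemma range_weight_decay:
  assumes \<gamma>: "0 < \<gamma>" "\<gamma> < 1"
  shows "\<exists>K c. 0 < K \<and> 0 < c \<and> (\<forall>t\<ge>1. (chain_op visit ^^ t) (range_weight \<gamma>) ({0 :: 'd::finite site}, 0)
      \<le> K * exp (- c * real t powr (real CARD('d) / (real CARD('d) + 2))))"
proof -
  define d where "d = real CARD('d)"
  define \<rho> where "\<rho> = (1 + \<gamma>) / 2"
  have d: "d \<ge> 1" by (simp add: d_def Suc_le_eq)
  have \<rho>: "0 < \<rho>" "\<rho> < 1" using \<gamma> by (auto simp: \<rho>_def)
  \<comment> \<open>The two rates come from the number of blocks, at least
    \<open>a / (9 * d) - 1\<close>, and from the threshold \<open>N\<close>, at least
    \<open>a - 1\<close>; \<open>K\<close> absorbs both losses of 1.\<close>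
  define c where "c = min (- ln \<rho> / (9 * d)) (- ln \<gamma>)"
  define K where "K = 1 / \<rho> + 1 / \<gamma>"
  have c: "0 < c" using \<gamma> \<rho> d by (auto simp: c_def intro!: divide_neg_pos)
  have K: "0 < K" using \<gamma> \<rho> by (auto simp: K_def intro!: add_pos_pos)
  have "(chain_op visit ^^ t) (range_weight \<gamma>) ({0 :: 'd site}, 0) \<le> K * exp (- c * real t powr (d / (d + 2)))"
    if t: "t \<ge> 1" for t
  proof -
    define \<alpha> where "\<alpha> = d / (d + 2)"
    \<comment> \<open>The scales solve \<open>a * b = t\<close> and
      \<open>b powr (d / 2) = a\<close>: blocks of length of order \<open>b\<close> are just long
      enough to escape from about \<open>a\<close> known sites, and about \<open>a\<close> of them
      fit into time \<open>t\<close>.\<close>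
    define b where "b = real t powr (2 / (d + 2))"
    define a where "a = real t powr \<alpha>"
    have b: "b \<ge> 1" unfolding b_def using t d by (intro ge_one_powr_ge_zero) auto
    have a: "a \<ge> 1" unfolding a_def \<alpha>_def using t d by (intro ge_one_powr_ge_zero) auto
    have ab: "a * b = real t"
    proof -
      have "\<alpha> + 2 / (d + 2) = 1" using d by (simp add: \<alpha>_def add_divide_distrib[symmetric])
      then show ?thesis using t by (simp add: a_def b_def powr_add[symmetric])
    qed
    have "2 / (d + 2) * (d / 2) = \<alpha>" using d by (simp add: \<alpha>_def divide_simps)
    then have ba: "b powr (d / 2) = a" by (simp only: a_def b_def powr_powr)
    define N where "N = nat \<lfloor>a\<rfloor>"
    \<comment> \<open>The 8 makes the base of the kernel bound at most \<open>1 / (4 * b)\<close>,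
      and its power \<open>d / 2\<close> at most \<open>1 / (2 * a)\<close> since
      \<open>d \<ge> 1\<close>. Rounding up costs at most the step from 8 to 9, as
      \<open>d * b \<ge> 1\<close>.\<close>
    define l where "l = nat \<lceil>8 * d * b\<rceil>"
    have N: "real N \<le> a" "a - 1 \<le> real N" unfolding N_def using a by linarith+
    have db: "d * b \<ge> 1" using mult_mono[of 1 d 1 b] d b by simp
    have l: "8 * d * b \<le> real l" "real l \<le> 9 * d * b" "l > 0"
      unfolding l_def using db by linarith+
    have spread: "real N * (2 * real CARD('d) / (2 * real CARD('d) + real l)) powr (real CARD('d) / 2) \<le> 1 / 2"
    proof -
      have "2 * d / (2 * d + real l) \<le> 2 * d / (8 * d * b)"
        using d b l by (intro divide_left_mono) auto
      also have "\<dots> = 1 / 4 * (1 / b)" using d by simp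
      finally have "(2 * d / (2 * d + real l)) powr (d / 2) \<le> (1 / 4 * (1 / b)) powr (d / 2)"
        using d by (intro powr_mono2) auto
      also have "\<dots> = (1 / 4) powr (d / 2) * (1 / b) powr (d / 2)" by (rule powr_mult)
      also have "(1 / b) powr (d / 2) = 1 / a" using b ba by (simp add: powr_divide)
      also have "(1 / 4) powr (d / 2) * (1 / a) \<le> 1 / 2 * (1 / a)"
      proof (rule mult_right_mono)
        have "(1 / 4) powr (d / 2) \<le> (1 / 4 :: real) powr (1 / 2)"
          using d by (intro powr_mono') auto
        also have "(1 / 4 :: real) powr (1 / 2) = 1 / 2"
          by (simp add: powr_half_sqrt real_sqrt_divide)
        finally show "(1 / 4) powr (d / 2) \<le> (1 / 2 :: real)" .
      qed (use a in simp)
      finally have "(2 * d / (2 * d + real l)) powr (d / 2) \<le> 1 / 2 * (1 / a)" .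
      then have "real N * (2 * d / (2 * d + real l)) powr (d / 2) \<le> a * (1 / 2 * (1 / a))"
        using N a by (intro mult_mono) auto
      then show ?thesis using a by (simp add: d_def)
    qed
    have ca: "c * a \<le> (- ln \<rho> / (9 * d)) * a" "c * a \<le> (- ln \<gamma>) * a"
      using a by (auto intro!: mult_right_mono simp only: c_def min.cobounded1 min.cobounded2)
    define k where "k = t div l"
    have "real t = real (k * l) + real (t mod l)" unfolding k_def by (metis of_nat_add div_mult_mod_eq)
    also have "\<dots> \<le> real k * real l + real l" using l(3) by (simp add: less_imp_le)
    also have "\<dots> \<le> (real k + 1) * (9 * d * b)" using l by (simp add: distrib_right mult_mono add_mono mult_left_mono)
    finally have "a * b \<le> ((real k + 1) * (9 * d)) * b" unfolding ab by (simp add: mult_ac)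
    then have "a \<le> (real k + 1) * (9 * d)" using b by (simp only: mult_le_cancel_right_pos)
    then have k: "a / (9 * d) - 1 \<le> real k" using d by (simp add: field_simps)
    have "(chain_op visit ^^ t) (range_weight \<gamma>) ({0 :: 'd site}, 0)
        = (chain_op visit ^^ (k * l)) ((chain_op visit ^^ (t mod l)) (range_weight \<gamma>)) ({0 :: 'd site}, 0)"
      unfolding k_def by (metis comp_apply div_mult_mod_eq funpow_add)
    also have "\<dots> \<le> (chain_op visit ^^ (k * l)) (range_weight \<gamma>) ({0 :: 'd site}, 0)"
    proof (rule chain_op_pow_mono[where P="\<lambda>s. finite (fst s)"])
      fix s :: "'d site set \<times> 'd site" assume "finite (fst s)"
      then show "(chain_op visit ^^ (t mod l)) (range_weight \<gamma>) s \<le> range_weight \<gamma> s"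
        using range_weight_le[OF \<gamma>, of "fst s" "t mod l" "snd s"] by (simp add: range_weight_def)
    qed (auto simp: visit_def)
    also have "\<dots> \<le> \<gamma> ^ card {0 :: 'd site} * \<rho> ^ k + \<gamma> ^ N"
      unfolding \<rho>_def by (rule range_weight_blocks[OF \<gamma> _ _ spread]) auto
    also have "\<dots> \<le> \<rho> ^ k + \<gamma> ^ N" using \<gamma> \<rho> by (simp add: mult_left_le_one_le)
    also have "\<dots> \<le> 1 / \<rho> * exp (- c * a) + 1 / \<gamma> * exp (- c * a)"
    proof (intro add_mono)
      have "\<rho> ^ k = \<rho> powr real k" using \<rho> by (simp add: powr_realpow)
      also have "\<dots> \<le> \<rho> powr (a / (9 * d) - 1)" using \<rho> k by (intro powr_mono') auto
      also have "\<dots> = 1 / \<rho> * exp (- (- ln \<rho> / (9 * d)) * a)"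
        using \<rho> by (simp add: powr_diff) (simp add: powr_def)
      also have "\<dots> \<le> 1 / \<rho> * exp (- c * a)"
      proof (rule mult_left_mono)
        show "exp (- (- ln \<rho> / (9 * d)) * a) \<le> exp (- c * a)"
          using ca(1) by (simp only: exp_le_cancel_iff mult_minus_left neg_le_iff_le)
      qed (use \<rho> in simp)
      finally show "\<rho> ^ k \<le> 1 / \<rho> * exp (- c * a)" .
      have "\<gamma> ^ N = \<gamma> powr real N" using \<gamma> by (simp add: powr_realpow)
      also have "\<dots> \<le> \<gamma> powr (a - 1)" using \<gamma> N by (intro powr_mono') auto
      also have "\<dots> = 1 / \<gamma> * exp (- (- ln \<gamma>) * a)"
        using \<gamma> by (simp add: powr_diff) (simp add: powr_def)
      also have "\<dots> \<le> 1 / \<gamma> * exp (- c * a)"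
      proof (rule mult_left_mono)
        show "exp (- (- ln \<gamma>) * a) \<le> exp (- c * a)"
          using ca(2) by (simp only: exp_le_cancel_iff mult_minus_left neg_le_iff_le)
      qed (use \<gamma> in simp)
      finally show "\<gamma> ^ N \<le> 1 / \<gamma> * exp (- c * a)" .
    qed
    also have "\<dots> = K * exp (- c * a)" by (simp add: K_def distrib_right)
    finally show ?thesis by (simp add: a_def \<alpha>_def)
  qed
  then show ?thesis using c K unfolding d_def by blast
qed

section \<open>Upper bound by exploration\<close>

text \<open>Makes the union over \<open>h\<close> increasing, so a bound uniform in \<open>h\<close>
  passes to it without loss.\<close>

lemma exploration_mono: "exploration h S Q1 Q2 b \<subseteq> exploration (Suc h) S Q1 Q2 b"
proof (induction h arbitrary: S Q1 Q2 b)
  case (Suc h)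
  consider "Q2 \<noteq> {}" | "Q2 = {}" "Q1 \<noteq> {}" | "Q2 = {}" "Q1 = {}" by blast
  then show ?case
  proof cases
    case 1
    note step = exploration_attach[OF refl 1]
    show ?thesis unfolding step[of h] step[of "Suc h"]
      by (intro Un_mono UN_mono Int_mono Suc.IH order.refl)
  next
    case 2
    note step = exploration_label[OF refl 2(2)]
    show ?thesis unfolding 2(1) step[of h] step[of "Suc h"]
      by (intro Un_mono UN_mono Int_mono Suc.IH order.refl)
  qed auto
qed auto

lemma measurable_prefix: "(\<lambda>g. map g [0..<n]) \<in> measurable (paths :: 'd::finite path measure) (count_space UNIV)"
proof (rule measurableI)
  fix A :: "'d site list set"
  show "(\<lambda>g. map g [0..<n]) -` A \<inter> space paths \<in> sets (paths :: 'd path measure)"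
    using sets_paths_prefix[of "\<lambda>l. l \<in> A" n] by (simp add: vimage_def)
qed simp

lemma measurable_range: "(\<lambda>g. g ` {..t}) \<in> measurable (paths :: 'd::finite path measure) (count_space UNIV)"
proof -
  have "(\<lambda>g. set (map g [0..<Suc t])) \<in> measurable (paths :: 'd path measure) (count_space UNIV)"
    by (rule measurable_compose[OF measurable_prefix]) simp
  then show ?thesis by (simp add: lessThan_Suc_atMost atLeast0LessThan del: upt_Suc)
qed

lemma nn_integral_range:
  assumes "0 \<le> \<gamma>"
  shows "(\<integral>\<^sup>+g. ennreal (\<gamma> ^ card (g ` {..t})) \<partial>walk_law (v :: 'd::finite site))
    = ennreal ((chain_op visit ^^ t) (range_weight \<gamma>) ({v}, v))"
proof -
  have m: "(\<lambda>g. ennreal (\<gamma> ^ card (g ` {..t}))) \<in> borel_measurable (paths :: 'd path measure)"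
    by (rule measurable_compose[OF measurable_range]) simp
  have "(\<integral>\<^sup>+g. ennreal (\<gamma> ^ card (g ` {..t})) \<partial>walk_law v)
     = (\<integral>\<^sup>+\<xi>. ennreal (range_weight \<gamma> (run visit \<xi> ({v}, v) t)) \<partial>steps_law)"
    unfolding walk_law_def by (subst nn_integral_distr) (use m in \<open>auto simp: run_visit range_weight_def\<close>)
  also have "\<dots> = ennreal ((chain_op visit ^^ t) (range_weight \<gamma>) ({v}, v))"
    using assms by (intro nn_integral_run) (auto simp: range_weight_def)
  finally show ?thesis .
qed

text \<open>Common frame of both upper bounds. For each possible range \<open>R\<close> of the
  origin's car, the event \<open>E R\<close> does not read the origin; the car and its walk split
  off, leaving \<open>p\<close> and the mean of \<open>\<gamma> ^ card R\<close> over the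
  walk.\<close>

lemma unparked_range_bound:
  fixes E :: "'d::finite site set \<Rightarrow> 'd config set"
  assumes p: "0 \<le> p" "p \<le> 1" and K: "0 \<le> K" and \<gamma>: "0 \<le> \<gamma>"
    and sets: "\<And>R. E R \<in> sets (parking_measure p)"
    and inv: "\<And>R \<omega> y. 0 \<in> R \<Longrightarrow> fun_upd \<omega> 0 y \<in> E R \<longleftrightarrow> \<omega> \<in> E R"
    and bound: "\<And>R. finite R \<Longrightarrow> 0 \<in> R \<Longrightarrow> emeasure (parking_measure p) (E R) \<le> ennreal (K * \<gamma> ^ card R)"
    and E: "\<And>\<omega>. regular \<omega> \<Longrightarrow> 0 \<in> unparked \<omega> t \<Longrightarrow> \<omega> \<in> E (walk \<omega> 0 ` {..t})"
  shows "measure (parking_measure p) {\<omega> :: 'd config. 0 \<in> unparked \<omega> t}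
    \<le> p * (K * (chain_op visit ^^ t) (range_weight \<gamma>) ({0 :: 'd site}, 0))"
proof -
  let ?P = "parking_measure p :: 'd config measure"
  interpret prob_space ?P by (rule prob_space_parking_measure)
  let ?I = "{R :: 'd site set. finite R \<and> 0 \<in> R}"
  have B: "{g. g ` {..t} = R} \<in> sets (paths :: 'd path measure)" for R
    using measurable_sets[OF measurable_range, of "{R}" t] by (simp add: vimage_def)
  let ?U = "\<Union>R\<in>?I. {\<omega>. init \<omega> 0 = 1 \<and> walk \<omega> 0 \<in> {g. g ` {..t} = R}} \<inter> E R"
  let ?m = "(chain_op visit ^^ t) (range_weight \<gamma>) ({0 :: 'd site}, 0)"
  have U: "?U \<in> sets ?P \<and> emeasure ?P ?U \<le> ennreal (p * K * ?m)"
  proof (rule emeasure_UN_cars[OF p countable_finite_sets K, where v="\<lambda>_. 0" and h="\<lambda>R. \<gamma> ^ card R"])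
    have "(\<integral>\<^sup>+R. emeasure (walk_law 0) {g. g ` {..t} = R} * ennreal (\<gamma> ^ card R) \<partial>count_space ?I)
       = (\<integral>\<^sup>+g. \<integral>\<^sup>+R. indicator {g. g ` {..t} = R} g * ennreal (\<gamma> ^ card R) \<partial>count_space ?I \<partial>walk_law 0)"
      by (rule nn_integral_count_space_emeasure) (simp_all add: B)
    also have "\<dots> \<le> (\<integral>\<^sup>+g. ennreal (\<gamma> ^ card (g ` {..t})) \<partial>walk_law (0 :: 'd site))"
    proof (intro nn_integral_mono)
      fix g :: "nat \<Rightarrow> 'd site"
      let ?r = "g ` {..t}"
      have "(\<integral>\<^sup>+R. indicator {g. g ` {..t} = R} g * ennreal (\<gamma> ^ card R) \<partial>count_space ?I)
        = (\<integral>\<^sup>+R. ennreal (\<gamma> ^ card ?r) * indicator {?r} R \<partial>count_space ?I)"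
        by (intro nn_integral_cong) (auto simp: indicator_def)
      also have "\<dots> \<le> (\<integral>\<^sup>+R. ennreal (\<gamma> ^ card ?r) * indicator {?r} R \<partial>count_space UNIV)"
        by (rule nn_integral_count_space_mono_set) simp
      also have "\<dots> = ennreal (\<gamma> ^ card ?r)"
        by (subst nn_integral_cmult_indicator) auto
      finally show "(\<integral>\<^sup>+R. indicator {g. g ` {..t} = R} g * ennreal (\<gamma> ^ card R) \<partial>count_space ?I) \<le> ennreal (\<gamma> ^ card ?r)" .
    qed
    also have "\<dots> = ennreal ?m" by (rule nn_integral_range[OF \<gamma>])
    finally show "(\<integral>\<^sup>+R. emeasure (walk_law 0) {g. g ` {..t} = R} * ennreal (\<gamma> ^ card R) \<partial>count_space ?I) \<le> ennreal ?m" .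
  qed (use B sets inv bound \<gamma> in auto)
  have "AE \<omega> in ?P. \<omega> \<in> {\<omega>. 0 \<in> unparked \<omega> t} \<longrightarrow> \<omega> \<in> ?U"
    using AE_regular[OF p]
  proof eventually_elim
    case (elim \<omega>)
    show ?case
    proof
      assume "\<omega> \<in> {\<omega>. 0 \<in> unparked \<omega> t}"
      then have u: "0 \<in> unparked \<omega> t" by simp
      have "init \<omega> 0 = 1" using u unparked_antimono[of 0 t \<omega>] by (auto simp: unparked_0)
      moreover have "0 \<in> walk \<omega> 0 ` {..t}" using elim by (auto simp: regular_def intro!: image_eqI[of _ _ 0])
      ultimately show "\<omega> \<in> ?U" using E[OF elim u] by auto
    qed
  qed
  then have "emeasure ?P {\<omega>. 0 \<in> unparked \<omega> t} \<le> emeasure ?P ?U"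
    using U by (intro emeasure_mono_AE) auto
  also have "\<dots> \<le> ennreal (p * (K * ?m))" using U by (simp add: mult.assoc)
  finally show ?thesis
    unfolding emeasure_eq_measure using p K \<gamma>
    by (subst (asm) ennreal_le_iff)
       (auto intro!: mult_nonneg_nonneg chain_op_nonneg simp: range_weight_def)
qed

lemma unparked_bound_exploration:
  assumes p: "0 \<le> p" "p \<le> 1" and z: "1 \<le> z" and T: "0 < T" "T < 1" and L: "0 \<le> L"
    and attach_budget: "1 + p * z * L\<^sup>2 / (1 - T)\<^sup>2 \<le> L"
    and label_budget: "L * ((1 - p) / z + p * z / (1 - T)) \<le> T"
  shows "measure (parking_measure p) {\<omega> :: 'd::finite config. 0 \<in> unparked \<omega> t}
    \<le> p * (L / T * (chain_op visit ^^ t) (range_weight T) ({0 :: 'd site}, 0))"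
proof -
  let ?E = "\<lambda>R :: 'd site set. if finite R \<and> 0 \<in> R then \<Union>h. exploration h R (R - {0}) {0} 0 else {}"
  let ?P = "parking_measure p :: 'd config measure"
  interpret prob_space ?P by (rule prob_space_parking_measure)
  have e: "exploration h R (R - {0}) {0} 0 \<in> sets ?P \<and> emeasure ?P (exploration h R (R - {0}) {0} 0) \<le> ennreal (T ^ card (R - {0}) * L ^ card {0 :: 'd site} * z powi 0)"
    if "finite R" "0 \<in> R" for R h
    using that T by (intro emeasure_exploration p z L attach_budget label_budget) auto
  show ?thesis
  proof (rule unparked_range_bound[where E="?E"])
    show "?E R \<in> sets ?P" for R
      using e by auto
    show "fun_upd \<omega> 0 y \<in> ?E R
        \<longleftrightarrow> \<omega> \<in> ?E R" if "0 \<in> R" for R \<omega> y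
      using that exploration_upd[of "R - {0}" R "{0}" 0 \<omega> y] by auto
    show "emeasure ?P (?E R) \<le> ennreal (L / T * T ^ card R)"
      if R: "finite R" "0 \<in> R" for R
    proof -
      have "card R = Suc (card (R - {0}))" using R by (metis card_Suc_Diff1)
      \<comment> \<open>The origin starts in \<open>Q2\<close> instead of \<open>Q1\<close>, which
        exchanges one factor \<open>T\<close> for \<open>L\<close>.\<close>
      then have "T ^ card (R - {0}) * L ^ card {0 :: 'd site} * z powi 0 = L / T * T ^ card R" using T by simp
      then have "emeasure ?P (exploration h R (R - {0}) {0} 0) \<le> ennreal (L / T * T ^ card R)" for h
        using e[OF R, of h] by simp
      moreover have "emeasure ?P (\<Union>h. exploration h R (R - {0}) {0} 0) = (SUP h. emeasure ?P (exploration h R (R - {0}) {0} 0))"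
      proof (rule SUP_emeasure_incseq[symmetric])
        show "incseq (\<lambda>h. exploration h R (R - {0}) {0} 0)" by (intro incseq_SucI exploration_mono)
      qed (use e[OF R] in auto)
      ultimately show ?thesis using R by (auto intro: SUP_least)
    qed
    show "\<omega> \<in> ?E (walk \<omega> 0 ` {..t})"
      if "regular \<omega>" "0 \<in> unparked \<omega> t" for \<omega> :: "'d config"
    proof -
      have "0 \<in> walk \<omega> 0 ` {..t}" using that by (auto simp: regular_def intro!: image_eqI[of _ _ 0])
      then show ?thesis using unparked_exploration[OF that] by auto
    qed
  qed (use p T L in auto)
qed

text \<open>The first step always finds a second site. This controls small \<open>t\<close>, where a
  decay with a multiplicative constant says nothing.\<close>

lemma range_weight_positive_time:
  assumes "0 < \<gamma>" "\<gamma> < 1" "1 \<le> t"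
  shows "(chain_op visit ^^ t) (range_weight \<gamma>) ({0 :: 'd::finite site}, 0) \<le> \<gamma>\<^sup>2"
proof -
  from assms(3) obtain s where s: "t = Suc s" by (cases t) auto
  have ax: "(chain_op visit ^^ s) (range_weight \<gamma>) ({axis i x, 0 :: 'd site}, axis i x) \<le> \<gamma>\<^sup>2" if "x \<noteq> 0" for i x
  proof -
    have "card {axis i x, 0 :: 'd site} = 2" using that by (simp add: axis_eq_0_iff)
    then show ?thesis using range_weight_le[OF assms(1,2), of "{axis i x, 0 :: 'd site}" s "axis i x"] by simp
  qed
  have "(chain_op visit ^^ t) (range_weight \<gamma>) ({0 :: 'd site}, 0)
      = (\<Sum>i\<in>(UNIV::'d set). (chain_op visit ^^ s) (range_weight \<gamma>) ({axis i 1, 0}, axis i 1)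
        + (chain_op visit ^^ s) (range_weight \<gamma>) ({axis i (-1), 0}, axis i (-1))) / (2 * real CARD('d))"
    by (simp add: s chain_op_def[of visit "(chain_op visit ^^ s) _"] step_mean_def visit_def)
  also have "\<dots> \<le> (\<Sum>i\<in>(UNIV::'d set). \<gamma>\<^sup>2 + \<gamma>\<^sup>2) / (2 * real CARD('d))"
    by (intro divide_right_mono sum_mono add_mono ax) auto
  also have "\<dots> = \<gamma>\<^sup>2" by simp
  finally show ?thesis .
qed

section \<open>Lower bound\<close>

lemma emeasure_init_finite:
  assumes p: "0 \<le> p" "p \<le> 1" and J: "finite J"
  shows "{\<omega> :: 'd::finite config. \<forall>v\<in>J. init \<omega> v \<in> A} \<in> sets (parking_measure p) \<and>
    emeasure (parking_measure p) {\<omega> :: 'd config. \<forall>v\<in>J. init \<omega> v \<in> A} = emeasure (init_law p) A ^ card J"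
  using J
proof (induction J rule: finite_induct)
  case empty
  interpret prob_space "parking_measure p :: 'd config measure" by (rule prob_space_parking_measure)
  show ?case using emeasure_space_1 sets.top[of "parking_measure p :: 'd config measure"] by simp
next
  case (insert v J)
  let ?F = "{\<omega> :: 'd config. \<forall>v\<in>J. init \<omega> v \<in> A}"
  have inv: "fun_upd \<omega> v y \<in> ?F \<longleftrightarrow> \<omega> \<in> ?F" for \<omega> y
    using insert.hyps(2) by (auto simp: init_def)
  have "{\<omega>. \<forall>v\<in>insert v J. init \<omega> v \<in> A} = {\<omega>. init \<omega> v \<in> A} \<inter> ?F" by auto
  then show ?case
    using emeasure_init_site[OF conjunct1[OF insert.IH] inv, of A] insert by simp
qed

definition cube :: "nat \<Rightarrow> 'd::finite site set"
  where "cube r = {x. \<forall>i. x $ i \<in> {- int r..int r}}"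

lemma finite_cube: "finite (cube r)"
  unfolding cube_def by (rule finite_vec_box) simp

lemma card_cube: "card (cube r :: 'd::finite site set) = (2 * r + 1) ^ CARD('d)"
  unfolding cube_def by (subst card_vec_box) (simp add: nat_add_distrib nat_mult_distrib)

definition confine :: "nat \<Rightarrow> 'd::finite site \<times> bool \<Rightarrow> 'd site \<Rightarrow> 'd site \<times> bool"
  where "confine r s e = (fst s + e, snd s \<and> fst s + e \<in> cube r)"

lemma run_confine:
  "run (confine r) \<xi> (0, True) n = ((\<Sum>k<n. \<xi> k), \<forall>m\<le>n. (\<Sum>k<m. \<xi> k) \<in> cube r)"
  by (induction n) (auto simp: confine_def le_Suc_eq cube_def)

text \<open>The eigenfunction of the walk killed outside \<open>cube r\<close>.\<close>

definition cos_product :: "real \<Rightarrow> 'd::finite site \<Rightarrow> real"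
  where "cos_product \<theta> x = (\<Prod>i\<in>UNIV. cos (\<theta> * real_of_int (x $ i)))"

lemma step_mean_cos_product:
  "step_mean (\<lambda>e. cos_product \<theta> (x + e)) = cos \<theta> * cos_product \<theta> (x :: 'd::finite site)"
proof -
  have "cos_product \<theta> (x + axis i 1) + cos_product \<theta> (x + axis i (-1)) = 2 * cos \<theta> * cos_product \<theta> x" for i
  proof -
    let ?r = "\<Prod>j\<in>UNIV - {i}. cos (\<theta> * real_of_int (x $ j))"
    have 1: "cos_product \<theta> (x + axis i s) = cos (\<theta> * real_of_int (x $ i + s)) * ?r" for s
      unfolding cos_product_def
      by (subst prod.remove[of UNIV i]) (auto simp: axis_def intro!: prod.cong arg_cong2[where f="(*)"])
    have 2: "cos_product \<theta> x = cos (\<theta> * real_of_int (x $ i)) * ?r"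
      unfolding cos_product_def by (subst prod.remove[of UNIV i]) auto
    have "\<theta> * real_of_int (x $ i + 1) = \<theta> * real_of_int (x $ i) + \<theta>" "\<theta> * real_of_int (x $ i + - 1) = \<theta> * real_of_int (x $ i) - \<theta>"
      by (auto simp: algebra_simps)
    then show ?thesis unfolding 1 2 by (simp add: cos_add cos_diff algebra_simps)
  qed
  then show ?thesis unfolding step_mean_def by (simp flip: distrib_left)
qed

lemma cos_product_le_1: "cos_product \<theta> x \<le> 1"
proof -
  have "\<bar>cos_product \<theta> x\<bar> \<le> 1" unfolding cos_product_def abs_prod by (intro prod_le_1) auto
  then show ?thesis by simp
qed

text \<open>The angle makes \<open>cos_product\<close> vanish on the sites one step outside the
  cube, so killing the walk there keeps the eigenvalue \<open>cos (\<theta> r)\<close>. The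
  eigenfunction is 1 at the origin and nowhere larger, so it can be replaced by the survival
  indicator.\<close>

lemma confine_lower_bound:
  defines "\<theta> r \<equiv> pi / (2 * (real r + 1))"
  shows "cos (\<theta> r) ^ n \<le> (chain_op (confine r) ^^ n) (\<lambda>s. if snd s then 1 else 0) (0 :: 'd::finite site, True)"
proof -
  let ?\<theta> = "\<theta> r"
  let ?F = "\<lambda>s :: 'd site \<times> bool. if snd s then cos_product ?\<theta> (fst s) else 0"
  let ?P = "\<lambda>s :: 'd site \<times> bool. snd s \<longrightarrow> fst s \<in> cube r"
  have \<theta>: "?\<theta> > 0" "?\<theta> * (real r + 1) = pi / 2" by (auto simp: \<theta>_def field_simps)
  have \<theta>1: "?\<theta> \<le> pi / 2" using \<theta> by (simp add: \<theta>_def field_simps)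
  have c0: "0 \<le> cos ?\<theta>" using \<theta> \<theta>1 by (intro cos_ge_zero) auto
  have step: "confine r s e = (fst s + e, snd s \<and> fst s + e \<in> cube r)" for s :: "'d site \<times> bool" and e
    by (rule confine_def)
  have P: "?P (confine r s e)" for s e by (simp add: step)
  have "chain_op (confine r) ?F s = cos ?\<theta> * ?F s" if "?P s" for s
  proof (cases "snd s")
    case True
    \<comment> \<open>A unit step can leave the cube only through the coordinate it changes, which
      then equals \<open>r + 1\<close> up to sign.\<close>
    have boundary: "(if fst s + axis i u \<in> cube r then cos_product ?\<theta> (fst s + axis i u) else 0) = cos_product ?\<theta> (fst s + axis i u)"
      if u: "u = 1 \<or> u = -1" for i u
    proof (cases "fst s + axis i u \<in> cube r")
      case False
      have "fst s $ i + u = int r + 1 \<or> fst s $ i + u = - (int r + 1)"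
      proof -
        obtain j where j: "\<not> (- int r \<le> (fst s + axis i u) $ j \<and> (fst s + axis i u) $ j \<le> int r)"
          using False by (auto simp: cube_def)
        have b: "- int r \<le> fst s $ j \<and> fst s $ j \<le> int r" using \<open>?P s\<close> True by (auto simp: cube_def)
        then have "j = i" using j by (auto simp: axis_def split: if_splits)
        then show ?thesis using j b u by (auto simp: axis_def)
      qed
      then have "real_of_int (fst s $ i + u) = real r + 1 \<or> real_of_int (fst s $ i + u) = - (real r + 1)" by force
      then have "cos (?\<theta> * real_of_int (fst s $ i + u)) = 0" 
        using \<theta>(2) by (metis cos_minus cos_pi_half mult_minus_right)
      then have "cos_product ?\<theta> (fst s + axis i u) = 0"
        unfolding cos_product_def by (intro prod_zero) (auto simp: axis_def intro!: bexI[of _ i])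
      then show ?thesis by simp
    qed simp
    have "chain_op (confine r) ?F s = step_mean (\<lambda>e. if fst s + e \<in> cube r then cos_product ?\<theta> (fst s + e) else 0)"
      unfolding chain_op_def by (simp add: step True cong: if_cong)
    also have "\<dots> = step_mean (\<lambda>e. cos_product ?\<theta> (fst s + e))"
      unfolding step_mean_def by (simp only: boundary simp_thms)
    finally show ?thesis using True by (simp add: step_mean_cos_product)
  qed (simp add: chain_op_def step)
  then have UF: "(chain_op (confine r) ^^ n) ?F s = cos ?\<theta> ^ n * ?F s" if "?P s" for s
    using that
  proof (induction n arbitrary: s)
    case (Suc n)
    have "(chain_op (confine r) ^^ Suc n) ?F s = step_mean (\<lambda>e. (chain_op (confine r) ^^ n) ?F (confine r s e))"
      by (simp add: chain_op_def[of _ "(chain_op _ ^^ n) _"])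
    also have "\<dots> = step_mean (\<lambda>e. cos ?\<theta> ^ n * ?F (confine r s e))"
      using Suc.IH[OF Suc.prems(1) P] by simp
    also have "\<dots> = cos ?\<theta> ^ n * chain_op (confine r) ?F s"
      by (simp only: step_mean_cmult chain_op_def)
    also have "\<dots> = cos ?\<theta> ^ Suc n * ?F s" using Suc.prems by simp
    finally show ?case .
  qed simp
  have "0 \<in> (cube r :: 'd site set)" by (simp add: cube_def)
  then have "cos ?\<theta> ^ n = (chain_op (confine r) ^^ n) ?F (0, True)"
    by (subst UF) (auto simp: cos_product_def)
  also have "\<dots> \<le> (chain_op (confine r) ^^ n) (\<lambda>s. if snd s then 1 else 0) (0 :: 'd site, True)"
  proof (rule chain_op_pow_mono[where P="?P"])
    show "?F s \<le> (if snd s then 1 else 0)" for s :: "'d site \<times> bool"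
      using cos_product_le_1[of ?\<theta> "fst s"] by simp
  qed (use \<open>0 \<in> cube r\<close> P in auto)
  finally show ?thesis .
qed

lemma cos_lower_bound:
  assumes "0 \<le> x" "x \<le> 1"
  shows "exp (- x\<^sup>2) \<le> cos (x :: real)"
proof -
  have x2: "x\<^sup>2 \<le> 1" using assms by (simp add: power_le_one)
  have "- (x\<^sup>2 / 2) - 2 * (x\<^sup>2 / 2)\<^sup>2 \<le> ln (1 - x\<^sup>2 / 2)"
    using x2 by (intro ln_one_minus_pos_lower_bound) auto
  moreover have "2 * (x\<^sup>2 / 2)\<^sup>2 \<le> x\<^sup>2 / 2"
    using x2 mult_left_mono[of "x\<^sup>2" 1 "x\<^sup>2"] by (simp add: power2_eq_square)
  ultimately have "- x\<^sup>2 \<le> ln (1 - x\<^sup>2 / 2)" by linarith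
  then have "exp (- x\<^sup>2) \<le> 1 - x\<^sup>2 / 2"
    using x2 by (subst (asm) ln_ge_iff) auto
  also have "\<dots> \<le> cos x"
  proof -
    have "(sin (x / 2))\<^sup>2 \<le> (x / 2)\<^sup>2"
      using abs_sin_x_le_abs_x[of "x / 2"] by (metis abs_le_square_iff)
    moreover have "cos x = 1 - 2 * (sin (x / 2))\<^sup>2"
      using cos_double_sin[of "x / 2"] by simp
    ultimately show ?thesis by (simp add: power2_eq_square)
  qed
  finally show ?thesis .
qed

lemma unparked_in_car_cube:
  assumes cars: "\<And>v. v \<in> cube r \<Longrightarrow> init \<omega> v = 1" and stay: "\<And>k. k \<le> t \<Longrightarrow> walk \<omega> 0 k \<in> cube r"
  shows "0 \<in> unparked \<omega> t"
  using stay
proof (induction t)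
  case 0
  have "0 \<in> cube r" by (simp add: cube_def)
  then show ?case using cars by (simp add: unparked_0)
next
  case (Suc t)
  have "walk \<omega> 0 (Suc t) \<notin> vacant \<omega> 0" using cars[OF Suc.prems[OF order.refl]] by (simp add: vacant_0)
  then have "\<not> parks \<omega> 0 t" using parksD[of \<omega> 0 t] vacant_antimono[of 0 t \<omega>] by auto
  then show ?case using Suc by (simp add: unparked_Suc)
qed

text \<open>The origin's coordinate carries both a car and the confined walk, so it is treated
  separately; the other sites of the cube contribute their initial states only.\<close>

lemma unparked_lower_bound:
  assumes p: "0 \<le> p" "p \<le> 1"
  shows "p ^ card (cube r :: 'd::finite site set) * cos (pi / (2 * (real r + 1))) ^ t
    \<le> measure (parking_measure p) {\<omega> :: 'd config. 0 \<in> unparked \<omega> t}"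
proof -
  let ?P = "parking_measure p :: 'd config measure"
  interpret prob_space ?P by (rule prob_space_parking_measure)
  let ?B = "{g. \<forall>k\<le>t. g k \<in> (cube r :: 'd site set)}"
  let ?F = "{\<omega> :: 'd config. \<forall>v\<in>cube r - {0}. init \<omega> v \<in> {1}}"
  have 0: "0 \<in> (cube r :: 'd site set)" by (simp add: cube_def)
  have B: "?B \<in> sets paths"
  proof -
    have "?B = {g. (\<lambda>l. \<forall>k\<le>t. l ! k \<in> (cube r :: 'd site set)) (map g [0..<Suc t])}"
      by (simp del: upt_Suc)
    then show ?thesis using sets_paths_prefix by (simp only:)
  qed
  have F: "?F \<in> sets ?P" "emeasure ?P ?F = ennreal (p ^ card (cube r - {0} :: 'd site set))"
    using emeasure_init_finite[OF p, of "cube r - {0}" "{1}"] finite_cube p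
    by (auto simp: emeasure_init_law ennreal_power)
  have inv: "fun_upd \<omega> 0 y \<in> ?F \<longleftrightarrow> \<omega> \<in> ?F" for \<omega> y by (auto simp: init_def)
  have "emeasure (walk_law 0) ?B = (\<integral>\<^sup>+\<xi>. indicator {\<xi>. \<forall>m\<le>t. (\<Sum>k<m. \<xi> k) \<in> (cube r :: 'd site set)} \<xi> \<partial>steps_law)"
  proof -
    have "{\<xi>. \<forall>m\<le>t. (\<Sum>k<m. \<xi> k) \<in> (cube r :: 'd site set)} = (\<lambda>\<xi> n. 0 + (\<Sum>k<n. \<xi> k)) -` ?B \<inter> space steps_law" by auto
    also have "\<dots> \<in> sets steps_law" by (rule measurable_sets[OF measurable_shifted_path B])
    finally show ?thesis by (subst emeasure_walk_law[OF B]) simp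
  qed
  also have "\<dots> = (\<integral>\<^sup>+\<xi>. ennreal ((\<lambda>s. if snd s then 1 else 0) (run (confine r) \<xi> (0 :: 'd site, True) t)) \<partial>steps_law)"
    by (intro nn_integral_cong) (auto simp: run_confine indicator_def)
  also have "\<dots> = ennreal ((chain_op (confine r) ^^ t) (\<lambda>s. if snd s then 1 else 0) (0 :: 'd site, True))"
    by (rule nn_integral_run) simp
  also have "\<dots> \<ge> ennreal (cos (pi / (2 * (real r + 1))) ^ t)"
    by (intro ennreal_leI confine_lower_bound)
  finally have W: "ennreal (cos (pi / (2 * (real r + 1))) ^ t) \<le> emeasure (walk_law 0) ?B" .
  have c0: "0 \<le> cos (pi / (2 * (real r + 1)))"
    by (intro cos_ge_zero) (auto simp: field_simps)
  have card: "card (cube r :: 'd site set) = Suc (card (cube r - {0} :: 'd site set))"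
    using 0 finite_cube by (metis card_Suc_Diff1)
  have "ennreal (p ^ card (cube r :: 'd site set) * cos (pi / (2 * (real r + 1))) ^ t)
     = ennreal p * ennreal (cos (pi / (2 * (real r + 1))) ^ t) * ennreal (p ^ card (cube r - {0} :: 'd site set))"
    using p c0 by (simp add: card mult_ac flip: ennreal_mult)
  also have "\<dots> \<le> ennreal p * emeasure (walk_law 0) ?B * emeasure ?P ?F"
    unfolding F(2) by (intro mult_right_mono mult_left_mono W) auto
  also have "\<dots> = emeasure ?P ({\<omega>. init \<omega> 0 = 1 \<and> walk \<omega> 0 \<in> ?B} \<inter> ?F)"
    by (rule emeasure_car_site(1)[OF p B F(1) inv, symmetric])
  also have "\<dots> \<le> emeasure ?P {\<omega>. 0 \<in> unparked \<omega> t}"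
  proof (rule emeasure_mono)
    show "{\<omega>. init \<omega> 0 = 1 \<and> walk \<omega> 0 \<in> ?B} \<inter> ?F \<subseteq> {\<omega>. 0 \<in> unparked \<omega> t}"
    proof
      fix \<omega> assume \<omega>: "\<omega> \<in> {\<omega>. init \<omega> 0 = 1 \<and> walk \<omega> 0 \<in> ?B} \<inter> ?F"
      have "init \<omega> v = 1" if "v \<in> cube r" for v using \<omega> that by (cases "v = 0") auto
      then show "\<omega> \<in> {\<omega>. 0 \<in> unparked \<omega> t}" using \<omega> by (auto intro!: unparked_in_car_cube[of r])
    qed
  qed (use unparked_measurable in auto)
  finally show ?thesis
    unfolding emeasure_eq_measure by (subst (asm) ennreal_le_iff) auto
qed

lemma parking_lower_bound:
  assumes p: "0 < p" "p \<le> 1"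
  shows "\<exists>C>0. \<forall>t\<ge>1. exp (- C * real t powr (real CARD('d) / (real CARD('d) + 2)))
    \<le> measure (parking_measure p) {\<omega> :: 'd::finite config. 0 \<in> unparked \<omega> t}"
proof -
  define d where "d = real CARD('d)"
  have d: "d \<ge> 1" by (simp add: d_def Suc_le_eq)
  \<comment> \<open>With \<open>r\<close> the ceiling of \<open>b \<ge> 1\<close>,
    \<open>2 * r + 1 \<le> 5 * b\<close> bounds the volume of the cube by
    \<open>5 powr d * a\<close>. The 4 comes from \<open>\<theta> \<le> 2 / b\<close>, which gives
    \<open>\<theta>\<^sup>2 * t \<le> 4 * a\<close>.\<close>
  define C where "C = 5 powr d * (- ln p) + 4"
  have lnp: "0 \<le> - ln p" using p by simp
  have C: "C > 0" unfolding C_def by (intro add_nonneg_pos mult_nonneg_nonneg lnp) auto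
  have "exp (- C * real t powr (d / (d + 2))) \<le> measure (parking_measure p) {\<omega> :: 'd config. 0 \<in> unparked \<omega> t}"
    if t: "t \<ge> 1" for t
  proof -
    define a where "a = real t powr (d / (d + 2))"
    define b where "b = real t powr (1 / (d + 2))"
    have b: "b \<ge> 1" unfolding b_def using t d by (intro ge_one_powr_ge_zero) auto
    have a: "a > 0" unfolding a_def using t by simp
    have bd: "b powr d = a" using d by (simp add: a_def b_def powr_powr)
    have "d / (d + 2) + 2 * (1 / (d + 2)) = 1" using d by (simp add: divide_simps)
    then have "real t = real t powr (d / (d + 2)) * real t powr (2 * (1 / (d + 2)))"
      using t by (simp flip: powr_add)
    also have "real t powr (2 * (1 / (d + 2))) = b\<^sup>2"
      using t by (simp only: b_def powr_realpow[symmetric] powr_powr) (simp add: powr_realpow[symmetric] powr_powr mult.commute)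
    finally have tab: "real t = a * b\<^sup>2" by (simp add: a_def)
    define r where "r = nat \<lceil>b\<rceil>"
    have r: "b \<le> real r" "real r \<le> b + 1" "r \<ge> 1" unfolding r_def using b by linarith+
    define \<theta> where "\<theta> = pi / (2 * (real r + 1))"
    have \<theta>: "0 \<le> \<theta>" "\<theta> \<le> 1" "\<theta> \<le> 2 / b"
    proof -
      show "0 \<le> \<theta>" by (simp add: \<theta>_def)
      have "\<theta> \<le> 4 / (2 * (real r + 1))" unfolding \<theta>_def using pi_less_4 by (intro divide_right_mono) auto
      also have "\<dots> = 2 / (real r + 1)" by (simp add: divide_simps)
      finally have *: "\<theta> \<le> 2 / (real r + 1)" .
      also have "\<dots> \<le> 1" using r by simp
      finally show "\<theta> \<le> 1" .
      have "2 / (real r + 1) \<le> 2 / b" using r b by (intro divide_left_mono) auto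
      with * show "\<theta> \<le> 2 / b" by simp
    qed
    have "exp (- 4 * a) \<le> exp (- \<theta>\<^sup>2 * real t)"
    proof -
      have "\<theta>\<^sup>2 \<le> (2 / b)\<^sup>2" using \<theta> by (intro power_mono) auto
      then have "\<theta>\<^sup>2 * real t \<le> (2 / b)\<^sup>2 * (a * b\<^sup>2)" unfolding tab using a by (intro mult_right_mono) auto
      also have "\<dots> = 4 * a" using b by (simp add: power_divide)
      finally show ?thesis by simp
    qed
    also have "\<dots> = exp (- \<theta>\<^sup>2) ^ t" by (simp add: exp_of_nat_mult[symmetric] mult.commute)
    also have "\<dots> \<le> cos \<theta> ^ t" using \<theta> by (intro power_mono cos_lower_bound) auto
    finally have 1: "exp (- 4 * a) \<le> cos \<theta> ^ t" .
    have "real (card (cube r :: 'd site set)) = (2 * real r + 1) powr d"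
      by (simp add: card_cube d_def powr_realpow add.commute)
    also have "\<dots> \<le> (5 * b) powr d" using r b d by (intro powr_mono2) auto
    also have "\<dots> = 5 powr d * a" using b by (simp add: powr_mult bd)
    finally have 2: "real (card (cube r :: 'd site set)) \<le> 5 powr d * a" .
    have "exp (- (5 powr d * (- ln p)) * a) = exp (- ((5 powr d * a) * (- ln p)))" by (simp add: mult_ac)
    also have "\<dots> \<le> exp (- (real (card (cube r :: 'd site set)) * (- ln p)))"
      using mult_right_mono[OF 2 lnp] by simp
    also have "\<dots> = p ^ card (cube r :: 'd site set)" using p by (simp add: exp_of_nat_mult)
    finally have 3: "exp (- (5 powr d * (- ln p)) * a) \<le> p ^ card (cube r :: 'd site set)" .
    have "exp (- C * a) = exp (- (5 powr d * (- ln p)) * a) * exp (- 4 * a)"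
      unfolding exp_add[symmetric] by (simp add: C_def algebra_simps)
    also have "\<dots> \<le> p ^ card (cube r :: 'd site set) * cos \<theta> ^ t"
      using 1 3 p by (intro mult_mono) auto
    also have "\<dots> \<le> measure (parking_measure p) {\<omega> :: 'd config. 0 \<in> unparked \<omega> t}"
      unfolding \<theta>_def using p by (intro unparked_lower_bound) auto
    finally show ?thesis by (simp add: a_def)
  qed
  then show ?thesis using C unfolding d_def by blast
qed

section \<open>The one-dimensional case\<close>

definition surplus :: "'d::finite config \<Rightarrow> 'd site set \<Rightarrow> int"
  where "surplus \<omega> J = (\<Sum>v\<in>J. if init \<omega> v = 1 then 1 else -1)"

text \<open>Exponential Markov inequality: \<open>p * z + (1 - p) / z\<close> is the mean weight of
  one site. The offset \<open>c\<close> is arbitrary so that sites can be read one at a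
  time.\<close>

lemma surplus_chernoff:
  assumes p: "0 \<le> p" "p \<le> 1" and z: "1 \<le> z" and J: "finite (J :: 'd::finite site set)"
  shows "{\<omega>. 0 \<le> c + surplus \<omega> J} \<in> sets (parking_measure p) \<and>
    emeasure (parking_measure p) {\<omega>. 0 \<le> c + surplus \<omega> J} \<le> ennreal (z powi c * (p * z + (1 - p) / z) ^ card J)"
  using J
proof (induction J arbitrary: c rule: finite_induct)
  case empty
  interpret prob_space "parking_measure p :: 'd config measure" by (rule prob_space_parking_measure)
  have "1 \<le> z powi c" if "c \<ge> 0"
    using that z by (simp add: power_int_def one_le_power)
  then show ?case using emeasure_space_1 sets.top[of "parking_measure p :: 'd config measure"]
    by (cases "c \<ge> 0") (auto simp: surplus_def)
next
  case (insert v J)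
  let ?P = "parking_measure p :: 'd config measure"
  let ?F = "\<lambda>c. {\<omega>. 0 \<le> c + surplus \<omega> J}"
  let ?s = "(p * z + (1 - p) / z) ^ card J"
  have inv: "fun_upd \<omega> v y \<in> ?F c \<longleftrightarrow> \<omega> \<in> ?F c" for \<omega> y c
  proof -
    have "surplus (fun_upd \<omega> v y) J = surplus \<omega> J"
      unfolding surplus_def using insert.hyps(2) by (intro sum.cong) (auto simp: init_def)
    then show ?thesis by simp
  qed
  note IH = insert.IH
  have s: "0 \<le> ?s" using p z by (intro zero_le_power add_nonneg_nonneg) auto
  have zc: "0 < z powi c" "z powi (c + 1) = z powi c * z" "z powi (c - 1) = z powi c / z"
    using z by (auto simp: power_int_add_1 power_int_diff)
  have eq: "{\<omega>. 0 \<le> c + surplus \<omega> (insert v J)} =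
      ({\<omega>. init \<omega> v \<in> {1}} \<inter> ?F (c + 1)) \<union> ({\<omega>. init \<omega> v \<in> {i. i \<noteq> 1}} \<inter> ?F (c - 1))"
    using insert.hyps by (auto simp: surplus_def algebra_simps)
  note m1 = emeasure_init_site[OF conjunct1[OF IH[of "c + 1"]] inv, of "{1}"]
  note m2 = emeasure_init_site[OF conjunct1[OF IH[of "c - 1"]] inv, of "{i. i \<noteq> 1}"]
  have "emeasure ?P {\<omega>. 0 \<le> c + surplus \<omega> (insert v J)}
      \<le> ennreal p * emeasure ?P (?F (c + 1)) + ennreal (1 - p) * emeasure ?P (?F (c - 1))"
    unfolding eq using emeasure_subadditive[OF m1(2) m2(2)] m1(1) m2(1) p
    by (simp add: emeasure_init_law)
  also have "\<dots> \<le> ennreal p * ennreal (z powi (c + 1) * ?s) + ennreal (1 - p) * ennreal (z powi (c - 1) * ?s)"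
    using IH by (intro add_mono mult_left_mono) auto
  also have "\<dots> = ennreal (p * (z powi (c + 1) * ?s) + (1 - p) * (z powi (c - 1) * ?s))"
    using p z s zc by (simp only: ennreal_mult'[symmetric]) (intro ennreal_plus[symmetric] mult_nonneg_nonneg, auto)
  also have "p * (z powi (c + 1) * ?s) + (1 - p) * (z powi (c - 1) * ?s) = z powi c * (p * z + (1 - p) / z) ^ card (insert v J)"
    using insert.hyps by (simp add: zc distrib_left distrib_right mult_ac)
  finally show ?case using m1(2) m2(2) unfolding eq by auto
qed

abbreviation segment :: "nat \<times> nat \<Rightarrow> 'd::finite site set"
  where "segment ab \<equiv> vec ` {- int (fst ab)..int (snd ab)}"

lemma inj_vec: "inj (vec :: int \<Rightarrow> 'd::finite site)"
  by (auto simp: inj_def vec_eq_iff)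

lemma card_segment: "card (segment ab :: 'd::finite site set) = Suc (fst ab + snd ab)"
  using inj_vec by (subst card_image) (auto intro: inj_on_subset)

lemma zero_in_segment: "0 \<in> segment ab"
  by (auto intro!: image_eqI[of _ _ 0] simp: vec_eq_iff)

text \<open>Steps of size at most 1 cannot jump over the two forbidden neighbours, so being inside
  the interval never changes up to time \<open>n\<close>.\<close>

lemma path_in_segment:
  fixes g :: "nat \<Rightarrow> int"
  assumes steps: "\<And>k. \<bar>g (Suc k) - g k\<bar> \<le> 1"
    and avoid: "\<And>k. k \<le> n \<Longrightarrow> g k \<noteq> - a - 1 \<and> g k \<noteq> b + 1"
    and j: "j \<le> n" "g j \<in> {-a..b}" and k: "k \<le> n"
  shows "g k \<in> {-a..b}"
proof -
  have step: "g (Suc i) \<in> {-a..b} \<longleftrightarrow> g i \<in> {-a..b}" if "Suc i \<le> n" for i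
    using steps[of i] avoid[of i] avoid[of "Suc i"] that by auto
  have "g i \<in> {-a..b} \<longleftrightarrow> g 0 \<in> {-a..b}" if "i \<le> n" for i
    using that by (induction i) (auto simp: step simp del: atLeastAtMost_iff)
  then show ?thesis using j k by blast
qed

text \<open>\<open>D\<close> is the union of all tracks, and the segment is its maximal interval
  around the origin. The two neighbours of the segment lie on no track, so cars of \<open>G\<close>
  that park inside started inside; the spots are thus at most as many as the cars, even without the
  origin.\<close>

lemma unparked_segment:
  assumes reg: "regular (\<omega> :: 'd::finite config)" and d: "CARD('d) = 1" and u: "0 \<in> unparked \<omega> t"
  shows "\<exists>ab. walk \<omega> 0 ` {..t} \<subseteq> segment ab \<and> 0 \<le> surplus \<omega> (segment ab - {0})"
proof -
  from d obtain i where i: "UNIV = {i :: 'd}" by (metis card_1_singletonE)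
  have vec: "vec (x $ i) = x" for x :: "'d site"
    using i by (auto simp: vec_eq_iff)
  obtain G where G: "self_filling \<omega> G" "0 \<notin> G"
    "\<And>k. k \<le> t \<Longrightarrow> init \<omega> (walk \<omega> 0 k) \<noteq> 1 \<Longrightarrow> walk \<omega> 0 k \<in> park_site \<omega> ` G"
    using self_filling_range[OF reg u] by blast
  define D where "D = walk \<omega> 0 ` {..t} \<union> (\<Union>w\<in>G. walk \<omega> w ` {..park_time \<omega> w})"
  have finD: "finite D" using G(1) by (auto simp: D_def self_filling_def)
  have filled: "y \<in> park_site \<omega> ` G" if "y \<in> D" "init \<omega> y \<noteq> 1" for y
    using that G(1,3) by (auto simp: D_def self_filling_def)
  have start: "walk \<omega> v 0 = v" for v using reg by (simp add: regular_def)
  have steps: "\<bar>walk \<omega> v (Suc k) $ i - walk \<omega> v k $ i\<bar> \<le> 1" for v k using reg by (simp add: regular_def)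
  have fresh: "\<exists>n::nat. vec (s * (int n + 1)) \<notin> D" if "s \<noteq> 0" for s
  proof (rule ccontr)
    assume "\<not> ?thesis"
    then have "range (\<lambda>n::nat. vec (s * (int n + 1))) \<subseteq> D" by auto
    moreover have "inj (\<lambda>n::nat. vec (s * (int n + 1)) :: 'd site)"
      using that by (auto simp: inj_def vec_eq_iff)
    ultimately show False using finD by (metis finite_subset range_inj_infinite)
  qed
  \<comment> \<open>The least \<open>n\<close> such that \<open>n + 1\<close> is missing: the
    interval ends at \<open>b\<close> and starts at \<open>- a\<close>, and both numbers may be
    0.\<close>
  define b where "b = (LEAST n::nat. vec (1 * (int n + 1)) \<notin> D)"
  define a where "a = (LEAST n::nat. vec (-1 * (int n + 1)) \<notin> D)"
  have ends: "vec (int b + 1) \<notin> D" "vec (- int a - 1) \<notin> D"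
    using LeastI_ex[OF fresh[of 1]] LeastI_ex[OF fresh[of "-1"]] by (auto simp: a_def b_def)
  have inD: "segment (a, b) \<subseteq> D"
  proof clarify
    fix n assume n: "n \<in> {- int (fst (a, b))..int (snd (a, b))}"
    consider "n = 0" | m where "n = int m + 1" "m < b" | m where "n = - int m - 1" "m < a"
    proof -
      assume h: "n = 0 \<Longrightarrow> thesis" "\<And>m. n = int m + 1 \<Longrightarrow> m < b \<Longrightarrow> thesis" "\<And>m. n = - int m - 1 \<Longrightarrow> m < a \<Longrightarrow> thesis"
      consider "n = 0" | "n > 0" | "n < 0" by linarith
      then show thesis
      proof cases
        case 2
        then show thesis using n by (intro h(2)[of "nat (n - 1)"]) auto
      next
        case 3
        then show thesis using n by (intro h(3)[of "nat (- n - 1)"]) auto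
      qed (rule h(1))
    qed
    then show "vec n \<in> D"
    proof cases
      case 1
      have "vec 0 = (0 :: 'd site)" by (simp add: vec_eq_iff)
      then have "vec n = walk \<omega> 0 0" using 1 start by simp
      then show ?thesis by (auto simp: D_def)
    next
      case 2
      then show ?thesis using not_less_Least[of m "\<lambda>n. vec (1 * (int n + 1)) \<notin> D"] by (auto simp: b_def)
    next
      case 3
      then show ?thesis using not_less_Least[of m "\<lambda>n. vec (-1 * (int n + 1)) \<notin> D"] by (auto simp: a_def)
    qed
  qed
  have coord: "x \<in> segment (a, b) \<longleftrightarrow> x $ i \<in> {- int a..int b}" for x :: "'d site"
    using vec[of x] by (auto intro!: image_eqI[of _ _ "x $ i"])
  have avoid: "walk \<omega> w k $ i \<noteq> - int a - 1 \<and> walk \<omega> w k $ i \<noteq> int b + 1" if "walk \<omega> w k \<in> D" for w k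
    using ends that vec[of "walk \<omega> w k"] by auto
  have R: "walk \<omega> 0 ` {..t} \<subseteq> segment (a, b)"
  proof (rule image_subsetI)
    fix k assume k: "k \<in> {..t}"
    have "walk \<omega> 0 k $ i \<in> {- int a..int b}"
      by (rule path_in_segment[where n=t and j=0 and g="\<lambda>k. walk \<omega> 0 k $ i"], rule steps, rule avoid)
         (use k start in \<open>auto simp: D_def\<close>)
    then show "walk \<omega> 0 k \<in> segment (a, b)" by (simp only: coord)
  qed
  let ?cars = "{v \<in> segment (a, b) - {0}. init \<omega> v = 1}" and ?spots = "{v \<in> segment (a, b) - {0}. init \<omega> v \<noteq> 1}"
  have "?spots \<subseteq> park_site \<omega> ` ?cars"
  proof
    fix y assume y: "y \<in> ?spots"
    then have y: "y \<in> segment (a, b)" "init \<omega> y \<noteq> 1" by (simp_all only: mem_Collect_eq Diff_iff simp_thms)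
    have "y \<in> D" by (rule subsetD[OF inD y(1)])
    from filled[OF this y(2)] obtain w where w: "y = walk \<omega> w (park_time \<omega> w)" "w \<in> G" by (rule imageE)
    have "walk \<omega> w (park_time \<omega> w) $ i \<in> {- int a..int b}"
      using y(1) unfolding w(1) by (rule coord[THEN iffD1])
    then have "walk \<omega> w 0 $ i \<in> {- int a..int b}"
      by (intro path_in_segment[where n="park_time \<omega> w" and j="park_time \<omega> w" and k=0 and g="\<lambda>k. walk \<omega> w k $ i", OF steps avoid])
         (use w(2) in \<open>auto simp: D_def\<close>)
    then have "w \<in> segment (a, b)" by (simp only: coord start)
    moreover have "init \<omega> w = 1" "w \<noteq> 0" using G(1,2) w(2) by (auto simp: self_filling_def)
    ultimately have "w \<in> ?cars" by (simp only: mem_Collect_eq Diff_iff) simp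
    then show "y \<in> park_site \<omega> ` ?cars"
      unfolding w(1) by (rule imageI[where f="park_site \<omega>"])
  qed
  then have "card ?spots \<le> card ?cars" by (intro surj_card_le) auto
  moreover have "surplus \<omega> (segment (a, b) - {0}) = int (card ?cars) - int (card ?spots)"
  proof -
    have "surplus \<omega> (segment (a, b) - {0}) = (\<Sum>v\<in>?cars \<union> ?spots. if init \<omega> v = 1 then 1 else -1)"
      unfolding surplus_def by (intro sum.cong) auto
    also have "\<dots> = (\<Sum>v\<in>?cars. if init \<omega> v = 1 then 1 else -1) + (\<Sum>v\<in>?spots. if init \<omega> v = 1 then 1 else -1)"
      by (intro sum.union_disjoint) auto
    also have "(\<Sum>v\<in>?cars. if init \<omega> v = 1 then 1 else -1) = (\<Sum>v\<in>?cars. 1 :: int)" by (intro sum.cong) auto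
    also have "(\<Sum>v\<in>?spots. if init \<omega> v = 1 then 1 else -1) = (\<Sum>v\<in>?spots. - 1 :: int)" by (intro sum.cong) auto
    finally show ?thesis by simp
  qed
  ultimately show ?thesis using R by (intro exI[of _ "(a, b)"]) simp
qed

text \<open>Each site other than the origin gains \<open>\<gamma>\<^sup>2\<close>. One factor
  \<open>\<gamma>\<close> per site is kept for the size of \<open>R\<close>; the other sums over the
  two ends of the interval to \<open>1 / (1 - \<gamma>)\<^sup>2\<close>.\<close>

lemma unparked_bound_line:
  assumes d: "CARD('d) = 1" and p: "0 \<le> p" "p \<le> 1" and z: "1 \<le> z"
    and \<gamma>: "0 < \<gamma>" "\<gamma> < 1" "p * z + (1 - p) / z \<le> \<gamma>\<^sup>2"
  shows "measure (parking_measure p) {\<omega> :: 'd::finite config. 0 \<in> unparked \<omega> t}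
    \<le> p * (1 / (\<gamma> * (1 - \<gamma>)\<^sup>2) * (chain_op visit ^^ t) (range_weight \<gamma>) ({0 :: 'd site}, 0))"
proof (rule unparked_range_bound[where E = "\<lambda>R. \<Union>ab\<in>{ab. R \<subseteq> segment ab}. {\<omega>. 0 \<le> 0 + surplus \<omega> (segment ab - {0})}"])
  let ?P = "parking_measure p :: 'd config measure"
  let ?A = "\<lambda>ab. {\<omega> :: 'd config. 0 \<le> 0 + surplus \<omega> (segment ab - {0})}"
  have A: "?A ab \<in> sets ?P" "emeasure ?P (?A ab) \<le> ennreal (\<gamma>\<^sup>2 ^ (fst ab + snd ab))" for ab
  proof -
    have c: "card (segment ab - {0} :: 'd site set) = fst ab + snd ab"
      using zero_in_segment[of ab] by (subst card_Diff_singleton) (auto simp: card_segment)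
    have *: "?A ab \<in> sets ?P \<and> emeasure ?P (?A ab) \<le> ennreal (z powi 0 * (p * z + (1 - p) / z) ^ card (segment ab - {0} :: 'd site set))"
      by (rule surplus_chernoff[OF p z]) simp
    then show "?A ab \<in> sets ?P" by blast
    have "0 \<le> p * z + (1 - p) / z" using p z by simp
    then have "(p * z + (1 - p) / z) ^ (fst ab + snd ab) \<le> \<gamma>\<^sup>2 ^ (fst ab + snd ab)"
      using \<gamma>(3) by (intro power_mono) auto
    with * show "emeasure ?P (?A ab) \<le> ennreal (\<gamma>\<^sup>2 ^ (fst ab + snd ab))"
      unfolding c by (auto intro: order.trans ennreal_leI)
  qed
  show "(\<Union>ab\<in>{ab. R \<subseteq> segment ab}. ?A ab) \<in> sets ?P" for R :: "'d site set"
    using A by (intro sets.countable_UN') auto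
  show "fun_upd \<omega> 0 y \<in> (\<Union>ab\<in>{ab. R \<subseteq> segment ab}. ?A ab) \<longleftrightarrow> \<omega> \<in> (\<Union>ab\<in>{ab. R \<subseteq> segment ab}. ?A ab)" for R :: "'d site set" and \<omega> y
  proof -
    have "surplus (fun_upd \<omega> 0 y) (segment ab - {0}) = surplus \<omega> (segment ab - {0})" for ab
      unfolding surplus_def by (intro sum.cong) (auto simp: init_def)
    then show ?thesis by simp
  qed
  show "emeasure ?P (\<Union>ab\<in>{ab. R \<subseteq> segment ab}. ?A ab) \<le> ennreal (1 / (\<gamma> * (1 - \<gamma>)\<^sup>2) * \<gamma> ^ card R)"
    if R: "finite R" "0 \<in> R" for R :: "'d site set"
  proof -
    have cR: "card R = Suc (card R - 1)" using R by (metis Suc_pred' card_gt_0_iff empty_iff diff_Suc_1)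
    let ?c = "\<gamma> ^ (card R - 1)"
    have "emeasure ?P (\<Union>ab\<in>{ab. R \<subseteq> segment ab}. ?A ab) \<le> (\<integral>\<^sup>+ab. emeasure ?P (?A ab) \<partial>count_space {ab. R \<subseteq> segment ab})"
      using A by (intro emeasure_UN_count_space) auto
    also have "\<dots> \<le> (\<integral>\<^sup>+ab. ennreal ?c * (ennreal (\<gamma> ^ fst ab) * ennreal (\<gamma> ^ snd ab)) \<partial>count_space {ab. R \<subseteq> segment ab})"
    proof (rule nn_integral_mono)
      fix ab assume "ab \<in> space (count_space {ab. R \<subseteq> segment ab})"
      then have "card R \<le> card (segment ab :: 'd site set)" by (intro card_mono) auto
      then have "card R - 1 \<le> fst ab + snd ab" by (simp add: card_segment)
      \<comment> \<open>This half of the exponent is spent on \<open>R\<close>, whose size minus one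
        is at most the number of sites of the interval other than the origin.\<close>
      then have "\<gamma> ^ (fst ab + snd ab) \<le> ?c" using \<gamma> by (intro power_decreasing) auto
      then have "\<gamma> ^ (fst ab + snd ab) * \<gamma> ^ (fst ab + snd ab) \<le> ?c * \<gamma> ^ (fst ab + snd ab)"
        using \<gamma> by (intro mult_right_mono) auto
      then have "\<gamma>\<^sup>2 ^ (fst ab + snd ab) \<le> ?c * (\<gamma> ^ fst ab * \<gamma> ^ snd ab)"
        by (simp add: power2_eq_square power_mult_distrib power_add mult_ac)
      then have "ennreal (\<gamma>\<^sup>2 ^ (fst ab + snd ab)) \<le> ennreal ?c * (ennreal (\<gamma> ^ fst ab) * ennreal (\<gamma> ^ snd ab))"
        using \<gamma> by (simp add: ennreal_leI flip: ennreal_mult)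
      then show "emeasure ?P (?A ab) \<le> ennreal ?c * (ennreal (\<gamma> ^ fst ab) * ennreal (\<gamma> ^ snd ab))"
        using A(2) order.trans by blast
    qed
    also have "\<dots> \<le> (\<integral>\<^sup>+ab. ennreal ?c * (ennreal (\<gamma> ^ fst ab) * ennreal (\<gamma> ^ snd ab)) \<partial>count_space UNIV)"
      by (rule nn_integral_count_space_mono_set) simp
    also have "\<dots> = ennreal ?c * (\<integral>\<^sup>+a. ennreal (\<gamma> ^ a) * (\<integral>\<^sup>+b. ennreal (\<gamma> ^ b) \<partial>count_space UNIV) \<partial>count_space UNIV)"
      by (subst nn_integral_cmult, simp, subst nn_integral_fst_count_space[symmetric]) (simp add: nn_integral_cmult)
    also have "(\<integral>\<^sup>+b. ennreal (\<gamma> ^ b) \<partial>count_space UNIV) = ennreal (1 / (1 - \<gamma>))"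
      using \<gamma> geometric_sums[of \<gamma>] by (subst nn_integral_count_space_nat, subst suminf_ennreal2) (auto simp: sums_iff)
    also have "(\<integral>\<^sup>+a. ennreal (\<gamma> ^ a) * ennreal (1 / (1 - \<gamma>)) \<partial>count_space UNIV) = ennreal (1 / (1 - \<gamma>)) * ennreal (1 / (1 - \<gamma>))"
      using \<gamma> geometric_sums[of \<gamma>]
      by (subst nn_integral_multc, simp, subst nn_integral_count_space_nat, subst suminf_ennreal2) (auto simp: sums_iff)
    also have "ennreal ?c * \<dots> = ennreal (1 / (\<gamma> * (1 - \<gamma>)\<^sup>2) * \<gamma> ^ card R)"
    proof -
      have "?c * (1 / (1 - \<gamma>) * (1 / (1 - \<gamma>))) = 1 / (\<gamma> * (1 - \<gamma>)\<^sup>2) * \<gamma> ^ card R"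
        using \<gamma> by (subst (2) cR) (simp add: power2_eq_square)
      then show ?thesis using \<gamma> by (metis ennreal_mult' zero_le_power less_imp_le diff_gt_0_iff_gt divide_nonneg_nonneg zero_le_one)
    qed
    finally show ?thesis .
  qed
  show "\<omega> \<in> (\<Union>ab\<in>{ab. walk \<omega> 0 ` {..t} \<subseteq> segment ab}. ?A ab)"
    if "regular \<omega>" "0 \<in> unparked \<omega> t" for \<omega> :: "'d config"
    using unparked_segment[OF that(1) d that(2)] by auto
qed (use p \<gamma> in auto)

text \<open>Covers small \<open>t\<close>, where the constant of \<open>unparked_bound_line\<close>
  may be large. If the four sites at distance 1 and 2 from the origin are spots, no other car can
  reach a neighbour of the origin at time 1, so the origin's car parks there at once. For
  \<open>p \<le> 1 / 2\<close> these four states have probability at least 1/16.\<close>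

lemma unparked_line_first_step:
  assumes d: "CARD('d) = 1" and p: "0 \<le> p" "p \<le> 1 / 2" and t: "1 \<le> t"
  shows "measure (parking_measure p) {\<omega> :: 'd::finite config. 0 \<in> unparked \<omega> t} \<le> p * (15 / 16)"
proof -
  let ?P = "parking_measure p :: 'd config measure"
  interpret prob_space ?P by (rule prob_space_parking_measure)
  have p1: "p \<le> 1" using p by simp
  from d obtain i where i: "UNIV = {i :: 'd}" by (metis card_1_singletonE)
  have vec: "vec (x $ i) = x" for x :: "'d site"
    using i by (auto simp: vec_eq_iff)
  let ?J = "vec ` {1, 2, -1, -2} :: 'd site set"
  let ?F = "{\<omega> :: 'd config. \<forall>v\<in>?J. init \<omega> v \<in> {x. x \<noteq> 1}}"
  let ?B = "{g. g 1 \<noteq> (0 :: 'd site)}"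
  have "card ?J = card {1, 2, -1, -2 :: int}" by (rule card_image) (rule inj_on_subset[OF inj_vec], simp)
  then have cardJ: "card ?J = 4" by simp
  have F: "?F \<in> sets ?P" "emeasure ?P ?F = ennreal ((1 - p) ^ 4)"
    using emeasure_init_finite[OF p(1) p1, of ?J "{x. x \<noteq> 1}"] p
    unfolding cardJ by (auto simp: emeasure_init_law ennreal_power)
  have inv: "fun_upd \<omega> 0 y \<in> ?F \<longleftrightarrow> \<omega> \<in> ?F" for \<omega> y
  proof -
    have "0 \<notin> ?J" by (auto simp: vec_eq_iff)
    then have "init (fun_upd \<omega> 0 y) v = init \<omega> v" if "v \<in> ?J" for v using that by (auto simp: init_def)
    then show ?thesis by auto
  qed
  have B: "?B \<in> sets paths"
    using sets_paths_prefix[of "\<lambda>l. l ! 1 \<noteq> (0 :: 'd site)" 2] by (simp add: numeral_2_eq_2)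
  have WB: "emeasure (walk_law 0) ?B = 1"
  proof -
    interpret W: prob_space "walk_law (0 :: 'd site)" by (rule prob_space_walk_law)
    have "AE g in walk_law (0 :: 'd site). g 1 \<noteq> 0"
    proof (rule AE_walk_law[OF B])
      fix \<xi> :: "nat \<Rightarrow> 'd site" assume "\<And>k. \<xi> k \<in> (unit_steps :: 'd site set)"
      then have "\<xi> 0 \<in> (unit_steps :: 'd site set)" by simp
      then show "0 + (\<Sum>k<1. \<xi> k) \<noteq> (0 :: 'd site)" by (auto simp: unit_steps_def axis_eq_0_iff)
    qed
    then show ?thesis using B W.emeasure_eq_1_AE[of ?B] by simp
  qed
  let ?A = "{\<omega>. init \<omega> 0 = 1 \<and> walk \<omega> 0 \<in> ?B} \<inter> ?F"
  let ?C = "{\<omega> :: 'd config. init \<omega> 0 \<in> {1}} \<inter> UNIV"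
  have U: "UNIV \<in> sets ?P" using sets.top[of ?P] by simp
  have A: "?A \<in> sets ?P" "emeasure ?P ?A = ennreal (p * (1 - p) ^ 4)"
    using emeasure_car_site[OF p(1) p1 B F(1) inv] p unfolding WB F(2)
    by (auto simp flip: ennreal_mult')
  have C: "?C \<in> sets ?P" "emeasure ?P ?C = ennreal p"
    using emeasure_init_site[OF U, where v=0 and A="{1}"] p p1 emeasure_space_1 by (auto simp: emeasure_init_law)
  have park: "0 \<notin> unparked \<omega> 1" if reg: "regular \<omega>" and \<omega>: "\<omega> \<in> ?A" for \<omega> :: "'d config"
  proof -
    have near: "\<bar>walk \<omega> w (Suc 0) $ i - w $ i\<bar> \<le> 1" for w
      using walk_displacement[OF reg, of w "Suc 0" i] by simp
    have inJ: "x \<in> ?J" if "\<bar>x $ i\<bar> \<le> 2" "x \<noteq> 0" for x :: "'d site"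
    proof -
      have "x $ i \<noteq> 0" using that(2) vec[of x] by (metis vec_component vec_eq_iff zero_index)
      then have "x $ i \<in> {1, 2, -1, -2}" using that(1) by auto
      then show ?thesis using vec[of x] by (metis imageI)
    qed
    have "walk \<omega> 0 (Suc 0) \<in> ?J" using \<omega> near[of 0] by (intro inJ) auto
    then have "walk \<omega> 0 (Suc 0) \<in> vacant \<omega> 0" using \<omega> reg by (auto simp: vacant_0 regular_def)
    moreover have "walk \<omega> w (Suc 0) \<noteq> walk \<omega> 0 (Suc 0)" if w: "w \<in> unparked \<omega> 0" "w \<noteq> 0" for w
    proof
      assume "walk \<omega> w (Suc 0) = walk \<omega> 0 (Suc 0)"
      then have "\<bar>w $ i\<bar> \<le> 2" using near[of w] near[of 0] by simp
      then have "w \<in> ?J" using w(2) by (rule inJ)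
      then show False using \<omega> w(1) by (auto simp: unparked_0)
    qed
    ultimately have "parks \<omega> 0 0" using \<omega> by (auto simp: parks_def parking_cars_def unparked_0)
    then show ?thesis by (simp add: unparked_Suc)
  qed
  have "AE \<omega> in ?P. \<omega> \<in> {\<omega>. 0 \<in> unparked \<omega> t} \<longrightarrow> \<omega> \<in> ?C - ?A"
    using AE_regular[OF p(1) p1]
  proof eventually_elim
    case (elim \<omega>)
    show ?case
    proof
      assume "\<omega> \<in> {\<omega>. 0 \<in> unparked \<omega> t}"
      then have "0 \<in> unparked \<omega> 1" "0 \<in> unparked \<omega> 0" using unparked_antimono[OF t] unparked_antimono[of 0 t \<omega>] by auto
      then show "\<omega> \<in> ?C - ?A" using park[OF elim] by (auto simp: unparked_0)
    qed
  qed
  then have "emeasure ?P {\<omega>. 0 \<in> unparked \<omega> t} \<le> emeasure ?P (?C - ?A)"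
    using A C by (intro emeasure_mono_AE) auto
  also have "\<dots> = emeasure ?P ?C - emeasure ?P ?A"
    using A C by (intro emeasure_Diff) auto
  also have "\<dots> = ennreal (p - p * (1 - p) ^ 4)"
    unfolding A(2) C(2) using p by (intro ennreal_minus) auto
  also have "\<dots> \<le> ennreal (p * (15 / 16))"
  proof (rule ennreal_leI)
    have "(1 / 2) ^ 4 \<le> (1 - p) ^ 4" using p by (intro power_mono) auto
    then have "p * (1 / 16) \<le> p * (1 - p) ^ 4" using p by (intro mult_left_mono) (auto simp: power4_eq_xxxx)
    then show "p - p * (1 - p) ^ 4 \<le> p * (15 / 16)" by simp
  qed
  finally show ?thesis unfolding emeasure_eq_measure using p by (subst (asm) ennreal_le_iff) auto
qed

section \<open>The two bounds\<close>

text \<open>Absorbs the constant \<open>K\<close>. Where \<open>ln K\<close> is at most half of the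
  exponent, the other half remains; elsewhere the exponent is bounded and
  \<open>1 - \<delta> \<le> exp (- \<delta>)\<close> suffices after lowering the rate.\<close>

lemma exp_decay_from_start:
  fixes F :: "nat \<Rightarrow> real"
  assumes K: "0 < K" and c: "0 < c" and \<delta>: "0 < \<delta>"
    and small: "\<And>t. 1 \<le> t \<Longrightarrow> F t \<le> 1 - \<delta>"
    and decay: "\<And>t. 1 \<le> t \<Longrightarrow> F t \<le> K * exp (- c * real t powr \<alpha>)"
  shows "\<exists>c'>0. \<forall>F'. \<forall>t\<ge>1. F' t \<le> F t \<longrightarrow> F' t \<le> exp (- c' * real t powr \<alpha>)"
proof -
  \<comment> \<open>The 1 keeps the divisor of the second rate positive even when
    \<open>K \<le> 1\<close>.\<close>
  define M where "M = max (ln K) 1"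
  define c' where "c' = min (c / 2) (\<delta> * c / (2 * M))"
  have M: "M \<ge> 1" "ln K \<le> M" by (auto simp: M_def)
  have c': "c' > 0" using c \<delta> M by (auto simp: c'_def)
  have "F t \<le> exp (- c' * real t powr \<alpha>)" if t: "t \<ge> 1" for t
  proof -
    define a where "a = real t powr \<alpha>"
    have a: "a > 0" using t by (simp add: a_def)
    show ?thesis
    proof (cases "ln K \<le> c / 2 * a")
      case True
      have "c' * a \<le> c / 2 * a" using a by (intro mult_right_mono) (auto simp: c'_def)
      have "F t \<le> exp (ln K) * exp (- c * a)" using decay[OF t] K by (simp add: a_def)
      also have "\<dots> = exp (ln K - c * a)" by (simp add: exp_diff exp_minus field_simps)
      also have "\<dots> \<le> exp (- c' * a)" using True \<open>c' * a \<le> c / 2 * a\<close> by simp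
      finally show ?thesis by (simp add: a_def)
    next
      case False
      have "c' * a \<le> \<delta> * c / (2 * M) * a" using a by (intro mult_right_mono) (auto simp: c'_def)
      also have "\<dots> = \<delta> / M * (c / 2 * a)" using M by (simp add: field_simps)
      also have "\<dots> \<le> \<delta> / M * M" using False M \<delta> by (intro mult_left_mono) auto
      also have "\<dots> = \<delta>" using M by simp
      finally have "c' * a \<le> \<delta>" .
      have "F t \<le> 1 - \<delta>" using small[OF t] .
      also have "\<dots> \<le> exp (- \<delta>)" using exp_ge_add_one_self[of "- \<delta>"] by simp
      also have "\<dots> \<le> exp (- c' * a)" using \<open>c' * a \<le> \<delta>\<close> by simp
      finally show ?thesis by (simp add: a_def)
    qed
  qed
  then show ?thesis using c' by (meson order.trans)
qed

lemma exp_one_lower: "2.718 \<le> exp (1 :: real)"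
proof -
  have "(\<Sum>n<7. inverse (fact n) * 1 ^ n) \<le> exp (1 :: real)"
    using sum_le_suminf[OF sums_summable[OF exp_converges[of "1 :: real"]], of "{..<7}"]
    by (simp add: exp_def)
  then show ?thesis by (simp add: numeral_eq_Suc lessThan_Suc fact_reduce)
qed

text \<open>The tilt \<open>z\<close> that minimizes \<open>q * z + (1 - q) / z\<close>.\<close>

lemma tilt:
  fixes q :: real
  assumes q: "0 < q" "q < 1 / 2"
  defines "z \<equiv> sqrt ((1 - q) / q)"
  shows "1 < z" "1 / z \<le> z" "(1 - q) / z = q * z" "q * z = sqrt (q * (1 - q))"
proof -
  show z: "1 < z" using q by (auto simp: z_def field_simps)
  show "1 / z \<le> z" using z less_1_mult[OF z z] by (simp add: divide_le_eq)
  have qz: "q * z\<^sup>2 = 1 - q" using q by (simp add: z_def)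
  then have "(1 - q) / z = q * z * z / z" by (simp only: power2_eq_square mult.assoc)
  then show "(1 - q) / z = q * z" using z by simp
  have "(q * z)\<^sup>2 = q * (q * z\<^sup>2)" by (simp add: power2_eq_square)
  then show "q * z = sqrt (q * (1 - q))"
    unfolding qz using q z by (intro real_sqrt_unique[symmetric]) auto
qed

lemma parking_upper_bound_line:
  assumes d: "CARD('d::finite) = 1" and b: "0 \<le> b" "b < 1 / 2"
  shows "\<exists>c>0. \<forall>p\<in>{0..b}. \<forall>t\<ge>1. measure (parking_measure p) {\<omega> :: 'd config. 0 \<in> unparked \<omega> t}
    \<le> p * exp (- c * real t powr (real CARD('d) / (real CARD('d) + 2)))"
proof -
  let ?a = "\<lambda>t :: nat. real t powr (real CARD('d) / (real CARD('d) + 2))"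
  \<comment> \<open>The tilt needs a positive parameter, also when \<open>b = 0\<close>; the choice
    for \<open>q\<close> then covers every \<open>p \<le> q\<close>, because the mean weight
    increases with \<open>p\<close> at fixed \<open>z \<ge> 1\<close>.\<close>
  define q where "q = max b (1 / 4)"
  have q: "0 < q" "q < 1 / 2" "b \<le> q" using b by (auto simp: q_def)
  define z where "z = sqrt ((1 - q) / q)"
  define s where "s = 2 * sqrt (q * (1 - q))"
  have s: "0 < s" "s < 1"
  proof -
    have "4 * (q * (1 - q)) < 1\<^sup>2"
    proof -
      have "0 < (1 - 2 * q)\<^sup>2" using q by simp
      then show ?thesis by (simp add: power2_eq_square algebra_simps)
    qed
    then have "sqrt (4 * (q * (1 - q))) < 1" by simp
    then show "s < 1" by (simp add: s_def real_sqrt_mult)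
    show "0 < s" using q by (simp add: s_def)
  qed
  note z = tilt[OF q(1,2), folded z_def]
  have sz: "q * z + (1 - q) / z = s" using z(3,4) by (simp add: s_def)
  define \<gamma> where "\<gamma> = sqrt s"
  have \<gamma>: "0 < \<gamma>" "\<gamma> < 1" "\<gamma>\<^sup>2 = s" using s by (auto simp: \<gamma>_def)
  define A where "A = 1 / (\<gamma> * (1 - \<gamma>)\<^sup>2)"
  have A: "A > 0" using \<gamma> by (simp add: A_def)
  obtain K c where Kc: "0 < K" "0 < c" "\<And>t. 1 \<le> t \<Longrightarrow> (chain_op visit ^^ t) (range_weight \<gamma>) ({0 :: 'd site}, 0)
      \<le> K * exp (- c * ?a t)"
    using range_weight_decay[OF \<gamma>(1,2)] by blast
  define F where "F t = min (15 / 16) (A * (chain_op visit ^^ t) (range_weight \<gamma>) ({0 :: 'd site}, 0))" for t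
  have "\<exists>c'>0. \<forall>F'. \<forall>t\<ge>1. F' t \<le> F t \<longrightarrow> F' t \<le> exp (- c' * ?a t)"
  proof (rule exp_decay_from_start[where K="A * K" and \<delta>="1 / 16"])
    show "F t \<le> A * K * exp (- c * ?a t)" if "1 \<le> t" for t
      using mult_left_mono[OF Kc(3)[OF that], of A] A by (simp add: F_def mult_ac min.coboundedI2)
  qed (use A Kc in \<open>auto simp: F_def\<close>)
  then obtain c' where c': "c' > 0" "\<And>t. 1 \<le> t \<Longrightarrow> F t \<le> exp (- c' * ?a t)"
    by blast
  have "measure (parking_measure p) {\<omega> :: 'd config. 0 \<in> unparked \<omega> t}
      \<le> p * exp (- c' * ?a t)" if p: "p \<in> {0..b}" and t: "1 \<le> t" for p t
  proof -
    have "p * z + (1 - p) / z \<le> q * z + (1 - q) / z"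
    proof -
      have "(q - p) / z \<le> (q - p) * z"
        using mult_left_mono[of "1 / z" z "q - p"] z(2) p q by simp
      then show ?thesis by (simp add: left_diff_distrib diff_divide_distrib)
    qed
    then have "p * z + (1 - p) / z \<le> \<gamma>\<^sup>2" using sz \<gamma> by simp
    then have "measure (parking_measure p) {\<omega> :: 'd config. 0 \<in> unparked \<omega> t}
       \<le> p * (A * (chain_op visit ^^ t) (range_weight \<gamma>) ({0 :: 'd site}, 0))"
      unfolding A_def using p b z \<gamma> by (intro unparked_bound_line[OF d]) auto
    moreover have "measure (parking_measure p) {\<omega> :: 'd config. 0 \<in> unparked \<omega> t} \<le> p * (15 / 16)"
      using p b t by (intro unparked_line_first_step[OF d]) auto
    ultimately have "measure (parking_measure p) {\<omega> :: 'd config. 0 \<in> unparked \<omega> t} \<le> p * F t"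
      unfolding F_def by (simp add: min_def)
    also have "\<dots> \<le> p * exp (- c' * ?a t)"
      using p c'(2)[OF t] by (intro mult_left_mono) auto
    finally show ?thesis .
  qed
  then show ?thesis using c'(1) by blast
qed

text \<open>\<open>p0 d * (1 - p0 d) = 1 / (2 * d * e)\<^sup>2\<close> by definition, and 0.092 is a
  rounded upper bound for \<open>1 / (4 * e)\<close>, the worst case \<open>d = 2\<close>.\<close>

lemma p0_dim_ge_2:
  assumes "2 \<le> d"
  shows "0 < p0 d" "p0 d < 1 / 2" "sqrt (p0 d * (1 - p0 d)) \<le> 0.092"
proof -
  define x where "x = 1 / (real d * exp 1)\<^sup>2"
  \<comment> \<open>Twice 2.718; the margin to 0.092 is small, so a cruder bound on \<open>e\<close>
    would not do.\<close>
  have "5.436 \<le> real d * exp 1"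
    using mult_mono[of 2 "real d" "2.718" "exp 1"] exp_one_lower assms by simp
  then have "5.436\<^sup>2 \<le> (real d * exp 1)\<^sup>2" by (intro power_mono) auto
  then have x: "0 < x" "x \<le> 1 / 5.436\<^sup>2"
    unfolding x_def using assms by (auto intro!: divide_left_mono)
  have x1: "x < 1" using x(2) by (simp add: power2_eq_square)
  have p0: "p0 d = (1 - sqrt (1 - x)) / 2" using assms by (simp add: p0_def x_def)
  show "0 < p0 d" "p0 d < 1 / 2" unfolding p0 using x x1 by auto
  have "p0 d * (1 - p0 d) = (1 - (sqrt (1 - x))\<^sup>2) / 4" unfolding p0 by (simp add: power2_eq_square field_simps)
  also have "\<dots> = x / 4" using x1 by simp
  also have "\<dots> \<le> 0.092\<^sup>2" using x(2) by (simp add: power2_eq_square)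
  finally show "sqrt (p0 d * (1 - p0 d)) \<le> 0.092" by (intro real_le_lsqrt) auto
qed

lemma parking_upper_bound_high_dim:
  assumes d: "2 \<le> CARD('d::finite)"
  shows "\<exists>c>0. \<forall>p\<in>{0..p0 CARD('d)}. \<forall>t\<ge>1. measure (parking_measure p) {\<omega> :: 'd config. 0 \<in> unparked \<omega> t}
    \<le> p * exp (- c * real t powr (real CARD('d) / (real CARD('d) + 2)))"
proof -
  let ?a = "\<lambda>t :: nat. real t powr (real CARD('d) / (real CARD('d) + 2))"
  define q where "q = p0 CARD('d)"
  have q: "0 < q" "q < 1 / 2" "sqrt (q * (1 - q)) \<le> 0.092"
    using p0_dim_ge_2[OF d] by (auto simp: q_def)
  define z where "z = sqrt ((1 - q) / q)"
  note z = tilt[OF q(1,2), folded z_def]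
  have s: "q * z \<le> 0.092" using q(3) z(4) by simp
  \<comment> \<open>a numerical solution of the two budgets at \<open>p * z = 0.092\<close>, which slightly exceeds \<open>1 / (4 * exp 1)\<close>\<close>
  define L :: real where "L = 1.34"
  define T :: real where "T = 0.3"
  obtain K c where Kc: "0 < K" "0 < c" "\<And>t. 1 \<le> t \<Longrightarrow> (chain_op visit ^^ t) (range_weight T) ({0 :: 'd site}, 0)
      \<le> K * exp (- c * ?a t)"
    using range_weight_decay[of T] unfolding T_def by auto
  define F where "F t = L / T * (chain_op visit ^^ t) (range_weight T) ({0 :: 'd site}, 0)" for t
  have "\<exists>c'>0. \<forall>F'. \<forall>t\<ge>1. F' t \<le> F t \<longrightarrow> F' t \<le> exp (- c' * ?a t)"
  proof (rule exp_decay_from_start[where K="L / T * K" and \<delta>="1 / 2"])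
    show "F t \<le> L / T * K * exp (- c * ?a t)" if "1 \<le> t" for t
      using mult_left_mono[OF Kc(3)[OF that], of "L / T"] by (simp add: F_def L_def T_def)
    \<comment> \<open>Two known sites give at most
      \<open>L / T * T\<^sup>2 = L * T = 0.402\<close>.\<close>
    show "F t \<le> 1 - 1 / 2" if "1 \<le> t" for t
      using range_weight_positive_time[of T t, where 'd='d] that by (simp add: F_def L_def T_def power2_eq_square)
  qed (use Kc in \<open>auto simp: L_def T_def\<close>)
  then obtain c' where c': "c' > 0" "\<And>t. 1 \<le> t \<Longrightarrow> F t \<le> exp (- c' * ?a t)"
    by blast
  have "measure (parking_measure p) {\<omega> :: 'd config. 0 \<in> unparked \<omega> t}
      \<le> p * exp (- c' * ?a t)" if p: "p \<in> {0..q}" and t: "1 \<le> t" for p t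
  proof -
    have "p * z \<le> q * z" using p z(1) by (intro mult_right_mono) auto
    then have pz: "p * z \<le> 0.092" using s by linarith
    have T7: "1 - T = 0.7" by (simp add: T_def)
    \<comment> \<open>The tilt belongs to \<open>q\<close>. For \<open>p < q\<close> the spot term
      grows by \<open>(q - p) / z\<close>, which the decrease of the car term outweighs since
      \<open>1 / z \<le> z\<close> and \<open>1 - T \<le> 1\<close>.\<close>
    have label: "(1 - p) / z + p * z / (1 - T) \<le> 0.092 + 0.092 / 0.7"
    proof -
      have "(q - p) / z \<le> (q - p) * z"
        using mult_left_mono[of "1 / z" z "q - p"] z(2) p q by simp
      also have "\<dots> \<le> (q - p) * z / 0.7" using p z(1) by simp
      finally have "(1 - p) / z + p * z / 0.7 \<le> (1 - q) / z + q * z / 0.7"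
        by (simp add: left_diff_distrib diff_divide_distrib)
      also have "\<dots> \<le> 0.092 + 0.092 / 0.7"
        unfolding z(3) by (intro add_mono divide_right_mono s) simp
      finally show ?thesis unfolding T7 .
    qed
    have "measure (parking_measure p) {\<omega> :: 'd config. 0 \<in> unparked \<omega> t} \<le> p * F t"
      unfolding F_def
    proof (rule unparked_bound_exploration)
      have "p * z * L\<^sup>2 / (1 - T)\<^sup>2 \<le> 0.092 * L\<^sup>2 / (1 - T)\<^sup>2"
        using pz by (intro divide_right_mono mult_right_mono) auto
      also have "\<dots> \<le> L - 1" by (simp add: L_def T_def power2_eq_square)
      finally show "1 + p * z * L\<^sup>2 / (1 - T)\<^sup>2 \<le> L" by linarith
      have "L * ((1 - p) / z + p * z / (1 - T)) \<le> L * (0.092 + 0.092 / 0.7)"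
        using label by (intro mult_left_mono) (auto simp: L_def)
      also have "\<dots> \<le> T" by (simp add: L_def T_def)
      finally show "L * ((1 - p) / z + p * z / (1 - T)) \<le> T" .
    qed (use p q z in \<open>auto simp: L_def T_def\<close>)
    also have "\<dots> \<le> p * exp (- c' * ?a t)"
      using p c'(2)[OF t] by (intro mult_left_mono) auto
    finally show ?thesis .
  qed
  then show ?thesis using c'(1) unfolding q_def by blast
qed

lemma parking_upper_bound:
  assumes b: "0 \<le> b" "b < p0 CARD('d::finite)"
  shows "\<exists>c>0. \<forall>p\<in>{0..b}. \<forall>t\<ge>1. measure (parking_measure p) {\<omega> :: 'd config. 0 \<in> unparked \<omega> t}
    \<le> p * exp (- c * real t powr (real CARD('d) / (real CARD('d) + 2)))"
proof (cases "CARD('d) = 1")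
  case True
  then show ?thesis using b by (intro parking_upper_bound_line) (auto simp: p0_def)
next
  case False
  moreover have "CARD('d) \<noteq> 0" by simp
  ultimately have "2 \<le> CARD('d)" by linarith
  from parking_upper_bound_high_dim[OF this] show ?thesis using b by fastforce
qed

text \<open>Choosing some rate for each \<open>p\<close> separately could be arbitrarily bad near a
  given point. A near-optimal choice is, up to a factor 2, at least any rate (capped at 1) that
  works on a whole interval, and so inherits the uniformity.\<close>

lemma locally_uniform_choice:
  fixes P :: "real \<Rightarrow> real \<Rightarrow> bool"
  assumes unif: "\<And>b. 0 \<le> b \<Longrightarrow> b < r \<Longrightarrow> \<exists>c>0. \<forall>p\<in>{0..b}. P p c"
    and anti: "\<And>p c c'. P p c \<Longrightarrow> 0 < c' \<Longrightarrow> c' \<le> c \<Longrightarrow> P p c'"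
  shows "\<exists>f. (\<forall>p. 0 \<le> p \<and> p < r \<longrightarrow> 0 < f p \<and> P p (f p)) \<and>
    (\<forall>a b. {a..b} \<subseteq> {0..<r} \<longrightarrow> (\<exists>\<epsilon>>0. \<forall>p\<in>{a..b}. \<epsilon> \<le> f p))"
proof -
  define A where "A p = {c. 0 < c \<and> c \<le> 1 \<and> P p c}" for p
  \<comment> \<open>The supremum need not be attained; half of it lies strictly below some
    admissible rate. The cap 1 in \<open>A\<close> keeps the supremum finite, notably at
    \<open>p = 0\<close>.\<close>
  define f where "f p = Sup (A p) / 2" for p
  have bdd: "bdd_above (A p)" for p by (rule bdd_aboveI[of _ 1]) (auto simp: A_def)
  have lower: "\<exists>\<epsilon>>0. \<forall>p\<in>{0..b}. \<epsilon> \<in> A p" if b: "0 \<le> b" "b < r" for b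
  proof -
    obtain c where c: "c > 0" "\<forall>p\<in>{0..b}. P p c" using unif[OF b] by blast
    have "min c 1 \<in> A p" if "p \<in> {0..b}" for p
      using c that anti[of p c "min c 1"] by (auto simp: A_def)
    then show ?thesis using c(1) by (intro exI[of _ "min c 1"]) auto
  qed
  have pos: "0 < f p \<and> P p (f p)" if p: "0 \<le> p" "p < r" for p
  proof -
    obtain \<epsilon> where \<epsilon>: "\<epsilon> > 0" "\<epsilon> \<in> A p" using lower[OF p] p by auto
    have "\<epsilon> \<le> Sup (A p)" by (rule cSup_upper[OF \<epsilon>(2) bdd])
    then have "0 < Sup (A p)" using \<epsilon>(1) by simp
    then have "f p < Sup (A p)" "0 < f p" by (auto simp: f_def)
    then obtain c where "c \<in> A p" "f p < c" using less_cSup_iff[of "A p" "f p"] \<epsilon>(2) bdd by auto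
    then show ?thesis using \<open>0 < f p\<close> anti[of p c "f p"] by (auto simp: A_def)
  qed
  moreover have "\<exists>\<epsilon>>0. \<forall>p\<in>{a..b}. \<epsilon> \<le> f p" if ab: "{a..b} \<subseteq> {0..<r}" for a b
  proof (cases "a \<le> b")
    case True
    then have "0 \<le> a" "0 \<le> b" "b < r" using ab by auto
    then obtain \<epsilon> where \<epsilon>: "\<epsilon> > 0" "\<forall>p\<in>{0..b}. \<epsilon> \<in> A p" using lower by blast
    have "\<epsilon> / 2 \<le> f p" if "p \<in> {a..b}" for p
      using cSup_upper[OF _ bdd, of \<epsilon> p] \<epsilon>(2) that \<open>0 \<le> a\<close> by (auto simp: f_def)
    then show ?thesis using \<epsilon>(1) by (intro exI[of _ "\<epsilon> / 2"]) auto
  qed (auto intro: exI[of _ 1])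
  ultimately show ?thesis by blast
qed

theorem theorem1p1:
  "(\<forall>p::real. 0 < p \<and> p \<le> 1 \<longrightarrow>
      (\<exists>C1>0. \<forall>t\<ge>1.
        \<P>(\<omega> in (parking_measure p :: 'd::finite config measure). parking_time \<omega> 0 > enat t)
          \<ge> exp (- C1 * real t powr (real CARD('d) / (real CARD('d) + 2)))))
   \<and>
   (\<exists>c2 :: real \<Rightarrow> real.
      (\<forall>p. 0 \<le> p \<and> p < p0 CARD('d) \<longrightarrow>
        c2 p > 0 \<and>
        (\<forall>t\<ge>1.
          \<P>(\<omega> in (parking_measure p :: 'd config measure). parking_time \<omega> 0 > enat t)
            \<le> p * exp (- c2 p * real t powr (real CARD('d) / (real CARD('d) + 2))))) \<and>
      (\<forall>a b. {a..b} \<subseteq> {0..<p0 CARD('d)} \<longrightarrow>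
        (\<exists>\<epsilon>>0. \<forall>p\<in>{a..b}. \<epsilon> \<le> c2 p)))"
proof -
  let ?m = "\<lambda>p t. measure (parking_measure p) {\<omega> :: 'd config. 0 \<in> unparked \<omega> t}"
  let ?a = "\<lambda>t :: nat. real t powr (real CARD('d) / (real CARD('d) + 2))"
  let ?Q = "\<lambda>p c. 0 \<le> p \<longrightarrow> (\<forall>t\<ge>1. ?m p t \<le> p * exp (- c * ?a t))"
  have eq: "\<P>(\<omega> in (parking_measure p :: 'd config measure). parking_time \<omega> 0 > enat t) = ?m p t" for p t
    by (simp add: parking_time_gt)
  have "\<exists>f. (\<forall>p. 0 \<le> p \<and> p < p0 CARD('d) \<longrightarrow> 0 < f p \<and> ?Q p (f p)) \<and>
    (\<forall>a b. {a..b} \<subseteq> {0..<p0 CARD('d)} \<longrightarrow> (\<exists>\<epsilon>>0. \<forall>p\<in>{a..b}. \<epsilon> \<le> f p))"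
  proof (rule locally_uniform_choice)
    show "\<exists>c>0. \<forall>p\<in>{0..b}. ?Q p c" if "0 \<le> b" "b < p0 CARD('d)" for b
      using parking_upper_bound[OF that] by blast
    show "?Q p c'" if "?Q p c" "0 < c'" "c' \<le> c" for p c c'
    proof (intro impI allI)
      fix t :: nat assume pt: "0 \<le> p" "1 \<le> t"
      have "c' * ?a t \<le> c * ?a t" using that(3) by (intro mult_right_mono) auto
      then have "p * exp (- c * ?a t) \<le> p * exp (- c' * ?a t)" using pt by (intro mult_left_mono) auto
      then show "?m p t \<le> p * exp (- c' * ?a t)" using that(1) pt by (meson order.trans)
    qed
  qed
  then obtain f where f: "\<And>p. 0 \<le> p \<Longrightarrow> p < p0 CARD('d) \<Longrightarrow> 0 < f p \<and> (\<forall>t\<ge>1. ?m p t \<le> p * exp (- f p * ?a t))"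
    and unif: "\<forall>a b. {a..b} \<subseteq> {0..<p0 CARD('d)} \<longrightarrow> (\<exists>\<epsilon>>0. \<forall>p\<in>{a..b}. \<epsilon> \<le> f p)"
    by metis
  show ?thesis
    unfolding eq
  proof (intro conjI exI[of _ f] unif)
    show "\<forall>p. 0 < p \<and> p \<le> 1 \<longrightarrow> (\<exists>C1>0. \<forall>t\<ge>1. exp (- C1 * ?a t) \<le> ?m p t)"
      using parking_lower_bound[where 'd='d] by simp
    show "\<forall>p. 0 \<le> p \<and> p < p0 CARD('d) \<longrightarrow> 0 < f p \<and> (\<forall>t\<ge>1. ?m p t \<le> p * exp (- f p * ?a t))"
      using f by simp
  qed
qed

end
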